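(* Let $d=3$, $\frac12<H<\frac23$ and $t>0$. Let $B^H$ be a $3$-dimensional fractional Brownian motion with Hurst parameter $H$ and, for $\epsilon>0$, let $$\hat\alpha^{(1)}_{t,\epsilon}=\int_0^t\int_0^s\partial_{x_1}\delta_\epsilon(B^H_s-B^H_r)\,dr\,ds .$$ Then, as $\epsilon\to0$, $\epsilon^{\frac52-\frac1H}\,\hat\alpha^{(1)}_{t,\epsilon}$ converges in distribution to the Gaussian law $\mathcal{N}(0,\sigma_2^2)$, where $$\sigma_2^2=\frac{(2H-1)t^{2H}}{16\pi^3H}\,B(2,2H-1)\,B\!\left(\frac1H,\frac{5H-2}{2H}\right)^2$$ and $B(\cdot,\cdot)$ is the Beta function.
   Context: A $d$-dimensional fractional Brownian motion $B^H=(B^{H,1},\dots,B^{H,d})$ with Hurst parameter $H\in(0,1)$ is an a.s. continuous centered Gaussian process whose components are independent copies of a one-dimensional fractional Brownian motion with covariance $\mathbb{E}[B^{H,j}_tB^{H,j}_s]=\tfrac12(t^{2H}+s^{2H}-|t-s|^{2H})$. For $\epsilon>0$ and $x\in\mathbb{R}^d$, $\delta_\epsilon(x)=(2\pi\epsilon)^{-d/2}e^{-|x|^2/(2\epsilon)}$. The superscript $(1)$ denotes the multi-index $(1,0,\dots,0)$, i.e. one derivative in the first coordinate. *)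

theory Defs
  imports "HOL-Probability.Probability"
begin

text \<open>
  The Gaussian law on the reals with mean \<open>m\<close> and variance \<open>v\<close>. The degenerate case is needed
  because Gaussian processes may have marginals of variance zero (for instance at time 0),
  whereas the library's \<^const>\<open>normal_density\<close> vanishes identically for standard deviation 0.
\<close>

definition gaussian_law :: "real \<Rightarrow> real \<Rightarrow> real measure" where
  "gaussian_law m v =
     (if v = 0 then return borel m
      else density lborel (\<lambda>x. ennreal (normal_density m (sqrt v) x)))"

text \<open>Centered Gaussian process on the time set \<open>[0, \<infinity>)\<close> with values in a Euclidean space:
  every finite linear combination of coordinates at finitely many times is centered Gaussian.\<close>

definition centered_gaussian_process ::
    "'a measure \<Rightarrow> (real \<Rightarrow> 'a \<Rightarrow> 'v::euclidean_space) \<Rightarrow> bool" where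
  "centered_gaussian_process M X \<longleftrightarrow>
     (\<forall>t\<ge>0. X t \<in> borel_measurable M) \<and>
     (\<forall>T c. finite T \<and> T \<subseteq> {0..} \<longrightarrow>
        (\<exists>v\<ge>0. distr M borel (\<lambda>\<omega>. \<Sum>t\<in>T. c t \<bullet> X t \<omega>) = gaussian_law 0 v))"

text \<open>In the independence clause each component is regarded as a single random element of the
  space of real functions on \<open>[0, \<infinity>)\<close> with the product sigma-algebra.\<close>

definition fractional_brownian_motion ::
    "'a measure \<Rightarrow> real \<Rightarrow> (real \<Rightarrow> 'a \<Rightarrow> real ^ 'd) \<Rightarrow> bool" where
  "fractional_brownian_motion M H B \<longleftrightarrow>
     0 < H \<and> H < 1 \<and>
     centered_gaussian_process M B \<and>
     (AE \<omega> in M. continuous_on {0..} (\<lambda>t. B t \<omega>)) \<and>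
     prob_space.indep_vars M (\<lambda>_. PiM {0..} (\<lambda>_. borel))
       (\<lambda>j \<omega>. \<lambda>t\<in>{0..}. B t \<omega> $ j) UNIV \<and>
     (\<forall>j. \<forall>s\<ge>0. \<forall>t\<ge>0.
        integral\<^sup>L M (\<lambda>\<omega>. B t \<omega> $ j * B s \<omega> $ j) =
          (t powr (2 * H) + s powr (2 * H) - \<bar>t - s\<bar> powr (2 * H)) / 2)"

definition heat_kernel :: "real \<Rightarrow> real ^ 'd \<Rightarrow> real" where
  "heat_kernel \<epsilon> x =
     (2 * pi * \<epsilon>) powr (- (real CARD('d) / 2)) * exp (- (norm x)\<^sup>2 / (2 * \<epsilon>))"

definition partial_deriv :: "'d \<Rightarrow> (real ^ 'd \<Rightarrow> real) \<Rightarrow> real ^ 'd \<Rightarrow> real" where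
  "partial_deriv j f x = deriv (\<lambda>h. f (x + h *\<^sub>R axis j 1)) 0"

definition alpha_hat ::
    "'d \<Rightarrow> (real \<Rightarrow> 'a \<Rightarrow> real ^ 'd) \<Rightarrow> real \<Rightarrow> real \<Rightarrow> 'a \<Rightarrow> real" where
  "alpha_hat j B t \<epsilon> \<omega> =
     (LINT s:{0..t}|lborel. (LINT r:{0..s}|lborel.
        partial_deriv j (heat_kernel \<epsilon>) (B s \<omega> - B r \<omega>)))"

text \<open>
  Convergence in distribution as \<open>\<epsilon> \<rightarrow> 0+\<close>, via weak convergence along every sequence
  \<open>\<epsilon>\<^sub>n \<rightarrow> 0\<close> of positive numbers. The random variables are taken on the completion of the
  probability space: \<^const>\<open>alpha_hat\<close> is controlled only on the almost sure event of
  continuous paths, so it need not be measurable for an incomplete \<open>M\<close>.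
\<close>

definition converges_in_distribution_at_0 ::
    "'a measure \<Rightarrow> (real \<Rightarrow> 'a \<Rightarrow> real) \<Rightarrow> real measure \<Rightarrow> bool" where
  "converges_in_distribution_at_0 M X \<mu> \<longleftrightarrow>
     (\<forall>\<epsilon>>0. X \<epsilon> \<in> borel_measurable (completion M)) \<and>
     (\<forall>e :: nat \<Rightarrow> real. (\<forall>n. 0 < e n) \<and> e \<longlonglongrightarrow> 0 \<longrightarrow>
        weak_conv_m (\<lambda>n. distr (completion M) borel (X (e n))) \<mu>)"

definition sigma2_squared :: "real \<Rightarrow> real \<Rightarrow> real" where
  "sigma2_squared H t =
     (2 * H - 1) * t powr (2 * H) / (16 * pi ^ 3 * H) *
     Beta 2 (2 * H - 1) * (Beta (1 / H) ((5 * H - 2) / (2 * H)))\<^sup>2"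

end

theory Submission
  imports Defs
begin

text \<open>
  With \<open>p = 2 H\<close>, the orthogonal projection of the integrand at \<open>(r, s)\<close> onto the first Wiener chaos is
  \<open>- (2 \<pi>) powr (-3/2) * (\<epsilon> + (s - r) powr p) powr (-5/2) * (B s $ 1 - B r $ 1)\<close>. Its double integral
  over the triangle is a functional of one continuous path; after swapping the integrals and
  substituting \<open>s - r = \<epsilon> powr (1/p) * x\<close>, the normalised functional converges for every path to a
  constant multiple of \<open>B t $ 1 - B 0 $ 1\<close>, which is Gaussian. The constant is the improper integral
  of \<open>x * (1 + x powr p) powr (-5/2)\<close>, a Beta value.

  What remains after the projection is negligible in mean square. The second moment is a fourfold
  integral of \<open>\<mu> * ((\<Delta> - \<mu>\<^sup>2) powr (-5/2) - \<Delta> powr (-5/2))\<close>, where \<open>\<mu>\<close> is the covariance of the increments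
  over \<open>[r, s]\<close> and \<open>[r', s']\<close> and \<open>\<Delta>\<close> is the product of their variances, each increased by \<open>\<epsilon>\<close>.
  Whether the two intervals are disjoint, overlap or are nested, the normalised integrand is at most
  a positive power of \<open>\<epsilon>\<close> times \<open>(a * b * c) powr (-\<kappa>)\<close>, where \<open>a\<close>, \<open>b\<close>, \<open>c\<close> are the consecutive gaps of
  the four end points and \<open>\<kappa> < 1\<close>; such products are integrable. The power of \<open>\<epsilon>\<close> is
  positive because \<open>1/2 < H\<close>. Elementary power inequalities take the place of local nondeterminism.
\<close>

section \<open>Power inequalities for increment covariances\<close>

text \<open>The exponent \<open>5/2 - 1/H\<close> is forced by scaling: the projected kernel
  \<open>(\<epsilon> + u powr p) powr (-5/2)\<close> meets an averaged increment of size
  \<open>u\<close>, and \<open>u = \<epsilon> powr (1/p) * x\<close> turns the product with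
  \<open>du\<close> into \<open>\<epsilon> powr (2/p - 5/2)\<close>. Two obstacles shape the bounds.
  For disjoint intervals \<open>\<mu> * \<Delta> powr (-5/2)\<close> alone has a normalised integral
  of the order of the limiting variance, so the subtraction must be exploited to gain a power of
  \<open>\<mu>\<^sup>2 / \<Delta>\<close>. For overlapping and nested intervals
  \<open>\<Delta> - \<mu>\<^sup>2\<close> may be small, and the Cauchy-Schwarz defect has to be
  measured in terms of the gaps. With \<open>\<kappa> = 1\<close> the product of gaps would just
  fail to be integrable; taking \<open>\<kappa> = 1 - \<eta>\<close> costs
  \<open>3 * \<eta> / p\<close> out of an available gain \<open>(p - 1) / p\<close>. The factor
  \<open>Beta 2 (2 * H - 1)\<close> is \<open>1 / (2 * H * (2 * H - 1))\<close>: it comes from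
  writing the variance \<open>t powr (2 * H)\<close> as a double integral of a multiple of
  \<open>\<bar>s - r\<bar> powr (2 * H - 2)\<close>. Here the variance is read off a single
  increment, so this factor only has to be evaluated at the end.\<close>

lemma mean_value_continuous:
  fixes f f' :: "real \<Rightarrow> real"
  assumes "c < a" and "continuous_on {c..a} f"
    and "\<And>x. c < x \<Longrightarrow> x < a \<Longrightarrow> (f has_real_derivative f' x) (at x)"
  obtains z where "c < z" "z < a" "f a - f c = (a - c) * f' z"
proof -
  \<comment> \<open>Powers with exponent below 1 are not differentiable at 0, so the endpoints are
    covered by continuity alone.\<close>
  have "\<exists>l z. c < z \<and> z < a \<and> DERIV f z :> l \<and> f a - f c = (a - c) * l"
    using assms by (intro MVT) (auto simp: real_differentiable_def)
  then show thesis using assms(3) that by (metis DERIV_unique)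
qed

lemma powr_half_square: "(x powr (p/2))\<^sup>2 = x powr p" for x p :: real
  by (simp add: power2_eq_square powr_add[symmetric])

text \<open>Concavity of \<open>x powr q\<close>: the increment over a step \<open>b\<close> has a
  nonpositive derivative in its base point because \<open>q - 1 \<le> 0\<close>.\<close>

lemma powr_increment_antimono:
  fixes a b c q :: real
  assumes q: "0 \<le> q" "q \<le> 1" and "0 \<le> c" "c \<le> a" "0 \<le> b"
  shows "(a + b) powr q + c powr q \<le> a powr q + (c + b) powr q"
proof (cases "b = 0 \<or> c = a \<or> q = 0")
  case True then show ?thesis using assms by (auto)
next
  case False
  then have *: "c < a" "0 < b" "0 < q" using assms by auto
  obtain z where z: "c < z" "z < a" "((a + b) powr q - a powr q) - ((c + b) powr q - c powr q)
       = (a - c) * (q * (z + b) powr (q - 1) - q * z powr (q - 1))"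
  proof (rule mean_value_continuous[OF *(1), where f="\<lambda>x. (x + b) powr q - x powr q" and
        f'="\<lambda>z. q * (z + b) powr (q - 1) - q * z powr (q - 1)"])
    show "continuous_on {c..a} (\<lambda>x. (x + b) powr q - x powr q)"
      using assms * by (intro continuous_intros continuous_on_powr') auto
    show "((\<lambda>x. (x + b) powr q - x powr q) has_real_derivative
       q * (x + b) powr (q - 1) - q * x powr (q - 1)) (at x)" if "c < x" "x < a" for x
      using assms that * by (auto intro!: derivative_eq_intros)
  qed auto
  have "(z + b) powr (q - 1) \<le> z powr (q - 1)"
    using z assms by (intro powr_mono2') auto
  then have "(a - c) * (q * (z + b) powr (q - 1) - q * z powr (q - 1)) \<le> 0"
    using * by (intro mult_nonneg_nonpos) (auto simp: mult_left_mono)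
  then show ?thesis using z by linarith
qed

text \<open>The expression is twice the covariance of increments over disjoint intervals of lengths
  \<open>u\<close>, \<open>v\<close> separated by a gap \<open>w\<close>, that is, the double
  integral of \<open>p * (p - 1) * x powr (p - 2)\<close> over their mutual distances. The kernel is
  positive and decreasing: this gives the sign, the comparison with adjacent intervals, and the
  bound by the kernel at the smallest distance.\<close>

lemma powr_second_difference:
  fixes p u v w :: real
  assumes p: "1 < p" "p \<le> 2" and "0 \<le> u" "0 \<le> v" "0 \<le> w"
  shows powr_second_difference_nonneg:
      "(u + w) powr p + (v + w) powr p \<le> (u + v + w) powr p + w powr p" (is ?goal1)
    and powr_second_difference_antimono:
      "(u + v + w) powr p + w powr p - (u + w) powr p - (v + w) powr p
         \<le> (u + v) powr p - u powr p - v powr p" (is ?goal2)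
    and powr_second_difference_le:
      "0 < w \<Longrightarrow> (u + v + w) powr p + w powr p - (u + w) powr p - (v + w) powr p
         \<le> p * (p - 1) * u * v * w powr (p - 2)"
proof -
  \<comment> \<open>One mean value step in the direction of \<open>v\<close> serves both the sign
    and the upper bound; both use nothing about \<open>z\<close> except
    \<open>w \<le> z\<close>.\<close>
  have ex: "\<exists>z. w \<le> z \<and> (u + v + w) powr p + w powr p - (u + w) powr p - (v + w) powr p
      = v * (p * (z + u) powr (p - 1) - p * z powr (p - 1))"
  proof (cases "v = 0")
    case False
    then have "w < v + w" using assms by auto
    then obtain z where "w < z" "z < v + w"
      "((v + w + u) powr p - (v + w) powr p) - ((w + u) powr p - w powr p)
         = ((v + w) - w) * (p * (z + u) powr (p - 1) - p * z powr (p - 1))"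
    proof (rule mean_value_continuous[where f="\<lambda>x. (x + u) powr p - x powr p" and
        f'="\<lambda>z. p * (z + u) powr (p - 1) - p * z powr (p - 1)"])
      show "continuous_on {w..v+w} (\<lambda>x. (x + u) powr p - x powr p)"
        using assms by (intro continuous_intros continuous_on_powr') auto
      show "((\<lambda>x. (x + u) powr p - x powr p) has_real_derivative
         p * (x + u) powr (p - 1) - p * x powr (p - 1)) (at x)" if "w < x" "x < v+w" for x
        using assms that by (auto intro!: derivative_eq_intros)
    qed
    then show ?thesis by (intro exI[of _ z]) (auto simp: algebra_simps)
  qed (auto simp: algebra_simps)
  then obtain z where z: "w \<le> z" and zeq:
     "(u + v + w) powr p + w powr p - (u + w) powr p - (v + w) powr p
      = v * (p * (z + u) powr (p - 1) - p * z powr (p - 1))" by blast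
  have "z powr (p - 1) \<le> (z + u) powr (p - 1)"
    using z assms by (intro powr_mono2) auto
  then have "0 \<le> v * (p * (z + u) powr (p - 1) - p * z powr (p - 1))"
    using assms by (intro mult_nonneg_nonneg) (auto simp: mult_left_mono)
  then show ?goal1
    using zeq by linarith
  show "(u + v + w) powr p + w powr p - (u + w) powr p - (v + w) powr p
         \<le> p * (p - 1) * u * v * w powr (p - 2)" if w: "0 < w"
  proof (cases "u = 0")
    case True then show ?thesis by auto
  next
    case False
    then have "z < z + u" using assms by auto
    then obtain y where y: "z < y" "(z + u) powr (p - 1) - z powr (p - 1) = (z + u - z) * ((p - 1) * y powr (p - 1 - 1))"
    proof (rule mean_value_continuous[where f="\<lambda>x. x powr (p - 1)" and
        f'="\<lambda>y. (p - 1) * y powr (p - 1 - 1)"])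
      show "continuous_on {z..z+u} (\<lambda>x. x powr (p - 1))"
        using assms z by (intro continuous_intros continuous_on_powr') auto
      show "((\<lambda>x. x powr (p - 1)) has_real_derivative
         (p - 1) * x powr (p - 1 - 1)) (at x)" if "z < x" "x < z + u" for x
        using assms that z by (auto intro!: derivative_eq_intros)
    qed
    have "y powr (p - 2) \<le> w powr (p - 2)" using y z w assms by (intro powr_mono2') auto
    then have "v * p * (u * ((p - 1) * y powr (p - 2))) \<le> v * p * (u * ((p - 1) * w powr (p - 2)))"
      using assms by (intro mult_left_mono) auto
    moreover have "v * (p * (z + u) powr (p - 1) - p * z powr (p - 1)) = v * p * (u * ((p - 1) * y powr (p - 2)))"
      using y(2) by (simp add: right_diff_distrib[symmetric])
    ultimately show ?thesis unfolding zeq by (simp only: mult_ac)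
  qed
  show ?goal2
  proof -
    \<comment> \<open>The gap becomes the variable: the derivative of \<open>g\<close> is a second
      difference of the concave power \<open>x powr (p - 1)\<close>, hence nonpositive.\<close>
    define g where "g = (\<lambda>w. (u + v + w) powr p + w powr p - (u + w) powr p - (v + w) powr p)"
    have "g w \<le> g 0"
    proof (cases "w = 0")
      case False
      then have "0 < w" using assms by simp
      then obtain y where y: "0 < y" "g w - g 0 = (w - 0) * (p * (u + v + y) powr (p - 1) + p * y powr (p - 1)
           - p * (u + y) powr (p - 1) - p * (v + y) powr (p - 1))"
      proof (rule mean_value_continuous[where f=g and f'="\<lambda>y. p * (u + v + y) powr (p - 1) + p * y powr (p - 1)
           - p * (u + y) powr (p - 1) - p * (v + y) powr (p - 1)"])
        show "continuous_on {0..w} g" unfolding g_def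
          using assms by (intro continuous_intros continuous_on_powr') auto
        show "(g has_real_derivative p * (u + v + x) powr (p - 1) + p * x powr (p - 1)
           - p * (u + x) powr (p - 1) - p * (v + x) powr (p - 1)) (at x)" if "0 < x" "x < w" for x
          unfolding g_def using assms that by (auto intro!: derivative_eq_intros)
      qed
      have "(u + y + v) powr (p - 1) + y powr (p - 1) \<le> (u + y) powr (p - 1) + (y + v) powr (p - 1)"
        using assms y by (intro powr_increment_antimono) auto
      then have "(u + v + y) powr (p - 1) + y powr (p - 1)
           - (u + y) powr (p - 1) - (v + y) powr (p - 1) \<le> 0" by (simp add: add_ac)
      then have "(w * p) * ((u + v + y) powr (p - 1) + y powr (p - 1)
           - (u + y) powr (p - 1) - (v + y) powr (p - 1)) \<le> 0"
        using assms by (intro mult_nonneg_nonpos) auto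
      then show ?thesis using y(2) by (simp add: algebra_simps)
    qed simp
    then show ?thesis using p by (simp add: g_def)
  qed
qed

lemma powr_one_plus_le_Bernoulli:
  fixes x q :: real
  assumes "0 \<le> x" "0 \<le> q" "q \<le> 1"
  shows "(1 + x) powr q \<le> 1 + q * x"
proof (cases "x = 0")
  case False
  then have "1 < 1 + x" using assms by simp
  then obtain z where z: "1 < z" "(1 + x) powr q - 1 powr q = (1 + x - 1) * (q * z powr (q - 1))"
    by (rule mean_value_continuous[where f="\<lambda>x. x powr q" and f'="\<lambda>z. q * z powr (q - 1)"])
       (auto intro!: derivative_eq_intros continuous_intros)
  have "z powr (q - 1) \<le> 1 powr (q - 1)" using z assms by (intro powr_mono2') auto
  then have "x * (q * z powr (q - 1)) \<le> x * (q * 1)" using assms by (intro mult_left_mono) auto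
  then show ?thesis using z by (simp add: mult_ac)
qed simp

text \<open>With \<open>x = u / v \<le> 1\<close>, Bernoulli's inequality gives
  \<open>1 + p * x + (p - 1) * x\<^sup>2\<close>, and then \<open>x \<le> x powr (p/2)\<close> and
  \<open>x\<^sup>2 \<le> x powr p\<close>. The coefficient \<open>p\<close> is what matters: it
  bounds the correlation of adjacent increments by \<open>p/2\<close>.\<close>

lemma powr_add_le_geometric:
  fixes u v p :: real
  assumes p: "1 \<le> p" "p \<le> 2" and "0 \<le> u" "0 \<le> v"
  shows "(u + v) powr p \<le> u powr p + v powr p + p * (u powr (p/2) * v powr (p/2))"
proof -
  have main: "(u + v) powr p \<le> u powr p + v powr p + p * (u powr (p/2) * v powr (p/2))"
    if uv: "0 \<le> u" "u \<le> v" for u v :: real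
  proof (cases "v = 0")
    case False
    then have v: "0 < v" using uv by simp
    define x where "x = u / v"
    have x: "0 \<le> x" "x \<le> 1" "u = x * v" using uv v by (auto simp: x_def)
    have "(1 + x) powr p = (1 + x) * (1 + x) powr (p - 1)"
      using x by (simp add: powr_mult_base)
    also have "\<dots> \<le> (1 + x) * (1 + (p - 1) * x)"
      using x p by (intro mult_left_mono powr_one_plus_le_Bernoulli) auto
    also have "\<dots> = 1 + p * x + (p - 1) * x powr 2" using x by (simp add: algebra_simps power2_eq_square powr_numeral)
    also have "x powr 2 \<le> x powr p" using x p by (cases "x = 0") (auto intro!: powr_mono' simp del: powr_numeral)
    then have "1 + p * x + (p - 1) * x powr 2 \<le> 1 + p * x + 1 * x powr p"
      using p x by (intro add_mono mult_mono) auto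
    also have "x powr 1 \<le> x powr (p/2)" using x p by (cases "x = 0") (auto intro!: powr_mono' simp del: powr_one powr_one')
    then have "1 + p * x + 1 * x powr p \<le> 1 + p * x powr (p/2) + x powr p"
      using p x by auto
    finally have "(1 + x) powr p * v powr p \<le> (1 + p * x powr (p/2) + x powr p) * v powr p"
      by (intro mult_right_mono) auto
    moreover have "(1 + x) powr p * v powr p = (u + v) powr p"
      using x v by (simp add: powr_mult[symmetric] algebra_simps)
    moreover have "v powr p = v powr (p/2) * v powr (p/2)" by (simp add: powr_add[symmetric])
    then have "(1 + p * x powr (p/2) + x powr p) * v powr p = u powr p + v powr p + p * (u powr (p/2) * v powr (p/2))"
      using x v by (simp add: powr_mult algebra_simps)
    ultimately show ?thesis by simp
  qed (use uv in auto)
  show ?thesis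
    using main[of u v] main[of v u] assms by (cases "u \<le> v") (auto simp: add_ac mult_ac)
qed

text \<open>Here \<open>b\<close> is the common part of two overlapping intervals, and the last term
  is a quantitative defect in Cauchy-Schwarz. Two estimates are added: the increments over
  \<open>a\<close> and \<open>c\<close> are at most as correlated as adjacent ones, and the standard
  deviations of the long increments differ by no more than \<open>a powr (p/2)\<close> and
  \<open>c powr (p/2)\<close> do.\<close>

lemma powr_overlap_covariance_le:
  fixes a b c p :: real
  assumes p: "1 < p" "p < 2" and abc: "0 \<le> a" "0 \<le> b" "0 \<le> c"
  shows "(a + b + c) powr p + b powr p - a powr p - c powr p
     \<le> 2 * ((a + b) * (b + c)) powr (p/2) - (2 - p) * (a * c) powr (p/2)"
proof -
  have sq: "x powr p = (x powr (p/2))\<^sup>2" for x :: real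
    by (simp add: power2_eq_square powr_add[symmetric])
  have "(a + c + b) powr p + b powr p - (a + b) powr p - (c + b) powr p
     \<le> (a + c) powr p - a powr p - c powr p"
    using assms by (intro powr_second_difference_antimono) auto
  also have "(a + c) powr p \<le> a powr p + c powr p + p * (a powr (p/2) * c powr (p/2))"
    using assms by (intro powr_add_le_geometric) auto
  finally have 1: "(a + b + c) powr p + b powr p - (a + b) powr p - (b + c) powr p
      \<le> p * (a * c) powr (p/2)" using abc by (simp add: powr_mult add_ac)
  have aux: "\<bar>(x + b) powr (p/2) - (y + b) powr (p/2)\<bar> \<le> x powr (p/2) - y powr (p/2)"
    if "0 \<le> y" "y \<le> x" for x y
    using powr_increment_antimono[of "p/2" y x b] powr_mono2[of "p/2" "y + b" "x + b"] that assms by auto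
  have "\<bar>(a + b) powr (p/2) - (b + c) powr (p/2)\<bar> \<le> \<bar>a powr (p/2) - c powr (p/2)\<bar>"
    using aux[of c a] aux[of a c] abc by (cases "c \<le> a") (auto simp: add_ac abs_minus_commute)
  then have "((a + b) powr (p/2) - (b + c) powr (p/2))\<^sup>2 \<le> (a powr (p/2) - c powr (p/2))\<^sup>2"
    by (simp add: abs_le_square_iff)
  then have "(a + b) powr p + (b + c) powr p - 2 * ((a + b) * (b + c)) powr (p/2) \<le>
      a powr p + c powr p - 2 * (a * c) powr (p/2)"
    using abc by (simp add: sq power2_diff powr_mult)
  with 1 show ?thesis by (simp add: algebra_simps)
qed

text \<open>Midpoint concavity of \<open>x \<mapsto> (x + b) powr p - x powr p\<close>, whose
  derivative is an increment of the concave power \<open>x powr (p - 1)\<close> and therefore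
  decreases.\<close>

lemma powr_nested_midpoint:
  fixes a b c p :: real
  assumes p: "1 < p" "p < 2" and abc: "0 \<le> a" "0 \<le> b" "0 \<le> c"
  shows "(a + b) powr p - a powr p + ((b + c) powr p - c powr p)
     \<le> 2 * (((a + c) / 2 + b) powr p - ((a + c) / 2) powr p)"
proof -
  have main: "(a + b) powr p - a powr p + ((c + b) powr p - c powr p)
     \<le> 2 * (((a + c) / 2 + b) powr p - ((a + c) / 2) powr p)" if ac: "0 \<le> c" "c \<le> a" for a c
  proof (cases "a = c")
    case False
    define h where "h = (a + c) / 2"
    define d where "d = (a - c) / 2"
    \<comment> \<open>\<open>g x\<close> belongs to the outer gaps \<open>h + x\<close> and
      \<open>h - x\<close>; moving them apart can only decrease it.\<close>
    define g where "g = (\<lambda>x. (h + x + b) powr p - (h + x) powr p + ((h - x + b) powr p - (h - x) powr p))"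
    have d: "0 < d" "d \<le> h" using ac False by (auto simp: d_def h_def)
    obtain x where x: "0 < x" "x < d" "g d - g 0 = (d - 0) * (p * (h + x + b) powr (p - 1) - p * (h + x) powr (p - 1)
         - p * (h - x + b) powr (p - 1) + p * (h - x) powr (p - 1))"
    proof (rule mean_value_continuous[OF d(1), where f=g and f'="\<lambda>x. p * (h + x + b) powr (p - 1) - p * (h + x) powr (p - 1)
         - p * (h - x + b) powr (p - 1) + p * (h - x) powr (p - 1)"])
      show "continuous_on {0..d} g" unfolding g_def
        using d abc p by (intro continuous_intros continuous_on_powr') auto
      show "(g has_real_derivative p * (h + x + b) powr (p - 1) - p * (h + x) powr (p - 1)
         - p * (h - x + b) powr (p - 1) + p * (h - x) powr (p - 1)) (at x)" if "0 < x" "x < d" for x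
        unfolding g_def using d abc p that by (auto intro!: derivative_eq_intros)
    qed
    have "(h + x + b) powr (p - 1) + (h - x) powr (p - 1) \<le> (h + x) powr (p - 1) + (h - x + b) powr (p - 1)"
      using x d p abc by (intro powr_increment_antimono) auto
    then have "(h + x + b) powr (p - 1) + (h - x) powr (p - 1) - (h + x) powr (p - 1) - (h - x + b) powr (p - 1) \<le> 0"
      by simp
    then have "(d * p) * ((h + x + b) powr (p - 1) + (h - x) powr (p - 1) - (h + x) powr (p - 1) - (h - x + b) powr (p - 1)) \<le> 0"
      using d p by (intro mult_nonneg_nonpos) auto
    then have "g d \<le> g 0" using x(3) by (simp add: algebra_simps)
    moreover have "h + d = a" "h - d = c" by (auto simp: h_def d_def field_simps)
    ultimately show ?thesis by (simp add: g_def h_def[symmetric] )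
  qed auto
  show ?thesis
    using main[of c a] main[of a c] abc by (cases "c \<le> a") (auto simp: add_ac)
qed

text \<open>Expanding around the larger term, Bernoulli's inequality leaves
  \<open>q * y * x powr (q - 1) \<le> q * y powr q\<close> instead of \<open>y powr q\<close>. The
  saved fraction \<open>1 - q\<close> of the smaller term becomes the Cauchy-Schwarz defect of
  nested intervals.\<close>

lemma powr_strictly_subadditive:
  fixes x y q :: real
  assumes "0 \<le> x" "0 \<le> y" "0 \<le> q" "q \<le> 1"
  shows "(x + y) powr q \<le> x powr q + y powr q - (1 - q) * min (x powr q) (y powr q)"
proof -
  have main: "(x + y) powr q \<le> x powr q + y powr q - (1 - q) * min (x powr q) (y powr q)"
    if xy: "0 \<le> y" "y \<le> x" for x y :: real
  proof (cases "y = 0")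
    case False
    then have pos: "0 < x" "0 < y" using xy by auto
    have m: "y powr q \<le> x powr q" using xy assms by (intro powr_mono2) auto
    have "(x + y) powr q = x powr q * (1 + y / x) powr q"
      using pos by (simp add: powr_mult[symmetric] ring_distribs)
    also have "\<dots> \<le> x powr q * (1 + q * (y / x))"
      using pos assms by (intro mult_left_mono powr_one_plus_le_Bernoulli) auto
    also have "\<dots> = x powr q + q * (y * x powr (q - 1))"
      using pos by (simp add: field_simps powr_diff)
    also have "\<dots> \<le> x powr q + q * (y * y powr (q - 1))"
      using pos xy assms by (intro add_left_mono mult_left_mono powr_mono2') auto
    also have "y * y powr (q - 1) = y powr q" using pos by (simp add: powr_mult_base)
    finally show ?thesis using m by (simp add: min_absorb2 algebra_simps)
  qed (use assms in auto)
  show ?thesis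
    using main[of y x] main[of x y] assms by (cases "y \<le> x") (auto simp: add_ac min.commute)
qed

text \<open>As a function of \<open>a\<close> with \<open>a + c\<close> fixed the covariance is concave, hence largest at \<open>a = c\<close>; there
  the identity \<open>(h + b)\<^sup>2 = h\<^sup>2 + b * (a + b + c)\<close> with \<open>h = (a + c) / 2\<close> reduces the bound to strict
  subadditivity of \<open>x powr (p/2)\<close>.\<close>

lemma powr_nested_covariance_le:
  fixes a b c p :: real
  assumes p: "1 < p" "p < 2" and abc: "0 \<le> a" "0 \<le> b" "0 \<le> c"
  defines "m \<equiv> ((a + b) powr p - a powr p + (b + c) powr p - c powr p) / 2"
  shows powr_nested_covariance_le_min:
      "m \<le> (b * (a + b + c)) powr (p/2)
          - (1 - p/2) * min (((a + c) / 2) powr p) ((b * (a + b + c)) powr (p/2))" (is ?goal1)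
    and powr_nested_covariance_le_linear: "m \<le> p * b * (a + b + c) powr (p - 1)"
proof -
  define h where "h = (a + c) / 2"
  have h: "0 \<le> h" using abc by (simp add: h_def)
  have m: "m \<le> (h + b) powr p - h powr p"
    using powr_nested_midpoint[OF assms(1-5)] unfolding m_def h_def by simp
  have sq: "x powr p = (x\<^sup>2) powr (p/2)" if "0 \<le> x" for x :: real
    using that by (simp add: power2_eq_square powr_mult powr_add[symmetric])
  have "(h + b)\<^sup>2 = h\<^sup>2 + b * (a + b + c)" by (simp add: h_def power2_eq_square field_simps)
  then have "(h + b) powr p = (h\<^sup>2 + b * (a + b + c)) powr (p/2)" using sq[of "h + b"] h abc by simp
  also have "\<dots> \<le> (h\<^sup>2) powr (p/2) + (b * (a + b + c)) powr (p/2)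
      - (1 - p/2) * min ((h\<^sup>2) powr (p/2)) ((b * (a + b + c)) powr (p/2))"
    using abc p by (intro powr_strictly_subadditive) auto
  finally show ?goal1
    using m h by (simp add: sq[OF h, symmetric] h_def[symmetric])
  \<comment> \<open>This bound is for a short inner interval: its factor \<open>b\<close>
    compensates the singular power of \<open>\<epsilon> + b powr p\<close>.\<close>
  show "m \<le> p * b * (a + b + c) powr (p - 1)"
  proof (cases "b = 0")
    case False
    then have "h < h + b" using abc by simp
    then obtain z where z: "h < z" "z < h + b" "(h + b) powr p - h powr p = (h + b - h) * (p * z powr (p - 1))"
    proof (rule mean_value_continuous[where f="\<lambda>x. x powr p" and f'="\<lambda>z. p * z powr (p - 1)"])
      show "continuous_on {h..h+b} (\<lambda>x. x powr p)"
        using h p by (intro continuous_intros continuous_on_powr') auto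
      show "((\<lambda>x. x powr p) has_real_derivative p * x powr (p - 1)) (at x)" if "h < x" "x < h + b" for x
        using h that by (auto intro!: derivative_eq_intros)
    qed
    have "z powr (p - 1) \<le> (a + b + c) powr (p - 1)"
      using z h p abc by (intro powr_mono2) (auto simp: h_def field_simps)
    then have "b * p * z powr (p - 1) \<le> b * p * (a + b + c) powr (p - 1)"
      using abc p by (intro mult_left_mono) auto
    moreover have "(h + b) powr p - h powr p = b * p * z powr (p - 1)" using z by simp
    ultimately show ?thesis using m by (simp add: mult.commute[of p b])
  qed (simp add: m_def)
qed

section \<open>Bounds for the chaos remainder\<close>

text \<open>The basic trade: of the decay \<open>q\<close>, a part \<open>\<beta>\<close> is spent
  on \<open>y\<close> and the rest on \<open>\<epsilon>\<close>. In every configuration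
  \<open>\<beta>\<close> is tuned so that each gap ends up with the exponent
  \<open>-\<kappa>\<close>.\<close>

lemma powr_neg_add_le:
  fixes \<epsilon> y q \<beta> :: real
  assumes "0 < \<epsilon>" "0 < y" "0 \<le> \<beta>" "\<beta> \<le> q"
  shows "(\<epsilon> + y) powr (-q) \<le> \<epsilon> powr (\<beta> - q) * y powr (-\<beta>)"
proof -
  have "(\<epsilon> + y) powr (-q) = (\<epsilon> + y) powr (\<beta> - q) * (\<epsilon> + y) powr (-\<beta>)"
    by (simp add: powr_add[symmetric])
  also have "\<dots> \<le> \<epsilon> powr (\<beta> - q) * y powr (-\<beta>)"
    using assms by (intro mult_mono powr_mono2') auto
  finally show ?thesis .
qed

text \<open>\<open>g\<close> is the geometric mean of the variances and \<open>d\<close> the defect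
  in Cauchy-Schwarz. By the inequality of the means the determinant is at least
  \<open>(\<epsilon> + g)\<^sup>2 - \<mu>\<^sup>2\<close>, which factors, and
  \<open>\<epsilon> + g - \<mu> \<ge> \<epsilon> + d\<close>.\<close>

lemma regularized_det_ge:
  fixes \<epsilon> \<nu> \<rho> g d \<mu> :: real
  assumes "0 < \<epsilon>" "0 \<le> \<nu>" "0 \<le> \<rho>" "0 \<le> g" "g\<^sup>2 = \<nu> * \<rho>" "0 \<le> \<mu>" "0 \<le> d" "\<mu> \<le> g - d"
  shows "(\<epsilon> + g) * (\<epsilon> + d) \<le> (\<epsilon> + \<nu>) * (\<epsilon> + \<rho>) - \<mu>\<^sup>2"
proof -
  have "(2 * g)\<^sup>2 \<le> (\<nu> + \<rho>)\<^sup>2"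
    using assms(5) sum_squares_bound[of \<nu> \<rho>] by (simp add: power2_sum power_mult_distrib)
  then have "2 * g \<le> \<nu> + \<rho>" by (rule power2_le_imp_le) (use assms(2,3) in simp)
  then have "\<epsilon> * (2 * g) \<le> \<epsilon> * (\<nu> + \<rho>)" using assms(1) by (intro mult_left_mono) simp_all
  then have 1: "(\<epsilon> + g)\<^sup>2 \<le> (\<epsilon> + \<nu>) * (\<epsilon> + \<rho>)"
    using assms(5) by (simp add: power2_eq_square algebra_simps)
  have "(\<epsilon> + g) * (\<epsilon> + d) \<le> (\<epsilon> + g + \<mu>) * (\<epsilon> + g - \<mu>)"
    using assms(1,4,6-8) by (intro mult_mono) simp_all
  also have "\<dots> = (\<epsilon> + g)\<^sup>2 - \<mu>\<^sup>2" by (simp add: power2_eq_square algebra_simps)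
  finally show ?thesis using 1 by linarith
qed

text \<open>Up to the factor \<open>(2 * pi) powr (-3)\<close> this is the covariance of the parts of
  \<open>\<partial>\<^sub>1\<delta>\<^sub>\<epsilon>(B s - B r)\<close> and \<open>\<partial>\<^sub>1\<delta>\<^sub>\<epsilon>(B s' - B r')\<close> that are orthogonal to the first chaos; \<open>\<nu>\<close> and \<open>\<rho>\<close> are the
  variances and \<open>\<mu>\<close> the covariance of the increments of one coordinate.\<close>

definition chaos_remainder :: "real \<Rightarrow> real \<Rightarrow> real \<Rightarrow> real \<Rightarrow> real" where
  "chaos_remainder \<epsilon> \<nu> \<rho> \<mu> = \<mu> * (((\<epsilon> + \<nu>) * (\<epsilon> + \<rho>) - \<mu>\<^sup>2) powr (-(5/2)) - ((\<epsilon> + \<nu>) * (\<epsilon> + \<rho>)) powr (-(5/2)))"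

text \<open>Giving up the subtracted term is affordable when the intervals overlap or are nested;
  for disjoint intervals the cancellation is kept.\<close>

lemma chaos_remainder_le:
  assumes "0 \<le> \<mu>"
  shows "chaos_remainder \<epsilon> \<nu> \<rho> \<mu> \<le> \<mu> * ((\<epsilon> + \<nu>) * (\<epsilon> + \<rho>) - \<mu>\<^sup>2) powr (-(5/2))"
  unfolding chaos_remainder_def using assms by (intro mult_left_mono) auto

text \<open>The common end of the overlapping case and of one nested case: a geometric mean that
  controls the middle gap and a defect that controls the outer gaps suffice for the product
  bound.\<close>

lemma chaos_remainder_le_product:
  fixes \<epsilon> \<nu> \<rho> g d \<mu> a b c p k \<eta> :: real
  assumes "0 < \<epsilon>" "0 \<le> \<nu>" "0 \<le> \<rho>" "0 \<le> g" "g\<^sup>2 = \<nu> * \<rho>" "0 \<le> \<mu>" "\<mu> \<le> g - d"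
    and abc: "0 < a" "0 < b" "0 < c" and p: "1 < p" and k: "0 < k" and \<eta>: "0 \<le> \<eta>" "\<eta> \<le> 1"
    and g: "b powr p \<le> g" and d: "k * (a * c) powr (p/2) \<le> d"
  shows "\<epsilon> powr (5 - 4/p) * chaos_remainder \<epsilon> \<nu> \<rho> \<mu>
     \<le> k powr (-(2 * (1 - \<eta>) / p)) * (\<epsilon> powr ((p - 1 - 3 * \<eta>) / p) * (a * b * c) powr (-(1 - \<eta>)))"
proof -
  define \<kappa> where "\<kappa> = 1 - \<eta>"
  have \<kappa>: "0 \<le> \<kappa>" "\<kappa> \<le> 1" using \<eta> by (auto simp: \<kappa>_def)
  have kac: "0 < k * (a * c) powr (p/2)" using k abc by simp
  then have d0: "0 < d" using d by linarith
  define D where "D = (\<epsilon> + \<nu>) * (\<epsilon> + \<rho>) - \<mu>\<^sup>2"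
  have D: "(\<epsilon> + g) * (\<epsilon> + d) \<le> D" unfolding D_def
    by (rule regularized_det_ge) (use assms(1-7) d0 in simp_all)
  \<comment> \<open>Since \<open>\<mu> \<le> \<epsilon> + g\<close>, the covariance cancels one
    power of \<open>\<epsilon> + g\<close>, leaving the exponents \<open>-3/2\<close> and
    \<open>-5/2\<close>.\<close>
  have "\<mu> * D powr (-(5/2)) \<le> (\<epsilon> + g) * ((\<epsilon> + g) * (\<epsilon> + d)) powr (-(5/2))"
    using assms(1,4,6,7) d0 D by (intro mult_mono powr_mono2') simp_all
  also have "\<dots> = (\<epsilon> + g) powr (-(3/2)) * (\<epsilon> + d) powr (-(5/2))"
    using assms(1,4) d0 powr_mult_base[of "\<epsilon> + g" "-(5/2)"] by (simp add: powr_mult mult.assoc[symmetric])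
  also have "\<dots> \<le> (\<epsilon> + b powr p) powr (-(3/2)) * (\<epsilon> + k * (a * c) powr (p/2)) powr (-(5/2))"
    using assms(1,4) g d d0 kac by (intro mult_mono powr_mono2' add_left_mono add_pos_nonneg) auto
  \<comment> \<open>The split \<open>\<kappa>/p\<close> and \<open>2*\<kappa>/p\<close> is forced:
    \<open>b\<close> enters with exponent \<open>p\<close> but \<open>a * c\<close> with exponent
    \<open>p/2\<close>, and all three must end with \<open>-\<kappa>\<close>.\<close>
  also have "\<dots> \<le> (\<epsilon> powr (\<kappa>/p - 3/2) * (b powr p) powr (-(\<kappa>/p))) *
      (\<epsilon> powr (2*\<kappa>/p - 5/2) * (k * (a * c) powr (p/2)) powr (-(2*\<kappa>/p)))"
  proof (rule mult_mono)
    have "2 * \<kappa> / p \<le> 2 / 1" "\<kappa> / p \<le> 1 / 1" using \<kappa> p by (intro frac_le; simp)+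
    then have "2 * \<kappa> / p \<le> 5/2" "\<kappa> / p \<le> 3/2" by linarith+
    moreover have "0 \<le> 2 * \<kappa> / p" "0 \<le> \<kappa> / p" using \<kappa> p by simp_all
    moreover have "0 < b powr p" using abc by simp
    ultimately show "(\<epsilon> + b powr p) powr (-(3/2)) \<le> \<epsilon> powr (\<kappa>/p - 3/2) * (b powr p) powr (-(\<kappa>/p))"
      "(\<epsilon> + k * (a * c) powr (p/2)) powr (-(5/2)) \<le> \<epsilon> powr (2*\<kappa>/p - 5/2) * (k * (a * c) powr (p/2)) powr (-(2*\<kappa>/p))"
      using powr_neg_add_le[OF assms(1) kac] powr_neg_add_le[OF assms(1), of "b powr p"] by blast+
  qed simp_all
  also have "(k * (a * c) powr (p/2)) powr (-(2*\<kappa>/p)) = k powr (-(2*\<kappa>/p)) * (a * c) powr (-\<kappa>)"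
    using k abc p by (simp add: powr_mult powr_powr)
  also have "(b powr p) powr (-(\<kappa>/p)) = b powr (-\<kappa>)" using p by (simp add: powr_powr)
  finally have *: "chaos_remainder \<epsilon> \<nu> \<rho> \<mu> \<le> (\<epsilon> powr (\<kappa>/p - 3/2) * b powr (-\<kappa>)) *
      (\<epsilon> powr (2*\<kappa>/p - 5/2) * (k powr (-(2*\<kappa>/p)) * (a * c) powr (-\<kappa>)))"
    using chaos_remainder_le[OF assms(6), of \<epsilon> \<nu> \<rho>] unfolding D_def by linarith
  have "\<epsilon> powr (5 - 4/p) * chaos_remainder \<epsilon> \<nu> \<rho> \<mu> \<le> \<epsilon> powr (5 - 4/p) * ((\<epsilon> powr (\<kappa>/p - 3/2) * b powr (-\<kappa>)) *
      (\<epsilon> powr (2*\<kappa>/p - 5/2) * (k powr (-(2*\<kappa>/p)) * (a * c) powr (-\<kappa>))))"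
    by (intro mult_left_mono *) auto
  also have "\<dots> = k powr (-(2*\<kappa>/p)) * ((\<epsilon> powr (5 - 4/p) * \<epsilon> powr (\<kappa>/p - 3/2) * \<epsilon> powr (2*\<kappa>/p - 5/2)) * (b powr (-\<kappa>) * (a * c) powr (-\<kappa>)))"
    by simp
  also have "\<epsilon> powr (5 - 4/p) * \<epsilon> powr (\<kappa>/p - 3/2) * \<epsilon> powr (2*\<kappa>/p - 5/2)
      = \<epsilon> powr ((5 - 4/p) + (\<kappa>/p - 3/2) + (2*\<kappa>/p - 5/2))"
    by (simp only: powr_add)
  also have "(5 - 4/p) + (\<kappa>/p - 3/2) + (2*\<kappa>/p - 5/2) = (p - 1 - 3 * \<eta>) / p"
    using p by (simp add: field_simps \<kappa>_def)
  also have "b powr (-\<kappa>) * (a * c) powr (-\<kappa>) = (a * b * c) powr (-\<kappa>)"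
    using abc by (simp add: powr_mult mult_ac)
  finally show ?thesis by (simp add: \<kappa>_def)
qed

lemma chaos_remainder_overlap:
  fixes \<epsilon> a b c p \<eta> :: real
  assumes \<epsilon>: "0 < \<epsilon>" and abc: "0 < a" "0 < b" "0 < c" and p: "1 < p" "p < 2" and \<eta>: "0 \<le> \<eta>" "\<eta> \<le> 1"
  shows "\<epsilon> powr (5 - 4/p) * chaos_remainder \<epsilon> ((a + b) powr p) ((b + c) powr p)
        (((a + b + c) powr p + b powr p - a powr p - c powr p) / 2)
     \<le> (1 - p/2) powr (-(2 * (1 - \<eta>) / p)) * (\<epsilon> powr ((p - 1 - 3 * \<eta>) / p) * (a * b * c) powr (-(1 - \<eta>)))"
proof (rule chaos_remainder_le_product[where g="((a + b) * (b + c)) powr (p/2)" and d="(1 - p/2) * (a * c) powr (p/2)"])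
  show "(((a + b) * (b + c)) powr (p/2))\<^sup>2 = (a + b) powr p * (b + c) powr p"
    using abc by (simp add: powr_half_square powr_mult power_mult_distrib)
  \<comment> \<open>Superadditivity of \<open>x powr p\<close>, as the case of gap 0.\<close>
  have "(a + 0) powr p + (b + c + 0) powr p \<le> (a + (b + c) + 0) powr p + 0 powr p"
    using abc p by (intro powr_second_difference_nonneg) auto
  then have "a powr p + (b + c) powr p \<le> (a + b + c) powr p" by (simp add: add_ac)
  moreover have "c powr p \<le> (b + c) powr p" using abc p by (auto intro!: powr_mono2)
  ultimately have "0 \<le> (a + b + c) powr p - a powr p - c powr p" by linarith
  then show "0 \<le> ((a + b + c) powr p + b powr p - a powr p - c powr p) / 2"
    using powr_ge_zero[of b p] by (intro divide_nonneg_pos) linarith+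
  show "((a + b + c) powr p + b powr p - a powr p - c powr p) / 2
    \<le> ((a + b) * (b + c)) powr (p / 2) - (1 - p / 2) * (a * c) powr (p / 2)"
    using powr_overlap_covariance_le[of p a b c] abc p by (simp add: field_simps)
  have "b powr p = (b * b) powr (p/2)" using abc by (simp add: powr_mult powr_add[symmetric])
  also have "\<dots> \<le> ((a + b) * (b + c)) powr (p/2)" using abc p by (intro powr_mono2 mult_mono) auto
  finally show "b powr p \<le> ((a + b) * (b + c)) powr (p/2)" .
qed (use \<epsilon> abc p \<eta> in simp_all)

text \<open>If the outer gaps are small compared with \<open>(b * N) powr (p/2)\<close>, the defect
  is of size \<open>((a + c) / 2) powr p\<close> and the product lemma applies. Otherwise the
  correlation is at most \<open>p/2\<close>, so the determinant is comparable to
  \<open>\<Delta>\<close> and the linear bound on \<open>\<mu>\<close> takes over. The two summands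
  of the constant belong to these two cases.\<close>

lemma chaos_remainder_nested:
  fixes \<epsilon> a b c p \<eta> :: real
  assumes \<epsilon>: "0 < \<epsilon>" and abc: "0 < a" "0 < b" "0 < c" and p: "1 < p" "p < 2" and \<eta>: "0 \<le> \<eta>" "\<eta> \<le> 1"
  shows "\<epsilon> powr (5 - 4/p) * chaos_remainder \<epsilon> ((a + b + c) powr p) (b powr p)
        (((a + b) powr p + (b + c) powr p - a powr p - c powr p) / 2)
     \<le> ((1 - p/2) powr (-(2 * (1 - \<eta>) / p)) + p * (1 - p/2) powr (-(5/2))) *
        (\<epsilon> powr ((p - 1 - 3 * \<eta>) / p) * (a * b * c) powr (-(1 - \<eta>)))"
proof -
  define \<mu> where "\<mu> = ((a + b) powr p + (b + c) powr p - a powr p - c powr p) / 2"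
  define N where "N = a + b + c"
  define k where "k = 1 - p/2"
  define \<kappa> where "\<kappa> = 1 - \<eta>"
  define R where "R = \<epsilon> powr ((p - 1 - 3 * \<eta>) / p) * (a * b * c) powr (-\<kappa>)"
  have k: "0 < k" "k < 1" using p by (auto simp: k_def)
  have N: "0 < N" "a + c \<le> N" "b \<le> N" using abc by (auto simp: N_def)
  have R: "0 \<le> R" by (simp add: R_def)
  have \<kappa>: "0 \<le> \<kappa>" "\<kappa> \<le> 1" using \<eta> by (auto simp: \<kappa>_def)
  have \<mu>0: "0 \<le> \<mu>"
    using abc p powr_mono2[of p a "a + b"] powr_mono2[of p c "b + c"] by (simp add: \<mu>_def)
  have sq: "((b * N) powr (p/2))\<^sup>2 = N powr p * b powr p"
    using abc N by (simp add: powr_half_square powr_mult power_mult_distrib)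
  have min_le: "\<mu> \<le> (b * N) powr (p/2) - k * min (((a + c) / 2) powr p) ((b * N) powr (p/2))"
    using powr_nested_covariance_le_min[of p a b c] abc p by (simp add: \<mu>_def N_def k_def)
  have lin_le: "\<mu> \<le> p * b * N powr (p - 1)"
    using powr_nested_covariance_le_linear[of p a b c] abc p by (simp add: \<mu>_def N_def add_diff_eq diff_add_eq)
  have ac: "(a * c) powr (p/2) \<le> ((a + c) / 2) powr p"
  proof -
    have "0 \<le> (a - c)\<^sup>2" by simp
    then have "a * c \<le> ((a + c) / 2)\<^sup>2" by (simp add: power2_eq_square field_simps)
    then have "(a * c) powr (p/2) \<le> (((a + c) / 2)\<^sup>2) powr (p/2)" using abc p by (intro powr_mono2) auto
    also have "\<dots> = (((a + c) / 2) powr (p/2))\<^sup>2"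
      using abc unfolding power2_eq_square by (intro powr_mult)
    also have "\<dots> = ((a + c) / 2) powr p" by (rule powr_half_square)
    finally show ?thesis .
  qed
  show ?thesis
  proof (cases "((a + c) / 2) powr p \<le> (b * N) powr (p/2)")
    case True
    have "\<epsilon> powr (5 - 4/p) * chaos_remainder \<epsilon> (N powr p) (b powr p) \<mu> \<le> k powr (-(2 * (1 - \<eta>) / p)) * R"
      unfolding R_def \<kappa>_def
    proof (rule chaos_remainder_le_product[where g="(b * N) powr (p/2)" and d="k * ((a + c) / 2) powr p"])
      show "\<mu> \<le> (b * N) powr (p/2) - k * ((a + c) / 2) powr p" using min_le True by simp
      have "b powr p = (b * b) powr (p/2)" using abc by (simp add: powr_mult powr_add[symmetric])
      also have "\<dots> \<le> (b * N) powr (p/2)" using abc N p by (intro powr_mono2 mult_mono) auto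
      finally show "b powr p \<le> (b * N) powr (p/2)" .
      show "k * (a * c) powr (p / 2) \<le> k * ((a + c) / 2) powr p" using k ac by (intro mult_left_mono) auto
      show "((b * N) powr (p/2))\<^sup>2 = N powr p * b powr p" by (fact sq)
    qed (use \<epsilon> abc p \<eta> \<mu>0 k in simp_all)
    also have "\<dots> \<le> (k powr (-(2 * (1 - \<eta>) / p)) + p * k powr (-(5/2))) * R"
      using p R by (intro mult_right_mono) auto
    finally show ?thesis by (simp add: R_def \<kappa>_def k_def \<mu>_def N_def)
  next
    case False
    define g where "g = (b * N) powr (p/2)"
    define \<Delta> where "\<Delta> = (\<epsilon> + N powr p) * (\<epsilon> + b powr p)"
    have "\<mu> \<le> (1 - k) * g" using min_le False by (simp add: g_def min_def algebra_simps split: if_splits)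
    then have "\<mu>\<^sup>2 \<le> ((1 - k) * g)\<^sup>2" using \<mu>0 by (intro power_mono) auto
    also have "\<dots> \<le> (1 - k) * (1 * g\<^sup>2)"
      unfolding power_mult_distrib using k by (simp add: power2_eq_square mult_left_le mult_right_mono)
    also have "\<dots> \<le> (1 - k) * \<Delta>"
      using sq k \<epsilon> by (intro mult_left_mono) (auto simp: g_def \<Delta>_def algebra_simps)
    finally have det: "k * \<Delta> \<le> \<Delta> - \<mu>\<^sup>2" by (simp add: algebra_simps)
    have \<Delta>0: "0 < \<Delta>" using \<epsilon> by (auto simp: \<Delta>_def intro!: mult_pos_pos add_pos_nonneg)
      \<comment> \<open>The exponent \<open>(1 + \<kappa>)/p\<close> makes the factor
        \<open>b\<close> from the linear bound come out as
        \<open>b powr (-\<kappa>)\<close>.\<close>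
      have "(\<epsilon> + b powr p) powr (-(5/2)) \<le> \<epsilon> powr ((1 + \<kappa>)/p - 5/2) * (b powr p) powr (-((1 + \<kappa>)/p))"
        using \<epsilon> abc p \<kappa> by (intro powr_neg_add_le) (auto simp: field_simps)
      then have "b * (\<epsilon> + b powr p) powr (-(5/2)) \<le> b * (\<epsilon> powr ((1 + \<kappa>)/p - 5/2) * (b powr p) powr (-((1 + \<kappa>)/p)))"
        using abc by (intro mult_left_mono) auto
      also have "\<dots> = \<epsilon> powr ((1 + \<kappa>)/p - 5/2) * (b * b powr (-(1 + \<kappa>)))" using p by (simp add: powr_powr)
      also have "b * b powr (-(1 + \<kappa>)) = b powr (-\<kappa>)" using abc by (simp add: powr_mult_base)
      finally have leg1: "b * (\<epsilon> + b powr p) powr (-(5/2)) \<le> \<epsilon> powr ((1 + \<kappa>)/p - 5/2) * b powr (-\<kappa>)" .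
      \<comment> \<open>The outer length is to end with exponent \<open>-2 * \<kappa>\<close>: it
        dominates \<open>a\<close> and \<open>c\<close> alike, so this is at most
        \<open>(a * c) powr (-\<kappa>)\<close>.\<close>
      have "(\<epsilon> + N powr p) powr (-(5/2)) \<le> \<epsilon> powr ((p - 1 + 2 * \<kappa>)/p - 5/2) * (N powr p) powr (-((p - 1 + 2 * \<kappa>)/p))"
        using \<epsilon> N p \<kappa> by (intro powr_neg_add_le) (auto simp: field_simps)
      then have "N powr (p - 1) * (\<epsilon> + N powr p) powr (-(5/2)) \<le> N powr (p - 1) * (\<epsilon> powr ((p - 1 + 2 * \<kappa>)/p - 5/2) * (N powr p) powr (-((p - 1 + 2 * \<kappa>)/p)))"
        by (intro mult_left_mono) auto
      also have "\<dots> = \<epsilon> powr ((p - 1 + 2 * \<kappa>)/p - 5/2) * (N powr (p - 1) * N powr (-(p - 1 + 2 * \<kappa>)))" using p by (simp add: powr_powr)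
      also have "N powr (p - 1) * N powr (-(p - 1 + 2 * \<kappa>)) = (N * N) powr (-\<kappa>)"
        using N by (simp add: powr_mult powr_add[symmetric])
      also have "(N * N) powr (-\<kappa>) \<le> (a * c) powr (-\<kappa>)"
        using abc N \<kappa> by (intro powr_mono2' mult_mono) auto
      finally have leg2: "N powr (p - 1) * (\<epsilon> + N powr p) powr (-(5/2)) \<le> \<epsilon> powr ((p - 1 + 2 * \<kappa>)/p - 5/2) * (a * c) powr (-\<kappa>)"
        by (simp add: mult_left_mono)
    have "chaos_remainder \<epsilon> (N powr p) (b powr p) \<mu> \<le> \<mu> * (\<Delta> - \<mu>\<^sup>2) powr (-(5/2))"
      using chaos_remainder_le[OF \<mu>0] by (simp add: \<Delta>_def)
    also have "\<dots> \<le> (p * b * N powr (p - 1)) * (k * \<Delta>) powr (-(5/2))"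
      using lin_le det k \<Delta>0 \<mu>0 by (intro mult_mono powr_mono2') auto
    also have "\<dots> = p * k powr (-(5/2)) * (b * (\<epsilon> + b powr p) powr (-(5/2))) * (N powr (p - 1) * (\<epsilon> + N powr p) powr (-(5/2)))"
      using \<epsilon> k by (simp add: \<Delta>_def powr_mult)
    also have "\<dots> \<le> p * k powr (-(5/2)) * (\<epsilon> powr ((1 + \<kappa>)/p - 5/2) * b powr (-\<kappa>)) * (\<epsilon> powr ((p - 1 + 2 * \<kappa>)/p - 5/2) * (a * c) powr (-\<kappa>))"
      by (rule mult_mono[OF mult_left_mono[OF leg1] leg2]) (use p abc in auto)
    finally have "\<epsilon> powr (5 - 4/p) * chaos_remainder \<epsilon> (N powr p) (b powr p) \<mu> \<le>
       \<epsilon> powr (5 - 4/p) * (p * k powr (-(5/2)) * (\<epsilon> powr ((1 + \<kappa>)/p - 5/2) * b powr (-\<kappa>)) * (\<epsilon> powr ((p - 1 + 2 * \<kappa>)/p - 5/2) * (a * c) powr (-\<kappa>)))"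
      by (intro mult_left_mono) auto
    also have "\<dots> = p * k powr (-(5/2)) * ((\<epsilon> powr (5 - 4/p) * \<epsilon> powr ((1 + \<kappa>)/p - 5/2) * \<epsilon> powr ((p - 1 + 2 * \<kappa>)/p - 5/2)) * (b powr (-\<kappa>) * (a * c) powr (-\<kappa>)))"
      by simp
    also have "\<epsilon> powr (5 - 4/p) * \<epsilon> powr ((1 + \<kappa>)/p - 5/2) * \<epsilon> powr ((p - 1 + 2 * \<kappa>)/p - 5/2) =
        \<epsilon> powr ((5 - 4/p) + ((1 + \<kappa>)/p - 5/2) + ((p - 1 + 2 * \<kappa>)/p - 5/2))"
      by (simp only: powr_add)
    also have "(5 - 4/p) + ((1 + \<kappa>)/p - 5/2) + ((p - 1 + 2 * \<kappa>)/p - 5/2) = (p - 1 - 3 * \<eta>) / p"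
      using p by (simp add: field_simps \<kappa>_def)
    also have "b powr (-\<kappa>) * (a * c) powr (-\<kappa>) = (a * b * c) powr (-\<kappa>)"
      using abc by (simp add: powr_mult mult_ac)
    also have "p * k powr (-(5/2)) * (\<epsilon> powr ((p - 1 - 3 * \<eta>) / p) * (a * b * c) powr (-\<kappa>))
        \<le> (k powr (-(2 * (1 - \<eta>) / p)) + p * k powr (-(5/2))) * R"
      unfolding R_def[symmetric] using R by (intro mult_right_mono) auto
    finally show ?thesis by (simp add: R_def \<kappa>_def k_def \<mu>_def N_def)
  qed
qed

text \<open>After factoring out \<open>(1 - x) powr (-(5/2))\<close>, what remains is at most
  \<open>1 - (1 - x) ^ 3 \<le> 3 * x\<close>. Weakening \<open>x\<close> to
  \<open>x powr \<theta>\<close> keeps the order of cancellation adjustable, which fixes the decay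
  in the gap between disjoint intervals.\<close>

lemma powr_neg_minus_one_le:
  fixes x x0 \<theta> :: real
  assumes "0 \<le> x" "x \<le> x0" "x0 < 1" "0 < \<theta>" "\<theta> \<le> 1"
  shows "(1 - x) powr (-(5/2)) - 1 \<le> 3 * (1 - x0) powr (-(5/2)) * x powr \<theta>"
proof -
  have "1 - 3 * x \<le> (1 - x) ^ 3" using Bernoulli_inequality[of "-x" 3] assms by simp
  also have "(1 - x) ^ 3 = (1 - x) powr 3" using assms by (simp add: powr_numeral)
  also have "\<dots> \<le> (1 - x) powr (5/2)" using assms by (intro powr_mono') auto
  finally have A: "1 - (1 - x) powr (5/2) \<le> 3 * x" by linarith
  have B: "(1 - x) powr (-(5/2)) \<le> (1 - x0) powr (-(5/2))"
    by (rule powr_mono2') (use assms in simp_all)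
  have C: "0 \<le> 1 - (1 - x) powr (5/2)"
    using powr_mono2[of "5/2" "1 - x" 1] assms by simp
  have "(1 - x) powr (-(5/2)) * (1 - (1 - x) powr (5/2)) \<le> (1 - x0) powr (-(5/2)) * (3 * x)"
    by (rule mult_mono[OF B A]) (use C in simp_all)
  moreover have "(1 - x) powr (-(5/2)) * (1 - x) powr (5/2) = (1 - x) powr 0"
    unfolding powr_add[symmetric] by simp
  then have "(1 - x) powr (-(5/2)) * (1 - (1 - x) powr (5/2)) = (1 - x) powr (-(5/2)) - 1"
    using assms unfolding right_diff_distrib by simp
  moreover have "x \<le> x powr \<theta>" using assms powr_mono'[of \<theta> 1 x] by (cases "x = 0") auto
  then have "(1 - x0) powr (-(5/2)) * (3 * x) \<le> (1 - x0) powr (-(5/2)) * (3 * x powr \<theta>)"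
    by (intro mult_left_mono) auto
  ultimately show ?thesis by (simp only: mult.assoc mult.left_commute)
qed

text \<open>The cancellation contributes a factor
  \<open>(\<mu>\<^sup>2 / \<Delta>) powr \<theta>\<close>. The covariance is bounded in two ways: by
  the correlation of adjacent intervals, which keeps \<open>\<mu>\<^sup>2 / \<Delta>\<close> away
  from 1, and by \<open>u * v * w powr (p - 2)\<close>, which supplies the powers of the lengths and
  of the gap.\<close>

lemma chaos_remainder_disjoint:
  fixes \<epsilon> u v w p \<eta> :: real
  assumes \<epsilon>: "0 < \<epsilon>" and uvw: "0 < u" "0 < v" "0 < w" and p: "1 < p" "p < 4/3" and \<eta>: "0 \<le> \<eta>" "\<eta> < p - 1"
  shows "\<epsilon> powr (5 - 4/p) * chaos_remainder \<epsilon> (u powr p) (v powr p)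
        (((u + v + w) powr p + w powr p - (u + w) powr p - (v + w) powr p) / 2)
     \<le> 3 * (1 - (p/2)\<^sup>2) powr (-(5/2)) * (\<epsilon> powr ((p - 1 - 3 * \<eta>) / p) * (u * w * v) powr (-(1 - \<eta>)))"
proof -
  define \<mu> where "\<mu> = ((u + v + w) powr p + w powr p - (u + w) powr p - (v + w) powr p) / 2"
  define \<kappa> where "\<kappa> = 1 - \<eta>"
  define e where "e = (p - 1 - \<eta>) / (2 - p)"
  define \<theta> where "\<theta> = e / 2" \<comment> \<open>chosen so that \<open>\<mu> powr (1 + 2 * \<theta>)\<close> contributes exactly \<open>w powr (-\<kappa>)\<close>; \<open>\<theta> \<le> 1\<close> uses \<open>H < 2/3\<close>\<close>
  have e: "0 < e" "e \<le> 1/2" "(2 - p) * e = p - 1 - \<eta>"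
    using p \<eta> by (simp_all add: e_def divide_le_eq)
  define \<Delta> where "\<Delta> = (\<epsilon> + u powr p) * (\<epsilon> + v powr p)"
  define K where "K = 3 * (1 - (p/2)\<^sup>2) powr (-(5/2))"
  have K: "0 \<le> K" by (simp add: K_def)
  have \<theta>: "0 < \<theta>" "\<theta> \<le> 1" "(2 - p) * (1 + 2 * \<theta>) = \<kappa>" and \<theta>': "\<theta> \<le> 1/4"
    using e by (simp_all add: \<theta>_def \<kappa>_def distrib_left)
  have \<mu>0: "0 \<le> \<mu>" using powr_second_difference_nonneg[of p u v w] p uvw by (simp add: \<mu>_def)
  have \<mu>1: "\<mu> \<le> u * v * w powr (p - 2)"
  proof -
    have "p * (p - 1) \<le> 2 * 1" using p by (intro mult_mono) auto
    then have "p * (p - 1) * (u * v * w powr (p - 2)) \<le> 2 * (u * v * w powr (p - 2))"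
      using uvw by (intro mult_right_mono) auto
    moreover have "2 * \<mu> \<le> p * (p - 1) * u * v * w powr (p - 2)"
      using powr_second_difference_le[of p u v w] p uvw by (simp add: \<mu>_def)
    ultimately show ?thesis by (simp add: mult.assoc)
  qed
  \<comment> \<open>Closing the gap only increases the covariance, so the bound for adjacent
    intervals applies.\<close>
  have \<mu>2: "\<mu> \<le> p/2 * (u powr (p/2) * v powr (p/2))"
    using powr_second_difference_antimono[of p u v w] powr_add_le_geometric[of p u v] p uvw by (simp add: \<mu>_def)
  have \<Delta>0: "0 < \<Delta>" using \<epsilon> by (auto simp: \<Delta>_def intro!: mult_pos_pos add_pos_nonneg)
  have "\<mu>\<^sup>2 \<le> (p/2 * (u powr (p/2) * v powr (p/2)))\<^sup>2" using \<mu>0 \<mu>2 by (intro power_mono) auto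
  also have "\<dots> = (p/2)\<^sup>2 * (u powr p * v powr p)"
    by (simp only: power_mult_distrib powr_half_square)
  also have "\<dots> \<le> (p/2)\<^sup>2 * \<Delta>" using \<epsilon> by (intro mult_left_mono) (auto simp: \<Delta>_def algebra_simps)
  finally have x: "\<mu>\<^sup>2 / \<Delta> \<le> (p/2)\<^sup>2" using \<Delta>0 by (simp add: field_simps)
  have p2: "(p/2)\<^sup>2 < 1" using p power_strict_mono[of "p/2" 1 2] by simp
  have "\<Delta> - \<mu>\<^sup>2 = \<Delta> * (1 - \<mu>\<^sup>2 / \<Delta>)" using \<Delta>0 by (simp add: field_simps)
  then have "(\<Delta> - \<mu>\<^sup>2) powr (-(5/2)) = \<Delta> powr (-(5/2)) * (1 - \<mu>\<^sup>2 / \<Delta>) powr (-(5/2))"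
    using \<Delta>0 x p2 by (simp only: powr_mult)
  then have "chaos_remainder \<epsilon> (u powr p) (v powr p) \<mu> = \<mu> * \<Delta> powr (-(5/2)) * ((1 - \<mu>\<^sup>2 / \<Delta>) powr (-(5/2)) - 1)"
    unfolding chaos_remainder_def \<Delta>_def[symmetric] by (simp add: right_diff_distrib)
  also have "\<dots> \<le> \<mu> * \<Delta> powr (-(5/2)) * (3 * (1 - (p/2)\<^sup>2) powr (-(5/2)) * (\<mu>\<^sup>2 / \<Delta>) powr \<theta>)"
    using \<mu>0 \<Delta>0 x p2 \<theta> by (intro mult_left_mono powr_neg_minus_one_le) auto
  also have "(\<mu>\<^sup>2 / \<Delta>) powr \<theta> = \<mu> powr (2 * \<theta>) * \<Delta> powr (-\<theta>)"
    using \<mu>0 \<Delta>0 by (simp add: powr_divide powr_minus_divide power2_eq_square powr_mult powr_add[symmetric])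
  also have "\<mu> * \<Delta> powr (-(5/2)) * (3 * (1 - (p/2)\<^sup>2) powr (-(5/2)) * (\<mu> powr (2 * \<theta>) * \<Delta> powr (-\<theta>)))
     = K * ((\<mu> * \<mu> powr (2 * \<theta>)) * (\<Delta> powr (-(5/2)) * \<Delta> powr (-\<theta>)))"
    unfolding K_def by simp
  also have "\<Delta> powr (-(5/2)) * \<Delta> powr (-\<theta>) = \<Delta> powr (-(5/2 + \<theta>))" by (simp add: powr_add[symmetric])
  also have "\<mu> * \<mu> powr (2 * \<theta>) = \<mu> powr (1 + 2 * \<theta>)" using \<mu>0 by (simp add: powr_mult_base)
  also have "K * (\<mu> powr (1 + 2 * \<theta>) * \<Delta> powr (-(5/2 + \<theta>))) \<le> K * ((u * v * w powr (p - 2)) powr (1 + 2 * \<theta>) * \<Delta> powr (-(5/2 + \<theta>)))"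
    using \<mu>0 \<mu>1 \<theta> K by (intro mult_left_mono mult_right_mono powr_mono2) auto
  also have "(u * v * w powr (p - 2)) powr (1 + 2 * \<theta>) = u powr (1 + 2 * \<theta>) * v powr (1 + 2 * \<theta>) * w powr (-\<kappa>)"
  proof -
    have "(p - 2) * (1 + 2 * \<theta>) = -\<kappa>" using \<theta>(3) by (simp add: algebra_simps)
    then show ?thesis by (simp only: powr_mult powr_powr)
  qed
  also have "\<Delta> powr (-(5/2 + \<theta>)) = (\<epsilon> + u powr p) powr (-(5/2 + \<theta>)) * (\<epsilon> + v powr p) powr (-(5/2 + \<theta>))"
    using \<epsilon> by (simp add: \<Delta>_def powr_mult)
  finally have 1: "chaos_remainder \<epsilon> (u powr p) (v powr p) \<mu> \<le> K * (w powr (-\<kappa>) * (u powr (1 + 2 * \<theta>) * (\<epsilon> + u powr p) powr (-(5/2 + \<theta>)))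
       * (v powr (1 + 2 * \<theta>) * (\<epsilon> + v powr p) powr (-(5/2 + \<theta>))))" by (simp add: mult_ac)
  \<comment> \<open>Solved from \<open>1 + 2 * \<theta> - p * \<beta> = -\<kappa>\<close>, so that
    the length of either interval ends with the exponent \<open>-\<kappa>\<close>.\<close>
  define \<beta> where "\<beta> = (2 + 2 * \<theta> - \<eta>) / p"
  have leg: "z powr (1 + 2 * \<theta>) * (\<epsilon> + z powr p) powr (-(5/2 + \<theta>)) \<le> \<epsilon> powr (\<beta> - (5/2 + \<theta>)) * z powr (-\<kappa>)"
    if z: "0 < z" for z
  proof -
    have "2 + 2 * \<theta> - \<eta> \<le> 1 * (5/2 + \<theta>)" using \<theta> \<theta>' \<eta> by simp
    also have "\<dots> \<le> p * (5/2 + \<theta>)" using p \<theta> by (intro mult_right_mono) auto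
    finally have "\<beta> \<le> 5/2 + \<theta>" "0 \<le> \<beta>" using p \<theta> \<eta> by (auto simp: \<beta>_def field_simps)
    then have "(\<epsilon> + z powr p) powr (-(5/2 + \<theta>)) \<le> \<epsilon> powr (\<beta> - (5/2 + \<theta>)) * (z powr p) powr (-\<beta>)"
      using \<epsilon> z by (intro powr_neg_add_le) auto
    then have "z powr (1 + 2 * \<theta>) * (\<epsilon> + z powr p) powr (-(5/2 + \<theta>)) \<le> z powr (1 + 2 * \<theta>) * (\<epsilon> powr (\<beta> - (5/2 + \<theta>)) * (z powr p) powr (-\<beta>))"
      by (intro mult_left_mono) auto
    also have "\<dots> = \<epsilon> powr (\<beta> - (5/2 + \<theta>)) * (z powr (1 + 2 * \<theta>) * z powr (- (p * \<beta>)))"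
      by (simp add: powr_powr)
    also have "z powr (1 + 2 * \<theta>) * z powr (- (p * \<beta>)) = z powr (1 + 2 * \<theta> - p * \<beta>)"
      by (simp add: powr_add[symmetric])
    also have "1 + 2 * \<theta> - p * \<beta> = -\<kappa>" using p by (simp add: \<beta>_def \<kappa>_def)
    finally show ?thesis .
  qed
  have "chaos_remainder \<epsilon> (u powr p) (v powr p) \<mu> \<le> K * (w powr (-\<kappa>) * (\<epsilon> powr (\<beta> - (5/2 + \<theta>)) * u powr (-\<kappa>)) * (\<epsilon> powr (\<beta> - (5/2 + \<theta>)) * v powr (-\<kappa>)))"
    by (rule order_trans[OF 1]) (intro mult_left_mono mult_mono leg uvw K mult_nonneg_nonneg powr_ge_zero order_refl)
  then have "\<epsilon> powr (5 - 4/p) * chaos_remainder \<epsilon> (u powr p) (v powr p) \<mu> \<le> \<epsilon> powr (5 - 4/p) * (K * (w powr (-\<kappa>) * (\<epsilon> powr (\<beta> - (5/2 + \<theta>)) * u powr (-\<kappa>)) * (\<epsilon> powr (\<beta> - (5/2 + \<theta>)) * v powr (-\<kappa>))))"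
    by (intro mult_left_mono) auto
  also have "\<dots> = K * ((\<epsilon> powr (5 - 4/p) * \<epsilon> powr (\<beta> - (5/2 + \<theta>)) * \<epsilon> powr (\<beta> - (5/2 + \<theta>))) * (w powr (-\<kappa>) * u powr (-\<kappa>) * v powr (-\<kappa>)))"
    by simp
  also have "\<epsilon> powr (5 - 4/p) * \<epsilon> powr (\<beta> - (5/2 + \<theta>)) * \<epsilon> powr (\<beta> - (5/2 + \<theta>)) = \<epsilon> powr ((5 - 4/p) + (\<beta> - (5/2 + \<theta>)) + (\<beta> - (5/2 + \<theta>)))"
    by (simp only: powr_add)
  also have "(5 - 4/p) + (\<beta> - (5/2 + \<theta>)) + (\<beta> - (5/2 + \<theta>)) = (2 * \<theta> * (2 - p) - 2 * \<eta>) / p"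
    using p by (simp add: \<beta>_def field_simps)
  also have "2 * \<theta> * (2 - p) = p - 1 - \<eta>" using \<theta>(3) by (simp add: \<kappa>_def algebra_simps)
  also have "w powr (-\<kappa>) * u powr (-\<kappa>) * v powr (-\<kappa>) = (u * w * v) powr (-\<kappa>)"
    using uvw by (simp add: powr_mult mult_ac)
  finally show ?thesis by (simp add: K_def \<kappa>_def \<mu>_def)
qed

section \<open>Integrability of the chain kernels\<close>

definition fbm_incr_cov :: "real \<Rightarrow> real \<Rightarrow> real \<Rightarrow> real \<Rightarrow> real \<Rightarrow> real" where
  "fbm_incr_cov p r s r' s' =
     (\<bar>s - r'\<bar> powr p + \<bar>r - s'\<bar> powr p - \<bar>s - s'\<bar> powr p - \<bar>r - r'\<bar> powr p) / 2"

text \<open>The arguments are meant in increasing order, so the factors are the consecutive gaps.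
  Absolute values keep the kernel nonnegative and measurable for every order, so kernels of the
  wrong order can be added harmlessly.\<close>

definition chain_kernel :: "real \<Rightarrow> real \<Rightarrow> real \<Rightarrow> real \<Rightarrow> real \<Rightarrow> real" where
  "chain_kernel \<kappa> x1 x2 x3 x4 = (\<bar>x2 - x1\<bar> * \<bar>x3 - x2\<bar> * \<bar>x4 - x3\<bar>) powr (-\<kappa>)"

lemma chain_kernel_nonneg [simp]: "0 \<le> chain_kernel \<kappa> x1 x2 x3 x4"
  by (simp add: chain_kernel_def)

text \<open>The six orderings of four points \<open>r < s\<close>, \<open>r' < s'\<close>: disjoint, overlapping and nested intervals.\<close>

definition chain_sum :: "real \<Rightarrow> real \<Rightarrow> real \<Rightarrow> real \<Rightarrow> real \<Rightarrow> real" where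
  "chain_sum \<kappa> r s r' s' =
     chain_kernel \<kappa> r s r' s' + chain_kernel \<kappa> r r' s s' + chain_kernel \<kappa> r r' s' s +
     chain_kernel \<kappa> r' s' r s + chain_kernel \<kappa> r' r s' s + chain_kernel \<kappa> r' r s s'"

lemma measurable_chain_kernel [measurable (raw)]:
  assumes [measurable]: "f \<in> borel_measurable M" "g \<in> borel_measurable M" "h \<in> borel_measurable M" "k \<in> borel_measurable M"
  shows "(\<lambda>x. chain_kernel \<kappa> (f x) (g x) (h x) (k x)) \<in> borel_measurable M"
  unfolding chain_kernel_def by measurable

lemma chaos_remainder_commute: "chaos_remainder \<epsilon> \<nu> \<rho> \<mu> = chaos_remainder \<epsilon> \<rho> \<nu> \<mu>"
  by (simp add: chaos_remainder_def mult.commute)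

lemma fbm_incr_cov_commute: "fbm_incr_cov p r s r' s' = fbm_incr_cov p r' s' r s"
  by (simp add: fbm_incr_cov_def abs_minus_commute)

lemma chain_sum_commute: "chain_sum \<kappa> r s r' s' = chain_sum \<kappa> r' s' r s"
  by (simp add: chain_sum_def)

text \<open>Exchanging the two intervals reduces to \<open>r < r'\<close>, where three
  configurations remain, each controlled by one kernel. The full sum is symmetric and spares later
  arguments the case distinction. Coinciding end points, where a gap would vanish, are
  excluded.\<close>

lemma chaos_remainder_le_chain_sum:
  fixes p \<eta> :: real
  assumes p: "1 < p" "p < 4/3" and \<eta>: "0 \<le> \<eta>" "\<eta> < p - 1"
  obtains C where "0 \<le> C"
    "\<And>\<epsilon> r s r' s'. 0 < \<epsilon> \<Longrightarrow> r < s \<Longrightarrow> r' < s' \<Longrightarrow> r \<noteq> r' \<Longrightarrow> s \<noteq> s' \<Longrightarrow> r \<noteq> s' \<Longrightarrow> r' \<noteq> s \<Longrightarrow>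
      \<epsilon> powr (5 - 4/p) * chaos_remainder \<epsilon> ((s - r) powr p) ((s' - r') powr p) (fbm_incr_cov p r s r' s')
      \<le> C * (\<epsilon> powr ((p - 1 - 3 * \<eta>) / p) * chain_sum (1 - \<eta>) r s r' s')"
proof -
  define C1 where "C1 = (1 - p/2) powr (-(2 * (1 - \<eta>) / p))"
  define C2 where "C2 = (1 - p/2) powr (-(2 * (1 - \<eta>) / p)) + p * (1 - p/2) powr (-(5/2))"
  define C3 where "C3 = 3 * (1 - (p/2)\<^sup>2) powr (-(5/2))"
  define C where "C = C1 + C2 + C3"
  have C: "0 \<le> C1" "0 \<le> C2" "0 \<le> C3" using p by (auto simp: C1_def C2_def C3_def)
  have main: "\<epsilon> powr (5 - 4/p) * chaos_remainder \<epsilon> ((s - r) powr p) ((s' - r') powr p) (fbm_incr_cov p r s r' s')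
      \<le> C * (\<epsilon> powr ((p - 1 - 3 * \<eta>) / p) * chain_sum (1 - \<eta>) r s r' s')"
    if h: "0 < \<epsilon>" "r < s" "r' < s'" "r < r'" "s \<noteq> s'" "r \<noteq> s'" "r' \<noteq> s" for \<epsilon> r s r' s'
  proof -
    define E where "E = \<epsilon> powr ((p - 1 - 3 * \<eta>) / p)"
    have fin: "c * (E * k) \<le> C * (E * chain_sum (1 - \<eta>) r s r' s')"
      if "0 \<le> c" "c \<le> C" "0 \<le> k" "k \<le> chain_sum (1 - \<eta>) r s r' s'" for c k
      using that C by (intro mult_mono) (auto simp: E_def)
    consider "s < r'" | "r' < s" "s < s'" | "s' < s" using h by linarith
    then show ?thesis
    proof cases
      case 1
      have "\<epsilon> powr (5 - 4/p) * chaos_remainder \<epsilon> ((s - r) powr p) ((s' - r') powr p) (fbm_incr_cov p r s r' s')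
         \<le> C3 * (E * chain_kernel (1 - \<eta>) r s r' s')"
        using chaos_remainder_disjoint[of \<epsilon> "s - r" "s' - r'" "r' - s" p \<eta>] 1 h p \<eta>
        by (simp add: fbm_incr_cov_def chain_kernel_def C3_def E_def add_diff_eq algebra_simps)
      also have "\<dots> \<le> C * (E * chain_sum (1 - \<eta>) r s r' s')"
        using C by (intro fin) (auto simp: C_def chain_sum_def)
      finally show ?thesis by (simp add: E_def)
    next
      case 2
      have "\<epsilon> powr (5 - 4/p) * chaos_remainder \<epsilon> ((s - r) powr p) ((s' - r') powr p) (fbm_incr_cov p r s r' s')
         \<le> C1 * (E * chain_kernel (1 - \<eta>) r r' s s')"
        using chaos_remainder_overlap[of \<epsilon> "r' - r" "s - r'" "s' - s" p \<eta>] 2 h p \<eta>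
        by (simp add: fbm_incr_cov_def chain_kernel_def C1_def E_def add_diff_eq algebra_simps)
      also have "\<dots> \<le> C * (E * chain_sum (1 - \<eta>) r s r' s')"
        using C by (intro fin) (auto simp: C_def chain_sum_def)
      finally show ?thesis by (simp add: E_def)
    next
      case 3
      have "\<epsilon> powr (5 - 4/p) * chaos_remainder \<epsilon> ((s - r) powr p) ((s' - r') powr p) (fbm_incr_cov p r s r' s')
         \<le> C2 * (E * chain_kernel (1 - \<eta>) r r' s' s)"
        using chaos_remainder_nested[of \<epsilon> "r' - r" "s' - r'" "s - s'" p \<eta>] 3 h p \<eta>
        by (simp add: fbm_incr_cov_def chain_kernel_def C2_def E_def add_diff_eq algebra_simps)
      also have "\<dots> \<le> C * (E * chain_sum (1 - \<eta>) r s r' s')"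
        using C by (intro fin) (auto simp: C_def chain_sum_def)
      finally show ?thesis by (simp add: E_def)
    qed
  qed
  show thesis
  proof (rule that[of C])
    show "0 \<le> C" using C by (simp add: C_def)
    show "\<epsilon> powr (5 - 4/p) * chaos_remainder \<epsilon> ((s - r) powr p) ((s' - r') powr p) (fbm_incr_cov p r s r' s')
      \<le> C * (\<epsilon> powr ((p - 1 - 3 * \<eta>) / p) * chain_sum (1 - \<eta>) r s r' s')"
      if h: "0 < \<epsilon>" "r < s" "r' < s'" "r \<noteq> r'" "s \<noteq> s'" "r \<noteq> s'" "r' \<noteq> s" for \<epsilon> r s r' s'
    proof (cases "r < r'")
      case True then show ?thesis using main h by simp
    next
      case False
      then have "r' < r" using h by simp
      then show ?thesis
        using main[of \<epsilon> r' s' r s] h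
        by (simp add: chaos_remainder_commute[of _ "(s - r) powr p"] fbm_incr_cov_commute[of p r] chain_sum_commute[of _ r])
    qed
  qed
qed

text \<open>A density, rather than a restricted space, keeps \<^term>\<open>UNIV\<close> as underlying space.\<close>

definition Icc_measure :: "real \<Rightarrow> real measure" where
  "Icc_measure t = density lborel (\<lambda>x. ennreal (indicator {0..t} x))"

abbreviation Icc_square :: "real \<Rightarrow> (real \<times> real) measure" where
  "Icc_square t \<equiv> Icc_measure t \<Otimes>\<^sub>M Icc_measure t"

text \<open>Pairs are \<open>z = (s, r)\<close>: the upper end of the time interval comes first.\<close>

abbreviation in_triangle :: "real \<Rightarrow> real \<times> real \<Rightarrow> bool" where
  "in_triangle t z \<equiv> 0 \<le> snd z \<and> snd z \<le> fst z \<and> fst z \<le> t"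

section \<open>Lebesgue measure on a bounded interval and iterated integrals of the chain
  kernels\<close>

lemma space_Icc_measure [simp]: "space (Icc_measure t) = UNIV"
  and sets_Icc_measure [simp, measurable_cong]: "sets (Icc_measure t) = sets borel"
  by (simp_all add: Icc_measure_def)

lemma finite_Icc_measure: "finite_measure (Icc_measure t)"
  by (rule finite_measureI)
     (simp add: Icc_measure_def emeasure_density ennreal_indicator emeasure_lborel_Icc_eq)

lemma AE_Icc_measure: "AE x in Icc_measure t. x \<in> {0..t}"
  unfolding Icc_measure_def by (subst AE_density) (auto simp: indicator_def)

lemma AE_Icc_measure_neq: "AE x in Icc_measure t. x \<noteq> y"
  using AE_lborel_singleton[of y] unfolding Icc_measure_def by (subst AE_density) auto

lemma nn_integral_Icc_measure:
  "f \<in> borel_measurable borel \<Longrightarrow>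
     (\<integral>\<^sup>+x. f x \<partial>Icc_measure t) = (\<integral>\<^sup>+x. indicator {0..t} x * f x \<partial>lborel)"
  by (simp add: Icc_measure_def nn_integral_density ennreal_indicator)

text \<open>To the left and to the right of \<open>y\<close> the integrand is a reflected or
  translated copy of \<open>x powr (-\<kappa>)\<close> on a part of \<open>{0..t}\<close>. The bound
  is uniform in \<open>y\<close>, so a chain can be integrated one variable at a time.\<close>

lemma nn_integral_abs_diff_powr_le:
  fixes t \<kappa> y :: real
  assumes t: "0 \<le> t" and \<kappa>: "\<kappa> < 1" and y: "y \<in> {0..t}"
  shows "(\<integral>\<^sup>+x. ennreal (\<bar>x - y\<bar> powr (-\<kappa>)) \<partial>Icc_measure t)
       \<le> 2 * ennreal (t powr (1 - \<kappa>) / (1 - \<kappa>))"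
proof -
  define k where "k = (\<lambda>x::real. ennreal (indicator {0..t} x * \<bar>x\<bar> powr (-\<kappa>)))"
  have k [measurable]: "k \<in> borel_measurable borel" unfolding k_def by measurable
  have "((\<lambda>x. x powr (-\<kappa>)) has_integral (t powr (-\<kappa> + 1) / (-\<kappa> + 1))) {0..t}"
    using t \<kappa> by (intro has_integral_powr_from_0) auto
  then have "((\<lambda>x. \<bar>x\<bar> powr (-\<kappa>)) has_integral (t powr (1 - \<kappa>) / (1 - \<kappa>))) {0..t}"
    by (rule has_integral_eq_rhs[OF has_integral_eq, rotated]) auto
  then have kint: "(\<integral>\<^sup>+x. k x \<partial>lborel) = ennreal (t powr (1 - \<kappa>) / (1 - \<kappa>))"
    unfolding k_def by (rule nn_integral_has_integral_lebesgue[rotated]) simp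
  have "(\<integral>\<^sup>+x. ennreal (\<bar>x - y\<bar> powr (-\<kappa>)) \<partial>Icc_measure t)
     = (\<integral>\<^sup>+x. indicator {0..t} x * ennreal (\<bar>x - y\<bar> powr (-\<kappa>)) \<partial>lborel)"
    by (rule nn_integral_Icc_measure) measurable
  also have "\<dots> \<le> (\<integral>\<^sup>+x. k (x - y) + k (y - x) \<partial>lborel)"
    using y by (intro nn_integral_mono) (auto simp: k_def indicator_def abs_minus_commute)
  also have "\<dots> = (\<integral>\<^sup>+x. k (x - y) \<partial>lborel) + (\<integral>\<^sup>+x. k (y - x) \<partial>lborel)"
    by (intro nn_integral_add) measurable
  also have "(\<integral>\<^sup>+x. k (x - y) \<partial>lborel) = (\<integral>\<^sup>+x. k x \<partial>lborel)"
    using nn_integral_real_affine[OF k, of 1 "-y"] by simp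
  also have "(\<integral>\<^sup>+x. k (y - x) \<partial>lborel) = (\<integral>\<^sup>+x. k x \<partial>lborel)"
    using nn_integral_real_affine[OF k, of "-1" y] by simp
  finally show ?thesis by (simp add: kint mult_2)
qed

text \<open>Adjacent transpositions generate all permutations of the four variables, which reduces
  every ordering to a single reference integral.\<close>

lemma nn_integral4_swaps:
  fixes F :: "'a \<times> 'a \<times> 'a \<times> 'a \<Rightarrow> ennreal"
  assumes "sigma_finite_measure Q"
    and [measurable]: "F \<in> borel_measurable (Q \<Otimes>\<^sub>M Q \<Otimes>\<^sub>M Q \<Otimes>\<^sub>M Q)"
  defines "I \<equiv> (\<lambda>f::'a \<Rightarrow> 'a \<Rightarrow> 'a \<Rightarrow> 'a \<Rightarrow> ennreal. \<integral>\<^sup>+a. \<integral>\<^sup>+b. \<integral>\<^sup>+c. \<integral>\<^sup>+d. f a b c d \<partial>Q \<partial>Q \<partial>Q \<partial>Q)"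
  shows nn_integral4_swap12: "I (\<lambda>a b c d. F (b, a, c, d)) = I (\<lambda>a b c d. F (a, b, c, d))" (is ?goal1)
    and nn_integral4_swap23: "I (\<lambda>a b c d. F (a, c, b, d)) = I (\<lambda>a b c d. F (a, b, c, d))" (is ?goal2)
    and nn_integral4_swap34: "I (\<lambda>a b c d. F (a, b, d, c)) = I (\<lambda>a b c d. F (a, b, c, d))" (is ?goal3)
proof -
  interpret sigma_finite_measure Q by fact
  interpret pair_sigma_finite Q Q ..
  show ?goal1
    unfolding I_def by (rule Fubini') measurable
  show ?goal2
    unfolding I_def by (intro nn_integral_cong Fubini') measurable
  show ?goal3
    unfolding I_def by (intro nn_integral_cong Fubini') measurable
qed

text \<open>Each variable of a chain is tied only to its neighbours. Integrating from the last one
  inwards, each of three integrations costs a factor \<open>M\<close> and the fourth the total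
  mass.\<close>

lemma nn_integral_chain_kernel_finite:
  fixes t \<kappa> :: real
  assumes t: "0 < t" and \<kappa>: "0 \<le> \<kappa>" "\<kappa> < 1"
  defines "Q \<equiv> Icc_measure t"
  shows "(\<integral>\<^sup>+a. \<integral>\<^sup>+b. \<integral>\<^sup>+c. \<integral>\<^sup>+d. ennreal (chain_kernel \<kappa> a b c d) \<partial>Q \<partial>Q \<partial>Q \<partial>Q) < \<infinity>"
proof -
  interpret Q: finite_measure Q unfolding Q_def by (rule finite_Icc_measure)
  define M where "M = 2 * ennreal (t powr (1 - \<kappa>) / (1 - \<kappa>))"
  define k where "k = (\<lambda>x y::real. ennreal (\<bar>x - y\<bar> powr (-\<kappa>)))"
  have Qm[measurable_cong]: "sets Q = sets borel" by (simp add: Q_def)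
  have [measurable]: "(\<lambda>(x, y). k x y) \<in> borel_measurable (borel \<Otimes>\<^sub>M borel)"
    unfolding k_def by measurable
  \<comment> \<open>The uniform bound concerns \<open>y\<close> in \<open>{0..t}\<close>, which is
    almost every point for \<open>Q\<close>.\<close>
  have k: "AE y in Q. (\<integral>\<^sup>+x. k x y \<partial>Q) \<le> M"
    unfolding Q_def k_def M_def
    using AE_Icc_measure by eventually_elim (use t \<kappa> in \<open>intro nn_integral_abs_diff_powr_le; simp\<close>)
  have chain: "ennreal (chain_kernel \<kappa> a b c d) = k b a * (k c b * k d c)" for a b c d
    by (simp add: chain_kernel_def k_def powr_mult ennreal_mult[symmetric] mult.assoc)
  have "(\<integral>\<^sup>+a. \<integral>\<^sup>+b. \<integral>\<^sup>+c. \<integral>\<^sup>+d. ennreal (chain_kernel \<kappa> a b c d) \<partial>Q \<partial>Q \<partial>Q \<partial>Q)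
     = (\<integral>\<^sup>+a. \<integral>\<^sup>+b. k b a * (\<integral>\<^sup>+c. k c b * (\<integral>\<^sup>+d. k d c \<partial>Q) \<partial>Q) \<partial>Q \<partial>Q)"
    by (simp add: chain nn_integral_cmult)
  also have "\<dots> \<le> (\<integral>\<^sup>+a. \<integral>\<^sup>+b. k b a * (\<integral>\<^sup>+c. k c b * M \<partial>Q) \<partial>Q \<partial>Q)"
  proof (rule nn_integral_mono, rule nn_integral_mono, rule mult_left_mono)
    show "(\<integral>\<^sup>+c. k c b * (\<integral>\<^sup>+d. k d c \<partial>Q) \<partial>Q) \<le> (\<integral>\<^sup>+c. k c b * M \<partial>Q)" for b
      by (rule nn_integral_mono_AE) (use k in eventually_elim, auto intro: mult_left_mono)
  qed simp
  also have "\<dots> \<le> (\<integral>\<^sup>+a. \<integral>\<^sup>+b. k b a * (M * M) \<partial>Q \<partial>Q)"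
  proof (rule nn_integral_mono)
    show "(\<integral>\<^sup>+b. k b a * (\<integral>\<^sup>+c. k c b * M \<partial>Q) \<partial>Q) \<le> (\<integral>\<^sup>+b. k b a * (M * M) \<partial>Q)" for a
      by (rule nn_integral_mono_AE)
         (use k in eventually_elim, auto simp: nn_integral_multc intro!: mult_left_mono mult_right_mono)
  qed
  also have "\<dots> \<le> (\<integral>\<^sup>+a. M * (M * M) \<partial>Q)"
    by (rule nn_integral_mono_AE)
       (use k in eventually_elim, auto simp: nn_integral_multc intro!: mult_right_mono)
  also have "\<dots> < \<infinity>"
  proof -
    have "emeasure Q (space Q) < \<infinity>" using Q.emeasure_finite[of "space Q"] by (simp only: less_top infinity_ennreal_def)
    then show ?thesis by (auto simp: M_def ennreal_mult_less_top)
  qed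
  finally show ?thesis .
qed

text \<open>All six orderings have the same integral. Reversal invariance of the kernel settles one
  of them at once and shortens the chain of transpositions for two others.\<close>

lemma nn_integral_chain_sum_finite:
  fixes t \<kappa> :: real
  assumes t: "0 < t" and \<kappa>: "0 \<le> \<kappa>" "\<kappa> < 1"
  defines "Q \<equiv> Icc_measure t"
  shows "(\<integral>\<^sup>+s. \<integral>\<^sup>+r. \<integral>\<^sup>+s'. \<integral>\<^sup>+r'. ennreal (chain_sum \<kappa> r s r' s') \<partial>Q \<partial>Q \<partial>Q \<partial>Q) < \<infinity>"
proof -
  define I where "I = (\<lambda>f::real \<Rightarrow> real \<Rightarrow> real \<Rightarrow> real \<Rightarrow> ennreal. \<integral>\<^sup>+a. \<integral>\<^sup>+b. \<integral>\<^sup>+c. \<integral>\<^sup>+d. f a b c d \<partial>Q \<partial>Q \<partial>Q \<partial>Q)"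
  let ?C = "\<lambda>a b c d. ennreal (chain_kernel \<kappa> a b c d)"
  interpret Q: finite_measure Q unfolding Q_def by (rule finite_Icc_measure)
  have Qm[measurable_cong]: "sets Q = sets borel" by (simp add: Q_def)
  have rev: "?C a b c d = ?C d c b a" for a b c d
    by (simp add: chain_kernel_def abs_minus_commute mult_ac)
  note swap = nn_integral4_swap12[OF Q.sigma_finite_measure_axioms]
    nn_integral4_swap23[OF Q.sigma_finite_measure_axioms] nn_integral4_swap34[OF Q.sigma_finite_measure_axioms]
  have sw12: "I (\<lambda>a b c d. f b a c d) = I f" and sw23: "I (\<lambda>a b c d. f a c b d) = I f" and sw34: "I (\<lambda>a b c d. f a b d c) = I f"
    if "(\<lambda>(a, b, c, d). f a b c d) \<in> borel_measurable (Q \<Otimes>\<^sub>M Q \<Otimes>\<^sub>M Q \<Otimes>\<^sub>M Q)" for f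
    using swap[OF that] by (simp_all add: I_def)
  have "I (\<lambda>s r s' r'. ?C r s r' s') = I (\<lambda>a b c d. ?C a b d c)"
    by (rule sw12) measurable
  also have "\<dots> = I ?C" by (rule sw34) measurable
  finally have 1: "I (\<lambda>s r s' r'. ?C r s r' s') = I ?C" .
  have "I (\<lambda>s r s' r'. ?C r r' s s') = I (\<lambda>a b c d. ?C a d b c)" by (rule sw12) measurable
  also have "\<dots> = I (\<lambda>a b c d. ?C a c b d)" by (rule sw34) measurable
  also have "\<dots> = I ?C" by (rule sw23) measurable
  finally have 2: "I (\<lambda>s r s' r'. ?C r r' s s') = I ?C" .
  have "I (\<lambda>s r s' r'. ?C r r' s' s) = I (\<lambda>a b c d. ?C a d c b)" by (rule sw12) measurable
  also have "\<dots> = I (\<lambda>a b c d. ?C a c d b)" by (rule sw34) measurable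
  also have "\<dots> = I (\<lambda>a b c d. ?C a b d c)" by (rule sw23) measurable
  also have "\<dots> = I ?C" by (rule sw34) measurable
  finally have 3: "I (\<lambda>s r s' r'. ?C r r' s' s) = I ?C" .
  have 4: "I (\<lambda>s r s' r'. ?C r' s' r s) = I ?C" by (subst rev) (rule refl)
  have "I (\<lambda>s r s' r'. ?C r' r s' s) = I (\<lambda>s r s' r'. ?C s s' r r')" by (subst rev) (rule refl)
  also have "\<dots> = I ?C" by (rule sw23) measurable
  finally have 5: "I (\<lambda>s r s' r'. ?C r' r s' s) = I ?C" .
  have "I (\<lambda>s r s' r'. ?C r' r s s') = I (\<lambda>s r s' r'. ?C s' s r r')" by (subst rev) (rule refl)
  also have "\<dots> = I (\<lambda>a b c d. ?C b a c d)" by (rule sw23) measurable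
  also have "\<dots> = I ?C" by (rule sw12) measurable
  finally have 6: "I (\<lambda>s r s' r'. ?C r' r s s') = I ?C" .
  have "(\<integral>\<^sup>+s. \<integral>\<^sup>+r. \<integral>\<^sup>+s'. \<integral>\<^sup>+r'. ennreal (chain_sum \<kappa> r s r' s') \<partial>Q \<partial>Q \<partial>Q \<partial>Q)
     = I (\<lambda>s r s' r'. ?C r s r' s' + ?C r r' s s' + ?C r r' s' s + ?C r' s' r s + ?C r' r s' s + ?C r' r s s')"
    by (simp add: I_def chain_sum_def)
  also have "\<dots> = I (\<lambda>s r s' r'. ?C r s r' s') + I (\<lambda>s r s' r'. ?C r r' s s') + I (\<lambda>s r s' r'. ?C r r' s' s)
     + I (\<lambda>s r s' r'. ?C r' s' r s) + I (\<lambda>s r s' r'. ?C r' r s' s) + I (\<lambda>s r s' r'. ?C r' r s s')"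
    unfolding I_def by (simp add: nn_integral_add)
  also have "\<dots> = I ?C + I ?C + I ?C + I ?C + I ?C + I ?C"
    by (simp only: 1 2 3 4 5 6)
  also have "\<dots> < \<infinity>"
    using nn_integral_chain_kernel_finite[OF assms(1-3)] by (simp add: I_def Q_def)
  finally show ?thesis .
qed

section \<open>Gaussian integrals\<close>

abbreviation bell :: "real \<Rightarrow> real" where
  "bell x \<equiv> exp (- x\<^sup>2 / 2)"

lemma normal_density_scale:
  assumes "0 < \<sigma>"
  shows "normal_density 0 \<sigma> (x * \<sigma>) = std_normal_density x / \<sigma>"
  using assms by (simp add: normal_density_def power_mult_distrib real_sqrt_mult)

abbreviation gaussian_char :: "real \<Rightarrow> real \<Rightarrow> real \<Rightarrow> real \<Rightarrow> real \<Rightarrow> real" where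
  "gaussian_char \<nu> \<mu> \<rho> \<xi> \<eta> \<equiv> exp (- ((\<nu> * \<xi>\<^sup>2 + 2 * \<mu> * \<xi> * \<eta> + \<rho> * \<eta>\<^sup>2) / 2))"

lemma gaussian_law_cases:
  assumes "0 \<le> v"
  obtains "v = 0" "gaussian_law m v = return borel m"
  | \<sigma> where "0 < \<sigma>" "v = \<sigma>\<^sup>2" "gaussian_law m v = density lborel (\<lambda>x. ennreal (normal_density m \<sigma> x))"
proof (cases "v = 0")
  case True then show ?thesis using that(1) by (simp add: gaussian_law_def)
next
  case False
  then show ?thesis using that(2)[of "sqrt v"] assms by (simp add: gaussian_law_def)
qed

lemma sets_gaussian_law [simp, measurable_cong]: "sets (gaussian_law m v) = sets borel"
  by (simp add: gaussian_law_def)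

lemma char_gaussian_law:
  assumes "0 \<le> v"
  shows "char (gaussian_law 0 v) \<theta> = exp (- (v * \<theta>\<^sup>2 / 2))"
  using assms
proof (cases rule: gaussian_law_cases[where m=0])
  case 1
  then show ?thesis by (simp add: char_def integral_return)
next
  case (2 \<sigma>)
  have "char (gaussian_law 0 v) \<theta> = (CLBINT x. normal_density 0 \<sigma> x *\<^sub>R iexp (\<theta> * x))"
    unfolding char_def 2(3) by (subst integral_density) auto
  also have "\<dots> = (CLBINT x. std_normal_density x *\<^sub>R iexp (\<theta> * \<sigma> * x))"
    using 2(1) by (subst lborel_integral_real_affine[of \<sigma> _ 0])
      (auto simp: normal_density_scale integral_scaleR_right[symmetric] mult_ac simp del: integral_scaleR_right)
  also have "\<dots> = char std_normal_distribution (\<theta> * \<sigma>)"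
    unfolding char_def by (subst integral_density) auto
  finally show ?thesis using 2(2) by (simp add: char_std_normal_distribution power_mult_distrib mult_ac)
qed

lemma gaussian_law_second_moment:
  assumes "0 \<le> v"
  shows "integrable (gaussian_law 0 v) (\<lambda>x. x\<^sup>2)" "(LINT x|gaussian_law 0 v. x\<^sup>2) = v"
proof -
  have "integrable (gaussian_law 0 v) (\<lambda>x. x\<^sup>2) \<and> (LINT x|gaussian_law 0 v. x\<^sup>2) = v"
    using assms
  proof (cases rule: gaussian_law_cases[where m=0])
    case 1
    then show ?thesis by (simp add: integral_return integrable_iff_bounded nn_integral_return)
  next
    case (2 \<sigma>)
    show ?thesis
      unfolding 2(3)
      using integrable_normal_moment[of \<sigma> 0 2] integral_normal_moment_even[of \<sigma> 0 1] 2(1,2)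
      by (subst integrable_density, simp, simp, simp, subst integral_density) (auto simp: fact_numeral)
  qed
  then show "integrable (gaussian_law 0 v) (\<lambda>x. x\<^sup>2)" "(LINT x|gaussian_law 0 v. x\<^sup>2) = v" by auto
qed

lemma std_normal_density_has_derivative:
  "(std_normal_density has_real_derivative - x * std_normal_density x) (at x)"
  unfolding std_normal_density_def[abs_def] by (auto intro!: derivative_eq_intros simp: field_simps)

lemma std_normal_density_tendsto_0: "(std_normal_density \<longlongrightarrow> 0) at_top" "(std_normal_density \<longlongrightarrow> 0) at_bot"
proof -
  have "filterlim (\<lambda>x::real. - (x\<^sup>2) / 2) at_bot F" if "filterlim (\<lambda>x::real. x\<^sup>2) at_top F" for F
    using filterlim_tendsto_pos_mult_at_top[OF tendsto_const _ that, of "1/2"]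
    by (simp add: filterlim_uminus_at_bot mult.commute)
  then have "((\<lambda>x::real. exp (- (x\<^sup>2) / 2)) \<longlongrightarrow> 0) F" if "filterlim (\<lambda>x::real. x\<^sup>2) at_top F" for F
    using that filterlim_compose[OF exp_at_bot] by blast
  then have "(std_normal_density \<longlongrightarrow> 0) F" if "filterlim (\<lambda>x::real. x\<^sup>2) at_top F" for F
    unfolding std_normal_density_def[abs_def] using that by (intro tendsto_mult_right_zero) auto
  moreover have "filterlim (\<lambda>x::real. x\<^sup>2) at_top at_top"
    by (intro filterlim_pow_at_top filterlim_ident) simp
  moreover have "filterlim (\<lambda>x::real. x\<^sup>2) at_top at_bot"
    by (intro filterlim_pow_at_bot_even filterlim_ident) simp_all
  ultimately show "(std_normal_density \<longlongrightarrow> 0) at_top" "(std_normal_density \<longlongrightarrow> 0) at_bot" by auto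
qed

text \<open>Integration by parts: the total derivative of density times exponential integrates to 0.
  Thus \<open>y * bell y\<close> is, up to the factor \<open>\<i>\<close>, a Fourier integral
  against the normal law, and its expectation needs only characteristic functions.\<close>

lemma std_normal_first_Fourier_moment:
  "(CLINT \<xi>|std_normal_distribution. \<xi> *\<^sub>R iexp (y * \<xi>)) = \<i> * complex_of_real (y * exp (- y\<^sup>2 / 2))"
proof -
  let ?F = "\<lambda>x. std_normal_density x *\<^sub>R iexp (y * x)"
  let ?f = "\<lambda>x. (\<i> * y) * (std_normal_density x *\<^sub>R iexp (y * x)) - std_normal_density x *\<^sub>R (x *\<^sub>R iexp (y * x))"
  have i1: "integrable lborel ?F"
    by (rule Bochner_Integration.integrable_bound[OF integrable_normal_density[of 1 0]]) auto
  have i2: "integrable lborel (\<lambda>x. std_normal_density x *\<^sub>R (x *\<^sub>R iexp (y * x)))"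
    by (rule Bochner_Integration.integrable_bound[OF integrable_std_normal_moment[of 1]]) (auto simp: norm_mult)
  have i: "integrable lborel ?f"
    using i1 i2 by (intro Bochner_Integration.integrable_diff integrable_mult_right)
  have "(LBINT x=-\<infinity>..\<infinity>. ?f x) = 0 - 0"
  proof (rule interval_integral_FTC_integrable)
    show "(?F has_vector_derivative ?f x) (at x)" for x
    proof -
      have "((\<lambda>x. iexp (y * x)) has_vector_derivative \<i> * y * iexp (y * x)) (at x)"
        using has_vector_derivative_real_field[of "\<lambda>z. exp (\<i> * (complex_of_real y * z))" "\<i> * y * iexp (y * x)" x UNIV]
        by (force intro!: derivative_eq_intros)
      then show ?thesis
        by (rule has_vector_derivative_eq_rhs[OF has_vector_derivative_scaleR[OF std_normal_density_has_derivative]])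
           (simp add: scaleR_conv_of_real)
    qed
    show "isCont ?f x" for x
      unfolding std_normal_density_def by (intro continuous_intros) auto
    show "set_integrable lborel (einterval (- \<infinity>) \<infinity>) ?f"
      using i by (simp add: set_integrable_def einterval_def)
    show "((?F \<circ> real_of_ereal) \<longlongrightarrow> 0) (at_right (- \<infinity>))"
      unfolding ereal_tendsto_simps by (rule tendsto_norm_zero_cancel) (simp add: std_normal_density_tendsto_0)
    show "((?F \<circ> real_of_ereal) \<longlongrightarrow> 0) (at_left \<infinity>)"
      unfolding ereal_tendsto_simps by (rule tendsto_norm_zero_cancel) (simp add: std_normal_density_tendsto_0)
  qed auto
  then have A: "(LBINT x. ?f x) = 0" by (simp add: interval_integral_to_infinity_eq interval_lebesgue_integral_def einterval_def set_lebesgue_integral_def)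
  have B: "(LBINT x. ?f x) = (LBINT x. (\<i> * y) * ?F x) - (LBINT x. std_normal_density x *\<^sub>R (x *\<^sub>R iexp (y * x)))"
    by (rule Bochner_Integration.integral_diff[OF integrable_mult_right[OF i1] i2])
  have C: "(LBINT x. (\<i> * y) * ?F x) = (\<i> * y) * (LBINT x. ?F x)"
    by (rule integral_mult_right_zero)
  have "(\<i> * y) * (LBINT x. ?F x) = (LBINT x. std_normal_density x *\<^sub>R (x *\<^sub>R iexp (y * x)))"
    unfolding C[symmetric] using A unfolding B by (rule iffD1[OF right_minus_eq])
  moreover have "(LBINT x. ?F x) = char std_normal_distribution y"
    unfolding char_def by (subst integral_density) auto
  moreover have "(CLINT \<xi>|std_normal_distribution. \<xi> *\<^sub>R iexp (y * \<xi>)) = (LBINT x. std_normal_density x *\<^sub>R (x *\<^sub>R iexp (y * x)))"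
    by (subst integral_density) auto
  ultimately show ?thesis by (simp add: char_std_normal_distribution mult.assoc)
qed

section \<open>Expectations of functions of a Gaussian pair by Fourier representation\<close>

lemma (in pair_sigma_finite) integral_product_mult:
  fixes f :: "'a \<Rightarrow> 'c::{real_normed_field, banach, second_countable_topology}"
  assumes f: "integrable M1 f" and g: "integrable M2 g"
  shows integrable_product_mult: "integrable (M1 \<Otimes>\<^sub>M M2) (\<lambda>z. f (fst z) * g (snd z))"
    and "integral\<^sup>L (M1 \<Otimes>\<^sub>M M2) (\<lambda>z. f (fst z) * g (snd z)) = integral\<^sup>L M1 f * integral\<^sup>L M2 g" (is ?goal1)
proof -
  have [measurable]: "f \<in> borel_measurable M1" "g \<in> borel_measurable M2" using f g by auto
  show *: "integrable (M1 \<Otimes>\<^sub>M M2) (\<lambda>z. f (fst z) * g (snd z))"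
    by (rule Fubini_integrable) (use f g in \<open>simp_all add: norm_mult\<close>)
  show ?goal1
    using integral_fst'[OF *] by simp
qed

text \<open>The characteristic function, unlike a density, also covers degenerate pairs, which occur
  for coinciding times and for scaling by 0.\<close>

definition jointly_gaussian :: "'a measure \<Rightarrow> ('a \<Rightarrow> real) \<Rightarrow> ('a \<Rightarrow> real) \<Rightarrow> real \<Rightarrow> real \<Rightarrow> real \<Rightarrow> bool" where
  "jointly_gaussian M X Y \<nu> \<mu> \<rho> \<longleftrightarrow>
     X \<in> borel_measurable M \<and> Y \<in> borel_measurable M \<and>
     (\<forall>\<xi> \<eta>. (CLINT \<omega>|M. iexp (\<xi> * X \<omega> + \<eta> * Y \<omega>)) =
        complex_of_real (gaussian_char \<nu> \<mu> \<rho> \<xi> \<eta>))"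

text \<open>A Parseval formula: Fubini moves the expectation inside, where only the joint
  characteristic function is left. It is used with \<open>h\<close> constant 1 and with
  \<open>h\<close> the identity.\<close>

lemma (in prob_space) jointly_gaussian_Fourier:
  fixes h :: "real \<Rightarrow> real"
  assumes G: "jointly_gaussian M X Y \<nu> \<mu> \<rho>"
    and h: "integrable std_normal_distribution h"
  defines "N \<equiv> std_normal_distribution"
  shows "(CLINT \<omega>|M. (CLINT \<xi>|N. h \<xi> *\<^sub>R iexp (X \<omega> * \<xi>)) * (CLINT \<eta>|N. h \<eta> *\<^sub>R iexp (Y \<omega> * \<eta>)))
       = complex_of_real (LINT \<xi>|N. LINT \<eta>|N. h \<xi> * h \<eta> * gaussian_char \<nu> \<mu> \<rho> \<xi> \<eta>)"
proof -
  interpret N: real_distribution N unfolding N_def by (rule real_dist_normal_dist)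
  interpret NN: pair_prob_space N N ..
  interpret P: pair_sigma_finite M "N \<Otimes>\<^sub>M N" ..
  have [measurable]: "X \<in> borel_measurable M" "Y \<in> borel_measurable M" "h \<in> borel_measurable N"
    using G h by (auto simp: jointly_gaussian_def N_def)
  have hN: "integrable N h" using h by (simp add: N_def)
  define f where "f = (\<lambda>\<omega> z. (h (fst z) * h (snd z)) *\<^sub>R iexp (fst z * X \<omega> + snd z * Y \<omega>))"
  have hh: "integrable (N \<Otimes>\<^sub>M N) (\<lambda>z. h (fst z) * h (snd z))"
    by (rule NN.integral_product_mult(1)[OF hN hN])
  have f: "integrable (M \<Otimes>\<^sub>M (N \<Otimes>\<^sub>M N)) (\<lambda>(\<omega>, z). f \<omega> z)"
  proof (rule Bochner_Integration.integrable_bound)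
    show "integrable (M \<Otimes>\<^sub>M (N \<Otimes>\<^sub>M N)) (\<lambda>x. 1 * (h (fst (snd x)) * h (snd (snd x))))"
      using P.integral_product_mult(1)[OF _ hh, of "\<lambda>_. 1"] by simp
  qed (auto simp: f_def split_beta)
  have iE: "integrable (N \<Otimes>\<^sub>M N) (\<lambda>z. h (fst z) * h (snd z) * gaussian_char \<nu> \<mu> \<rho> (fst z) (snd z))"
  proof (rule Bochner_Integration.integrable_bound[OF hh])
    \<comment> \<open>Bounded because it is a characteristic function; definiteness of the quadratic
      form is a consequence, not an input.\<close>
    have "gaussian_char \<nu> \<mu> \<rho> \<xi> \<eta> \<le> 1" for \<xi> \<eta>
    proof -
      have "gaussian_char \<nu> \<mu> \<rho> \<xi> \<eta> = cmod (CLINT \<omega>|M. iexp (\<xi> * X \<omega> + \<eta> * Y \<omega>))"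
        using G by (simp add: jointly_gaussian_def del: of_real_exp)
      also have "\<dots> \<le> (LINT \<omega>|M. cmod (iexp (\<xi> * X \<omega> + \<eta> * Y \<omega>)))" by (rule integral_norm_bound)
      finally show ?thesis by (simp add: prob_space del: of_real_add of_real_mult)
    qed
    then show "AE z in N \<Otimes>\<^sub>M N. norm (h (fst z) * h (snd z) * gaussian_char \<nu> \<mu> \<rho> (fst z) (snd z))
        \<le> norm (h (fst z) * h (snd z))"
      by (intro AE_I2) (auto simp: abs_mult intro!: mult_left_le)
  qed measurable
  have iN: "complex_integrable N (\<lambda>\<xi>. h \<xi> *\<^sub>R iexp (y * \<xi>))" for y
    by (rule Bochner_Integration.integrable_bound[OF hN]) auto
  have "(CLINT \<omega>|M. (CLINT \<xi>|N. h \<xi> *\<^sub>R iexp (X \<omega> * \<xi>)) * (CLINT \<eta>|N. h \<eta> *\<^sub>R iexp (Y \<omega> * \<eta>)))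
      = (CLINT \<omega>|M. CLINT z|N \<Otimes>\<^sub>M N. f \<omega> z)"
    by (simp only: NN.integral_product_mult(2)[OF iN iN, symmetric])
       (simp add: f_def exp_add[symmetric] ring_distribs mult_ac)
  also have "\<dots> = (CLINT z|N \<Otimes>\<^sub>M N. CLINT \<omega>|M. f \<omega> z)"
    using P.Fubini_integral[OF f] by simp
  also have "\<dots> = (CLINT z|N \<Otimes>\<^sub>M N. complex_of_real (h (fst z) * h (snd z) * gaussian_char \<nu> \<mu> \<rho> (fst z) (snd z)))"
    using G by (intro Bochner_Integration.integral_cong refl) (simp add: f_def jointly_gaussian_def scaleR_conv_of_real)
  also have "\<dots> = complex_of_real (LINT z|(N \<Otimes>\<^sub>M N). (h (fst z) * h (snd z) * gaussian_char \<nu> \<mu> \<rho> (fst z) (snd z)))"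
    by (rule integral_of_real[OF iE])
  also have "(LINT z|(N \<Otimes>\<^sub>M N). (h (fst z) * h (snd z) * gaussian_char \<nu> \<mu> \<rho> (fst z) (snd z)))
    = (LINT \<xi>|N. LINT \<eta>|N. h \<xi> * h \<eta> * gaussian_char \<nu> \<mu> \<rho> \<xi> \<eta>)"
  proof -
    from NN.integral_fst'[OF iE] show ?thesis by simp
  qed
  finally show ?thesis .
qed

text \<open>Completing the square: the weighted density is a multiple of the normal density with
  mean \<open>- b / (1 + a)\<close> and variance \<open>1 / (1 + a)\<close>.\<close>

lemma gaussian_quadratic_integrals:
  fixes a b :: real
  assumes a: "0 \<le> a"
  defines "N \<equiv> std_normal_distribution"
  shows "(LINT x|N. exp (- ((a * x\<^sup>2 + 2 * b * x) / 2))) = exp (b\<^sup>2 / (2 * (1 + a))) / sqrt (1 + a)" (is ?goal1)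
    and "(LINT x|N. x * exp (- ((a * x\<^sup>2 + 2 * b * x) / 2))) = - (b / (1 + a)) * exp (b\<^sup>2 / (2 * (1 + a))) / sqrt (1 + a)" (is ?goal2)
proof -
  define R where "R = 1 + a"
  define E where "E = exp (b\<^sup>2 / (2 * R)) / sqrt R"
  have R: "0 < R" using a by (simp add: R_def)
  have *: "std_normal_density x * exp (- ((a * x\<^sup>2 + 2 * b * x) / 2)) = E * normal_density (- (b / R)) (1 / sqrt R) x" for x
  proof -
    have "- x\<^sup>2 / 2 + - ((a * x\<^sup>2 + 2 * b * x) / 2) = b\<^sup>2 / (2 * R) + - (x - - (b / R))\<^sup>2 / (2 * (1 / sqrt R)\<^sup>2)"
      using R by (simp add: power_divide field_simps power2_eq_square) (simp add: R_def algebra_simps)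
    then have "exp (- x\<^sup>2 / 2) * exp (- ((a * x\<^sup>2 + 2 * b * x) / 2)) = exp (b\<^sup>2 / (2 * R)) * exp (- (x - - (b / R))\<^sup>2 / (2 * (1 / sqrt R)\<^sup>2))"
      by (simp only: exp_add[symmetric])
    then show ?thesis
      using R by (simp add: E_def normal_density_def power_divide real_sqrt_divide real_sqrt_mult)
  qed
  have "(LINT x|N. exp (- ((a * x\<^sup>2 + 2 * b * x) / 2))) = (LBINT x. std_normal_density x * exp (- ((a * x\<^sup>2 + 2 * b * x) / 2)))"
    unfolding N_def by (subst integral_density) auto
  also have "\<dots> = E" using R by (simp add: *)
  finally show ?goal1
    by (simp add: E_def R_def)
  have "(LINT x|N. x * exp (- ((a * x\<^sup>2 + 2 * b * x) / 2))) = (LBINT x. x * (std_normal_density x * exp (- ((a * x\<^sup>2 + 2 * b * x) / 2))))"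
    unfolding N_def by (subst integral_density) (auto simp: mult_ac)
  also have "\<dots> = (LBINT x. E * (normal_density (- (b / R)) (1 / sqrt R) x * x))"
    by (simp only: *) (simp only: mult_ac)
  also have "\<dots> = E * - (b / R)" using R integral_normal_moment_nz_1[of "1 / sqrt R" "- (b / R)"] by simp
  finally show ?goal2
    by (simp add: E_def R_def mult_ac)
qed

lemma gaussian_second_moment_integral:
  fixes a :: real
  assumes a: "0 < 1 + a"
  defines "N \<equiv> std_normal_distribution"
  shows "(LINT x|N. exp (- (a * x\<^sup>2 / 2))) = 1 / sqrt (1 + a)"
    and "(LINT x|N. x\<^sup>2 * exp (- (a * x\<^sup>2 / 2))) = 1 / ((1 + a) * sqrt (1 + a))" (is ?goal1)
proof -
  define R where "R = 1 + a"
  have R: "0 < R" using a by (simp add: R_def)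
  have *: "std_normal_density x * exp (- (a * x\<^sup>2 / 2)) = (1 / sqrt R) * normal_density 0 (1 / sqrt R) x" for x
  proof -
    have "- x\<^sup>2 / 2 + - (a * x\<^sup>2 / 2) = - (x - 0)\<^sup>2 / (2 * (1 / sqrt R)\<^sup>2)"
      using R by (simp add: power_divide field_simps power2_eq_square) (simp add: R_def algebra_simps)
    then have "exp (- x\<^sup>2 / 2) * exp (- (a * x\<^sup>2 / 2)) = exp (- (x - 0)\<^sup>2 / (2 * (1 / sqrt R)\<^sup>2))"
      by (simp only: exp_add[symmetric])
    then show ?thesis
      using R by (simp add: normal_density_def power_divide real_sqrt_divide real_sqrt_mult)
  qed
  have "(LINT x|N. exp (- (a * x\<^sup>2 / 2))) = (LBINT x. std_normal_density x * exp (- (a * x\<^sup>2 / 2)))"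
    unfolding N_def by (subst integral_density) auto
  also have "\<dots> = 1 / sqrt R" using R by (simp add: *)
  finally show "(LINT x|N. exp (- (a * x\<^sup>2 / 2))) = 1 / sqrt (1 + a)" by (simp add: R_def)
  have "(LINT x|N. x\<^sup>2 * exp (- (a * x\<^sup>2 / 2))) = (LBINT x. x\<^sup>2 * (std_normal_density x * exp (- (a * x\<^sup>2 / 2))))"
    unfolding N_def by (subst integral_density) (auto simp: mult_ac)
  also have "\<dots> = (LBINT x. (1 / sqrt R) * (normal_density 0 (1 / sqrt R) x * (x - 0)^2))"
    by (simp only: *) (simp add: mult_ac)
  also have "\<dots> = (1 / sqrt R) * (1 / R)" using R integral_normal_moment_even[of "1 / sqrt R" 0 1]
    by (simp add: fact_numeral power_divide)
  finally show ?goal1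
    by (simp add: R_def mult.commute)
qed

lemma gaussian_double_integrals:
  fixes \<nu> \<mu> \<rho> :: real
  assumes "0 \<le> \<nu>" "0 \<le> \<rho>" "\<mu>\<^sup>2 \<le> \<nu> * \<rho>"
  defines "N \<equiv> std_normal_distribution" and "D \<equiv> (1 + \<nu>) * (1 + \<rho>) - \<mu>\<^sup>2"
  shows "(LINT \<xi>|N. LINT \<eta>|N. gaussian_char \<nu> \<mu> \<rho> \<xi> \<eta>) = D powr (-(1/2))" (is ?goal1)
    and "(LINT \<xi>|N. LINT \<eta>|N. \<xi> * \<eta> * gaussian_char \<nu> \<mu> \<rho> \<xi> \<eta>) = - \<mu> * D powr (-(3/2))" (is ?goal2)
proof -
  \<comment> \<open>The Schur complement left in \<open>\<xi>\<close> after \<open>\<eta>\<close> is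
    integrated out; hence \<open>(1 + \<rho>) * (1 + a)\<close> is the full determinant.\<close>
  define a where "a = \<nu> - \<mu>\<^sup>2 / (1 + \<rho>)"
  have D: "0 < D" using assms(1-3) by (simp add: D_def algebra_simps)
  have aD: "(1 + \<rho>) * (1 + a) = D" using assms(2) by (simp add: a_def D_def field_simps)
  then have a: "0 < 1 + a" using D assms(2) by (metis add_pos_nonneg zero_less_mult_pos zero_less_one)
  have sq: "sqrt (1 + \<rho>) * sqrt (1 + a) = sqrt D" using aD by (simp add: real_sqrt_mult[symmetric])
  have split: "gaussian_char \<nu> \<mu> \<rho> \<xi> \<eta> = exp (- (\<nu> * \<xi>\<^sup>2 / 2)) * exp (- ((\<rho> * \<eta>\<^sup>2 + 2 * (\<mu> * \<xi>) * \<eta>) / 2))" for \<xi> \<eta>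
    by (simp add: exp_add[symmetric] field_simps)
  have comb: "exp (- (\<nu> * \<xi>\<^sup>2 / 2)) * exp ((\<mu> * \<xi>)\<^sup>2 / (2 * (1 + \<rho>))) = exp (- (a * \<xi>\<^sup>2 / 2))" for \<xi>
    using assms(2) by (simp add: exp_add[symmetric] a_def field_simps)
  have "(LINT \<xi>|N. LINT \<eta>|N. gaussian_char \<nu> \<mu> \<rho> \<xi> \<eta>)
     = (LINT \<xi>|N. (exp (- (\<nu> * \<xi>\<^sup>2 / 2)) * exp ((\<mu> * \<xi>)\<^sup>2 / (2 * (1 + \<rho>)))) / sqrt (1 + \<rho>))"
    unfolding split using gaussian_quadratic_integrals(1)[OF assms(2)] by (simp add: N_def)
  also have "\<dots> = 1 / sqrt (1 + a) / sqrt (1 + \<rho>)"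
    unfolding comb using gaussian_second_moment_integral(1)[OF a] by (simp add: N_def)
  also have "\<dots> = D powr (-(1/2))"
    using D sq by (simp add: powr_minus_divide powr_half_sqrt mult.commute)
  finally show ?goal1 .
  have "(LINT \<xi>|N. LINT \<eta>|N. \<xi> * \<eta> * gaussian_char \<nu> \<mu> \<rho> \<xi> \<eta>)
     = (LINT \<xi>|N. LINT \<eta>|N. (\<xi> * exp (- (\<nu> * \<xi>\<^sup>2 / 2))) * (\<eta> * exp (- ((\<rho> * \<eta>\<^sup>2 + 2 * (\<mu> * \<xi>) * \<eta>) / 2))))"
    unfolding split by (simp only: mult_ac)
  also have "\<dots> = (LINT \<xi>|N. - (\<mu> / ((1 + \<rho>) * sqrt (1 + \<rho>))) * (\<xi>\<^sup>2 * (exp (- (\<nu> * \<xi>\<^sup>2 / 2)) * exp ((\<mu> * \<xi>)\<^sup>2 / (2 * (1 + \<rho>))))))"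
  proof (rule Bochner_Integration.integral_cong[OF refl])
    fix \<xi>
    have "(LINT \<eta>|N. (\<xi> * exp (- (\<nu> * \<xi>\<^sup>2 / 2))) * (\<eta> * exp (- ((\<rho> * \<eta>\<^sup>2 + 2 * (\<mu> * \<xi>) * \<eta>) / 2))))
       = (\<xi> * exp (- (\<nu> * \<xi>\<^sup>2 / 2))) * (- (\<mu> * \<xi> / (1 + \<rho>)) * exp ((\<mu> * \<xi>)\<^sup>2 / (2 * (1 + \<rho>))) / sqrt (1 + \<rho>))"
      unfolding N_def integral_mult_right_zero gaussian_quadratic_integrals(2)[OF assms(2)] ..
    also have "\<dots> = - (\<mu> / ((1 + \<rho>) * sqrt (1 + \<rho>))) * (\<xi>\<^sup>2 * (exp (- (\<nu> * \<xi>\<^sup>2 / 2)) * exp ((\<mu> * \<xi>)\<^sup>2 / (2 * (1 + \<rho>)))))"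
      by (simp only: power2_eq_square) simp
    finally show "(LINT \<eta>|N. (\<xi> * exp (- (\<nu> * \<xi>\<^sup>2 / 2))) * (\<eta> * exp (- ((\<rho> * \<eta>\<^sup>2 + 2 * (\<mu> * \<xi>) * \<eta>) / 2))))
       = - (\<mu> / ((1 + \<rho>) * sqrt (1 + \<rho>))) * (\<xi>\<^sup>2 * (exp (- (\<nu> * \<xi>\<^sup>2 / 2)) * exp ((\<mu> * \<xi>)\<^sup>2 / (2 * (1 + \<rho>)))))" .
  qed
  also have "\<dots> = - (\<mu> / ((1 + \<rho>) * sqrt (1 + \<rho>))) * (1 / ((1 + a) * sqrt (1 + a)))"
    unfolding comb using gaussian_second_moment_integral(2)[OF a] by (simp add: N_def)
  also have "\<dots> = - \<mu> * (1 / (((1 + \<rho>) * (1 + a)) * (sqrt (1 + \<rho>) * sqrt (1 + a))))"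
    by simp
  also have "\<dots> = - \<mu> * (1 / (D powr 1 * D powr (1/2)))"
    unfolding sq aD using D by (simp add: powr_half_sqrt)
  also have "\<dots> = - \<mu> * D powr (-(3/2))"
    unfolding powr_add[symmetric] by (simp add: powr_minus_divide)
  finally show ?goal2 .
qed

lemma (in prob_space) jointly_gaussian_expectations:
  assumes G: "jointly_gaussian M X Y \<nu> \<mu> \<rho>"
    and c: "0 \<le> \<nu>" "0 \<le> \<rho>" "\<mu>\<^sup>2 \<le> \<nu> * \<rho>"
  defines "D \<equiv> (1 + \<nu>) * (1 + \<rho>) - \<mu>\<^sup>2"
  shows "expectation (\<lambda>\<omega>. bell (X \<omega>) * bell (Y \<omega>)) = D powr (-(1/2))" (is ?goal1)
    and "expectation (\<lambda>\<omega>. (X \<omega> * bell (X \<omega>)) * (Y \<omega> * bell (Y \<omega>))) = \<mu> * D powr (-(3/2))" (is ?goal2)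
proof -
  interpret N: real_distribution std_normal_distribution by (rule real_dist_normal_dist)
  have F0: "(CLINT \<xi>|std_normal_distribution. 1 *\<^sub>R iexp (y * \<xi>)) = complex_of_real (exp (- y\<^sup>2 / 2))" for y
    using fun_cong[OF char_std_normal_distribution, of y] by (simp add: char_def)
  have h1: "integrable std_normal_distribution (\<lambda>x. x)"
    using integrable_std_normal_moment[of 1] by (subst integrable_density) auto
  have "complex_of_real (expectation (\<lambda>\<omega>. bell (X \<omega>) * bell (Y \<omega>)))
     = (CLINT \<omega>|M. complex_of_real (bell (X \<omega>)) * complex_of_real (bell (Y \<omega>)))"
    by (simp add: integral_complex_of_real[symmetric] del: integral_complex_of_real)
  also have "\<dots> = complex_of_real (D powr (-(1/2)))"
    unfolding F0[symmetric] using jointly_gaussian_Fourier[OF G, of "\<lambda>_. 1"] gaussian_double_integrals(1)[OF c]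
    by (simp add: D_def)
  finally show ?goal1
    by (simp only: of_real_eq_iff)
  \<comment> \<open>The minus sign is \<open>\<i> * \<i>\<close> from the two first Fourier moments;
    it cancels the sign in the double integral.\<close>
  have "- complex_of_real (expectation (\<lambda>\<omega>. (X \<omega> * bell (X \<omega>)) * (Y \<omega> * bell (Y \<omega>))))
     = (CLINT \<omega>|M. (\<i> * complex_of_real (X \<omega> * bell (X \<omega>))) * (\<i> * complex_of_real (Y \<omega> * bell (Y \<omega>))))"
    unfolding integral_complex_of_real[symmetric] integral_minus[symmetric]
    by (intro Bochner_Integration.integral_cong refl) (simp add: algebra_simps)
  also have "\<dots> = complex_of_real (- \<mu> * D powr (-(3/2)))"
    unfolding std_normal_first_Fourier_moment[symmetric] D_def gaussian_double_integrals(2)[OF c, symmetric]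
    by (rule jointly_gaussian_Fourier[OF G h1])
  finally have "complex_of_real (expectation (\<lambda>\<omega>. (X \<omega> * bell (X \<omega>)) * (Y \<omega> * bell (Y \<omega>)))) = complex_of_real (\<mu> * D powr (-(3/2)))"
    by (simp add: minus_equation_iff[of "complex_of_real _"])
  then show ?goal2
    by (simp only: of_real_eq_iff)
qed

lemma jointly_gaussian_scale:
  assumes "jointly_gaussian M X Y \<nu> \<mu> \<rho>"
  shows "jointly_gaussian M (\<lambda>\<omega>. a * X \<omega>) (\<lambda>\<omega>. b * Y \<omega>) (a\<^sup>2 * \<nu>) (a * b * \<mu>) (b\<^sup>2 * \<rho>)"
  unfolding jointly_gaussian_def
proof (intro conjI allI)
  show "(\<lambda>\<omega>. a * X \<omega>) \<in> borel_measurable M" "(\<lambda>\<omega>. b * Y \<omega>) \<in> borel_measurable M"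
    using assms by (auto simp: jointly_gaussian_def)
  fix \<xi> \<eta>
  have "(CLINT \<omega>|M. iexp ((\<xi> * a) * X \<omega> + (\<eta> * b) * Y \<omega>)) =
        complex_of_real (exp (- ((\<nu> * (\<xi> * a)\<^sup>2 + 2 * \<mu> * (\<xi> * a) * (\<eta> * b) + \<rho> * (\<eta> * b)\<^sup>2) / 2)))"
    using assms by (simp add: jointly_gaussian_def del: of_real_add of_real_mult)
  then show "(CLINT \<omega>|M. iexp (\<xi> * (a * X \<omega>) + \<eta> * (b * Y \<omega>))) =
        complex_of_real (exp (- ((a\<^sup>2 * \<nu> * \<xi>\<^sup>2 + 2 * (a * b * \<mu>) * \<xi> * \<eta> + b\<^sup>2 * \<rho> * \<eta>\<^sup>2) / 2)))"
    by (simp only: power_mult_distrib mult_ac)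
qed

lemma abs_mult_exp_neg_square_le: "\<bar>x * exp (- x\<^sup>2 / 2)\<bar> \<le> (1::real)"
proof -
  have "\<bar>x\<bar> \<le> 1 + x\<^sup>2 / 2"
    using zero_le_power2[of "\<bar>x\<bar> - 1"] by (simp add: power2_diff)
  also have "\<dots> \<le> exp (x\<^sup>2 / 2)" by (rule exp_ge_add_one_self)
  finally show ?thesis by (simp add: abs_mult exp_minus field_simps)
qed

text \<open>Obtained from the previous formulas with \<open>Y\<close> scaled by \<open>b n\<close>, dividing by \<open>b n\<close> and letting \<open>b n\<close> tend to 0.\<close>

lemma (in prob_space) jointly_gaussian_linear_expectation:
  assumes G: "jointly_gaussian M X Y \<nu> \<mu> \<rho>"
    and c: "0 \<le> \<nu>" "0 \<le> \<rho>" "\<mu>\<^sup>2 \<le> \<nu> * \<rho>" and Y: "integrable M Y"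
  shows "expectation (\<lambda>\<omega>. (X \<omega> * bell (X \<omega>)) * Y \<omega>) = \<mu> * (1 + \<nu>) powr (-(3/2))"
proof -
  have [measurable]: "X \<in> borel_measurable M" "Y \<in> borel_measurable M"
    using G by (auto simp: jointly_gaussian_def)
  define b where "b = (\<lambda>n. inverse (real (Suc n)))"
  have b: "b \<longlonglongrightarrow> 0" "0 < b n" for n
    unfolding b_def by (rule LIMSEQ_inverse_real_of_nat) simp
  define g where "g = (\<lambda>n \<omega>. (X \<omega> * bell (X \<omega>)) * (Y \<omega> * bell (b n * Y \<omega>)))"
  have "(\<lambda>n. expectation (g n)) \<longlonglongrightarrow> expectation (\<lambda>\<omega>. (X \<omega> * bell (X \<omega>)) * Y \<omega>)"
  proof (rule integral_dominated_convergence[where w="\<lambda>\<omega>. norm (Y \<omega>)"])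
    show "AE \<omega> in M. (\<lambda>n. g n \<omega>) \<longlonglongrightarrow> (X \<omega> * bell (X \<omega>)) * Y \<omega>"
    proof (intro AE_I2)
      fix \<omega>
      have "(\<lambda>n. g n \<omega>) \<longlonglongrightarrow> (X \<omega> * bell (X \<omega>)) * (Y \<omega> * exp (- (0 * Y \<omega>)\<^sup>2 / 2))"
        unfolding g_def by (intro tendsto_intros b) auto
      then show "(\<lambda>n. g n \<omega>) \<longlonglongrightarrow> (X \<omega> * bell (X \<omega>)) * Y \<omega>" by simp
    qed
    show "AE \<omega> in M. norm (g n \<omega>) \<le> norm (Y \<omega>)" for n
    proof (intro AE_I2)
      fix \<omega>
      have "norm (g n \<omega>) \<le> 1 * (\<bar>Y \<omega>\<bar> * 1)"
        unfolding g_def real_norm_def abs_mult[of "X \<omega> * _"] abs_mult[of "Y \<omega>"]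
        by (intro mult_mono abs_mult_exp_neg_square_le) auto
      then show "norm (g n \<omega>) \<le> norm (Y \<omega>)" by simp
    qed
    show "g n \<in> borel_measurable M" for n unfolding g_def by measurable
  qed (use Y in auto)
  moreover have "expectation (g n) = \<mu> * ((1 + \<nu>) * (1 + (b n)\<^sup>2 * \<rho>) - (b n * \<mu>)\<^sup>2) powr (-(3/2))" for n
  proof -
    have "jointly_gaussian M (\<lambda>\<omega>. 1 * X \<omega>) (\<lambda>\<omega>. b n * Y \<omega>) (1\<^sup>2 * \<nu>) (1 * b n * \<mu>) ((b n)\<^sup>2 * \<rho>)"
      by (rule jointly_gaussian_scale[OF G])
    then have J: "jointly_gaussian M X (\<lambda>\<omega>. b n * Y \<omega>) \<nu> (b n * \<mu>) ((b n)\<^sup>2 * \<rho>)" by simp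
    have "(b n * \<mu>)\<^sup>2 \<le> \<nu> * ((b n)\<^sup>2 * \<rho>)"
      using mult_left_mono[OF c(3), of "(b n)\<^sup>2"] by (simp add: power_mult_distrib mult_ac)
    then have "expectation (\<lambda>\<omega>. (X \<omega> * bell (X \<omega>)) * (b n * Y \<omega> * bell (b n * Y \<omega>)))
       = (b n * \<mu>) * ((1 + \<nu>) * (1 + (b n)\<^sup>2 * \<rho>) - (b n * \<mu>)\<^sup>2) powr (-(3/2))"
      using c by (intro jointly_gaussian_expectations(2)[OF J]) auto
    moreover have "expectation (\<lambda>\<omega>. (X \<omega> * bell (X \<omega>)) * (b n * Y \<omega> * bell (b n * Y \<omega>))) = b n * expectation (g n)"
      unfolding g_def integral_mult_right_zero[symmetric] by (simp only: mult_ac)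
    ultimately show ?thesis using b(2)[of n] by simp
  qed
  moreover have "(\<lambda>n. \<mu> * ((1 + \<nu>) * (1 + (b n)\<^sup>2 * \<rho>) - (b n * \<mu>)\<^sup>2) powr (-(3/2))) \<longlonglongrightarrow> \<mu> * ((1 + \<nu>) * (1 + 0\<^sup>2 * \<rho>) - (0 * \<mu>)\<^sup>2) powr (-(3/2))"
    using c by (intro tendsto_intros b) auto
  ultimately show ?thesis by (simp add: LIMSEQ_unique)
qed

text \<open>A characteristic function has modulus at most 1, so the quadratic form in the exponent
  is nonnegative; evaluating it at suitable points gives the three inequalities.\<close>

lemma (in prob_space) jointly_gaussian_Cauchy_Schwarz:
  assumes G: "jointly_gaussian M X Y \<nu> \<mu> \<rho>"
  shows "\<mu>\<^sup>2 \<le> \<nu> * \<rho>" "0 \<le> \<nu>" "0 \<le> \<rho>"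
proof -
  have form: "0 \<le> \<nu> * \<xi>\<^sup>2 + 2 * \<mu> * \<xi> * \<eta> + \<rho> * \<eta>\<^sup>2" for \<xi> \<eta>
  proof -
    have "gaussian_char \<nu> \<mu> \<rho> \<xi> \<eta> = cmod (CLINT \<omega>|M. iexp (\<xi> * X \<omega> + \<eta> * Y \<omega>))"
      using G by (simp add: jointly_gaussian_def del: of_real_exp)
    also have "\<dots> \<le> (LINT \<omega>|M. cmod (iexp (\<xi> * X \<omega> + \<eta> * Y \<omega>)))" by (rule integral_norm_bound)
    also have "\<dots> = 1" by (simp add: prob_space del: of_real_add of_real_mult)
    finally show ?thesis by simp
  qed
  show \<nu>: "0 \<le> \<nu>" and \<rho>: "0 \<le> \<rho>" using form[of 1 0] form[of 0 1] by auto
  show "\<mu>\<^sup>2 \<le> \<nu> * \<rho>"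
  proof (cases "\<rho> = 0")
    case True
    have "\<mu> = 0"
    proof (rule ccontr)
      assume "\<mu> \<noteq> 0"
      \<comment> \<open>For \<open>\<rho> = 0\<close> the form is linear in \<open>\<eta>\<close>;
        at this point it equals \<open>- \<nu> - 2\<close>.\<close>
      then show False using form[of 1 "- (\<nu> + 1) / \<mu>"] True \<nu> by simp
    qed
    then show ?thesis using True by simp
  next
    case False
    have "0 \<le> \<rho> * (\<nu> * \<rho> - \<mu>\<^sup>2)" using form[of \<rho> "-\<mu>"] by (simp add: algebra_simps power2_eq_square)
    then show ?thesis using False \<rho> by (simp add: zero_le_mult_iff)
  qed
qed

section \<open>Moments of the gradient of the heat kernel\<close>

text \<open>The product form over rescaled coordinates reduces moments to one coordinate at a time.
  The power is \<open>-2\<close> because \<open>-3/2\<close> from the kernel and \<open>-1\<close>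
  from the derivative are offset by \<open>1/2\<close> from rescaling \<open>x $ 1\<close>.\<close>

lemma partial_deriv_heat_kernel:
  fixes x :: "real ^ 3"
  assumes "0 < \<epsilon>"
  defines "y \<equiv> \<lambda>j. x $ j / sqrt \<epsilon>"
  shows "partial_deriv 1 (heat_kernel \<epsilon>) x =
    - ((2 * pi) powr (-(3/2)) * \<epsilon> powr (-2)) *
      (y 1 * bell (y 1) * (bell (y 2) * bell (y 3)))"
proof -
  have n: "(norm (x + h *\<^sub>R axis 1 1))\<^sup>2 = (x $ 1 + h)\<^sup>2 + (x $ 2)\<^sup>2 + (x $ 3)\<^sup>2" for h
    by (simp add: norm_vec_def L2_set_def sum_3 axis_def)
  have "((\<lambda>h. heat_kernel \<epsilon> (x + h *\<^sub>R axis 1 1)) has_real_derivative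
      (2 * pi * \<epsilon>) powr (-(3/2)) * (exp (- ((x $ 1)\<^sup>2 + (x $ 2)\<^sup>2 + (x $ 3)\<^sup>2) / (2 * \<epsilon>)) * (- (x $ 1 / \<epsilon>)))) (at 0)"
    unfolding heat_kernel_def n using assms(1) by (auto intro!: derivative_eq_intros simp: field_simps)
  then have "partial_deriv 1 (heat_kernel \<epsilon>) x =
     (2 * pi * \<epsilon>) powr (-(3/2)) * (exp (- ((x $ 1)\<^sup>2 + (x $ 2)\<^sup>2 + (x $ 3)\<^sup>2) / (2 * \<epsilon>)) * (- (x $ 1 / \<epsilon>)))"
    unfolding partial_deriv_def by (rule DERIV_imp_deriv)
  also have "exp (- ((x $ 1)\<^sup>2 + (x $ 2)\<^sup>2 + (x $ 3)\<^sup>2) / (2 * \<epsilon>)) = bell (y 1) * (bell (y 2) * bell (y 3))"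
    using assms(1) by (simp add: exp_add[symmetric] y_def power_divide add_divide_distrib diff_divide_distrib)
  also have "(2 * pi * \<epsilon>) powr (-(3/2)) * (bell (y 1) * (bell (y 2) * bell (y 3)) * (- (x $ 1 / \<epsilon>)))
    = - ((2 * pi) powr (-(3/2)) * (\<epsilon> powr (-(3/2)) * (sqrt \<epsilon> / \<epsilon>))) *
      (y 1 * bell (y 1) * (bell (y 2) * bell (y 3)))"
    using assms(1) by (simp add: y_def powr_mult)
  also have "sqrt \<epsilon> / \<epsilon> = \<epsilon> powr (1/2 - 1)"
    unfolding powr_diff using assms(1) by (simp add: powr_half_sqrt)
  also have "\<epsilon> powr (-(3/2)) * \<epsilon> powr (1/2 - 1) = \<epsilon> powr (-2)"
    by (simp add: powr_add[symmetric])
  finally show ?thesis .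
qed

section \<open>Gaussian structure of the increments\<close>

locale fbm3 = prob_space M for M :: "'a measure" +
  fixes B :: "real \<Rightarrow> 'a \<Rightarrow> real ^ 3" and H p :: real
  assumes fbm: "fractional_brownian_motion M H B"
    and H_gt: "1 / 2 < H" and H_less: "H < 2 / 3"
  defines "p \<equiv> 2 * H"
begin

lemma measurable_B: "0 \<le> t \<Longrightarrow> B t \<in> borel_measurable M"
  using fbm by (auto simp: fractional_brownian_motion_def centered_gaussian_process_def)

lemma measurable_B_nth: "0 \<le> t \<Longrightarrow> (\<lambda>\<omega>. B t \<omega> $ j) \<in> borel_measurable M"
  unfolding cart_eq_inner_axis by (intro borel_measurable_inner measurable_B borel_measurable_const)

text \<open>The process definition provides only some variance; identifying it with the second
  moment ties it to the prescribed covariance.\<close>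

lemma gaussian_combination:
  assumes "finite T" "T \<subseteq> {0..}"
  obtains v where "0 \<le> v" "distr M borel (\<lambda>\<omega>. \<Sum>t\<in>T. c t \<bullet> B t \<omega>) = gaussian_law 0 v"
    "integrable M (\<lambda>\<omega>. (\<Sum>t\<in>T. c t \<bullet> B t \<omega>)\<^sup>2)" "v = expectation (\<lambda>\<omega>. (\<Sum>t\<in>T. c t \<bullet> B t \<omega>)\<^sup>2)"
proof -
  obtain v where v: "0 \<le> v" "distr M borel (\<lambda>\<omega>. \<Sum>t\<in>T. c t \<bullet> B t \<omega>) = gaussian_law 0 v"
    using fbm assms unfolding fractional_brownian_motion_def centered_gaussian_process_def by blast
  have m: "(\<lambda>\<omega>. \<Sum>t\<in>T. c t \<bullet> B t \<omega>) \<in> borel_measurable M"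
    using assms by (intro borel_measurable_sum borel_measurable_inner measurable_B) auto
  show thesis
  proof (rule that[OF v])
    show "integrable M (\<lambda>\<omega>. (\<Sum>t\<in>T. c t \<bullet> B t \<omega>)\<^sup>2)"
      using gaussian_law_second_moment(1)[OF v(1)] unfolding v(2)[symmetric] by (rule integrable_distr[OF m])
    show "v = expectation (\<lambda>\<omega>. (\<Sum>t\<in>T. c t \<bullet> B t \<omega>)\<^sup>2)"
      using gaussian_law_second_moment(2)[OF v(1)] unfolding v(2)[symmetric] by (subst (asm) integral_distr[OF m]) auto
  qed
qed

lemma square_integrable_B: "0 \<le> t \<Longrightarrow> integrable M (\<lambda>\<omega>. (B t \<omega> $ j)\<^sup>2)"
  by (rule gaussian_combination[of "{t}" "\<lambda>_. axis j 1"]) (auto simp: inner_axis inner_commute[of "axis j 1"])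

lemma integrable_B_mult:
  assumes "0 \<le> s" "0 \<le> t"
  shows "integrable M (\<lambda>\<omega>. B s \<omega> $ j * B t \<omega> $ j)"
proof (rule Bochner_Integration.integrable_bound)
  show "integrable M (\<lambda>\<omega>. (B s \<omega> $ j)\<^sup>2 + (B t \<omega> $ j)\<^sup>2)"
    using assms by (intro Bochner_Integration.integrable_add square_integrable_B)
  show "(\<lambda>\<omega>. B s \<omega> $ j * B t \<omega> $ j) \<in> borel_measurable M"
    using assms by (intro borel_measurable_times measurable_B_nth)
  show "AE \<omega> in M. norm (B s \<omega> $ j * B t \<omega> $ j) \<le> norm ((B s \<omega> $ j)\<^sup>2 + (B t \<omega> $ j)\<^sup>2)"
  proof (intro AE_I2)
    fix \<omega>
    have "2 * (\<bar>B s \<omega> $ j\<bar> * \<bar>B t \<omega> $ j\<bar>) \<le> (B s \<omega> $ j)\<^sup>2 + (B t \<omega> $ j)\<^sup>2"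
      using sum_squares_bound[of "\<bar>B s \<omega> $ j\<bar>" "\<bar>B t \<omega> $ j\<bar>"] by simp
    then show "norm (B s \<omega> $ j * B t \<omega> $ j) \<le> norm ((B s \<omega> $ j)\<^sup>2 + (B t \<omega> $ j)\<^sup>2)"
      using mult_nonneg_nonneg[OF abs_ge_zero[of "B s \<omega> $ j"] abs_ge_zero[of "B t \<omega> $ j"]]
      unfolding real_norm_def abs_mult by linarith
  qed
qed

lemma integrable_B: "0 \<le> t \<Longrightarrow> integrable M (\<lambda>\<omega>. B t \<omega> $ j)"
  by (rule square_integrable_imp_integrable) (auto intro: measurable_B_nth square_integrable_B)

lemma increment_covariance:
  assumes "0 \<le> r" "0 \<le> s" "0 \<le> r'" "0 \<le> s'"
  shows "integrable M (\<lambda>\<omega>. (B s \<omega> $ j - B r \<omega> $ j) * (B s' \<omega> $ j - B r' \<omega> $ j))" (is ?goal1)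
    "expectation (\<lambda>\<omega>. (B s \<omega> $ j - B r \<omega> $ j) * (B s' \<omega> $ j - B r' \<omega> $ j)) = fbm_incr_cov p r s r' s'" (is ?goal2)
proof -
  have c: "expectation (\<lambda>\<omega>. B t \<omega> $ j * B s \<omega> $ j) = (t powr p + s powr p - \<bar>t - s\<bar> powr p) / 2" if "0 \<le> s" "0 \<le> t" for s t
    using fbm that by (simp add: fractional_brownian_motion_def p_def)
  have eq: "(B s \<omega> $ j - B r \<omega> $ j) * (B s' \<omega> $ j - B r' \<omega> $ j) =
     B s \<omega> $ j * B s' \<omega> $ j - B s \<omega> $ j * B r' \<omega> $ j - B r \<omega> $ j * B s' \<omega> $ j + B r \<omega> $ j * B r' \<omega> $ j" for \<omega>
    by (simp add: algebra_simps)
  note i = integrable_B_mult[of _ _ j]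
  show ?goal1
    unfolding eq using assms by (intro Bochner_Integration.integrable_add Bochner_Integration.integrable_diff i)
  show ?goal2
    unfolding eq using assms by (simp add: i c fbm_incr_cov_def abs_minus_commute[of r' s] field_simps)
qed

lemma jointly_gaussian_increments:
  assumes "0 \<le> r" "0 \<le> s" "0 \<le> r'" "0 \<le> s'"
  shows "jointly_gaussian M (\<lambda>\<omega>. B s \<omega> $ j - B r \<omega> $ j) (\<lambda>\<omega>. B s' \<omega> $ j - B r' \<omega> $ j)
     (\<bar>s - r\<bar> powr p) (fbm_incr_cov p r s r' s') (\<bar>s' - r'\<bar> powr p)"
  unfolding jointly_gaussian_def
proof (intro conjI allI)
  let ?X = "\<lambda>\<omega>. B s \<omega> $ j - B r \<omega> $ j" and ?Y = "\<lambda>\<omega>. B s' \<omega> $ j - B r' \<omega> $ j"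
  show m: "?X \<in> borel_measurable M" "?Y \<in> borel_measurable M"
    using assms by (auto intro!: borel_measurable_diff measurable_B_nth)
  fix \<xi> \<eta>
  define T where "T = {r, s, r', s'}"
  \<comment> \<open>The four times may coincide. Adding indicators lets their coefficients
    accumulate on the set \<open>T\<close> without a case distinction.\<close>
  define c :: "real \<Rightarrow> real ^ 3" where "c = (\<lambda>\<tau>. (\<xi> * (of_bool (\<tau> = s) - of_bool (\<tau> = r)) + \<eta> * (of_bool (\<tau> = s') - of_bool (\<tau> = r'))) *\<^sub>R axis j 1)"
  have pick: "(\<Sum>\<tau>\<in>T. of_bool (\<tau> = x) * f \<tau>) = f x" if "x \<in> T" for x and f :: "real \<Rightarrow> real"
    using sum.delta[of T x f] that by (simp add: T_def of_bool_def if_distrib[of "\<lambda>u. u * _"] cong: if_cong)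
  have mem: "s \<in> T" "r \<in> T" "s' \<in> T" "r' \<in> T" by (auto simp: T_def)
  have comb: "(\<Sum>\<tau>\<in>T. c \<tau> \<bullet> B \<tau> \<omega>) = \<xi> * ?X \<omega> + \<eta> * ?Y \<omega>" for \<omega>
  proof -
    have "(\<Sum>\<tau>\<in>T. c \<tau> \<bullet> B \<tau> \<omega>) = (\<Sum>\<tau>\<in>T. \<xi> * (of_bool (\<tau> = s) * B \<tau> \<omega> $ j) - \<xi> * (of_bool (\<tau> = r) * B \<tau> \<omega> $ j)
         + \<eta> * (of_bool (\<tau> = s') * B \<tau> \<omega> $ j) - \<eta> * (of_bool (\<tau> = r') * B \<tau> \<omega> $ j))"
      by (intro sum.cong refl) (simp add: c_def inner_axis inner_commute[of "axis j 1"] algebra_simps)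
    also have "\<dots> = \<xi> * B s \<omega> $ j - \<xi> * B r \<omega> $ j + \<eta> * B s' \<omega> $ j - \<eta> * B r' \<omega> $ j"
      by (simp only: sum.distrib sum_subtractf sum_distrib_left[symmetric] pick[OF mem(1)] pick[OF mem(2)] pick[OF mem(3)] pick[OF mem(4)])
    finally show ?thesis by (simp add: algebra_simps)
  qed
  obtain v where v: "0 \<le> v" "distr M borel (\<lambda>\<omega>. \<xi> * ?X \<omega> + \<eta> * ?Y \<omega>) = gaussian_law 0 v"
    "v = expectation (\<lambda>\<omega>. (\<xi> * ?X \<omega> + \<eta> * ?Y \<omega>)\<^sup>2)"
    using gaussian_combination[of T c] assms unfolding comb by (auto simp: T_def)
  have eq: "(\<xi> * x + \<eta> * y)\<^sup>2 = \<xi>\<^sup>2 * (x * x) + 2 * \<xi> * \<eta> * (x * y) + \<eta>\<^sup>2 * (y * y)" for x y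
    by (simp add: power2_eq_square algebra_simps)
  have "v = \<xi>\<^sup>2 * fbm_incr_cov p r s r s + 2 * \<xi> * \<eta> * fbm_incr_cov p r s r' s' + \<eta>\<^sup>2 * fbm_incr_cov p r' s' r' s'"
    unfolding v(3) eq using assms by (simp add: increment_covariance)
  then have veq: "v = \<bar>s - r\<bar> powr p * \<xi>\<^sup>2 + 2 * fbm_incr_cov p r s r' s' * \<xi> * \<eta> + \<bar>s' - r'\<bar> powr p * \<eta>\<^sup>2"
    by (simp add: fbm_incr_cov_def abs_minus_commute)
  have "(CLINT \<omega>|M. iexp (\<xi> * ?X \<omega> + \<eta> * ?Y \<omega>)) = char (distr M borel (\<lambda>\<omega>. \<xi> * ?X \<omega> + \<eta> * ?Y \<omega>)) 1"
    unfolding char_def using m by (subst integral_distr) auto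
  also have "\<dots> = complex_of_real (exp (- (v / 2)))"
    unfolding v(2) by (simp add: char_gaussian_law[OF v(1)])
  finally show "(CLINT \<omega>|M. iexp (\<xi> * ?X \<omega> + \<eta> * ?Y \<omega>)) =
     complex_of_real (exp (- ((\<bar>s - r\<bar> powr p * \<xi>\<^sup>2 + 2 * fbm_incr_cov p r s r' s' * \<xi> * \<eta> + \<bar>s' - r'\<bar> powr p * \<eta>\<^sup>2) / 2)))"
    unfolding veq .
qed

text \<open>Independence is assumed for whole coordinate paths, so evaluation at four times followed
  by a measurable function preserves it.\<close>

lemma expectation_coordinate_product:
  fixes f :: "3 \<Rightarrow> real \<Rightarrow> real \<Rightarrow> real"
  assumes "0 \<le> r" "0 \<le> s" "0 \<le> r'" "0 \<le> s'"
    and f: "\<And>j. (\<lambda>(x, y). f j x y) \<in> borel_measurable (borel \<Otimes>\<^sub>M borel)"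
    and i: "\<And>j. integrable M (\<lambda>\<omega>. f j (B s \<omega> $ j - B r \<omega> $ j) (B s' \<omega> $ j - B r' \<omega> $ j))"
  shows "integrable M (\<lambda>\<omega>. \<Prod>j\<in>UNIV. f j (B s \<omega> $ j - B r \<omega> $ j) (B s' \<omega> $ j - B r' \<omega> $ j))" (is ?goal1)
    "expectation (\<lambda>\<omega>. \<Prod>j\<in>UNIV. f j (B s \<omega> $ j - B r \<omega> $ j) (B s' \<omega> $ j - B r' \<omega> $ j)) =
     (\<Prod>j\<in>UNIV. expectation (\<lambda>\<omega>. f j (B s \<omega> $ j - B r \<omega> $ j) (B s' \<omega> $ j - B r' \<omega> $ j)))" (is ?goal2)
proof -
  have "indep_vars (\<lambda>_. PiM {0..} (\<lambda>_. borel)) (\<lambda>j \<omega>. \<lambda>t\<in>{0..}. B t \<omega> $ j) UNIV"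
    using fbm by (simp add: fractional_brownian_motion_def)
  then have "indep_vars (\<lambda>_. borel) (\<lambda>j \<omega>. (\<lambda>x. f j (x s - x r) (x s' - x r')) (\<lambda>t\<in>{0..}. B t \<omega> $ j)) UNIV"
  proof (rule indep_vars_compose2)
    fix j
    have [measurable]: "(\<lambda>x. x t) \<in> borel_measurable (PiM {0..} (\<lambda>_. borel))" if "0 \<le> t" for t :: real
      using that by (intro measurable_component_singleton) simp
    show "(\<lambda>x. f j (x s - x r) (x s' - x r')) \<in> borel_measurable (PiM {0..} (\<lambda>_. borel))"
      using measurable_compose[OF _ f[of j], of "\<lambda>x. (x s - x r, x s' - x r')"] assms(1-4) by simp
  qed
  then have I: "indep_vars (\<lambda>_. borel) (\<lambda>j \<omega>. f j (B s \<omega> $ j - B r \<omega> $ j) (B s' \<omega> $ j - B r' \<omega> $ j)) UNIV"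
    using assms(1-4) by simp
  show ?goal1
    by (rule indep_vars_integrable[OF _ I i]) auto
  show ?goal2
    by (rule indep_vars_lebesgue_integral[OF _ I i]) auto
qed

end

text \<open>The formulas at unit scale, applied to variables divided by
  \<open>sqrt \<epsilon>\<close>: the determinant there is \<open>d / \<epsilon>\<^sup>2\<close>,
  which accounts for the powers of \<open>\<epsilon>\<close>.\<close>

lemma (in prob_space) jointly_gaussian_kernel_expectations:
  assumes G: "jointly_gaussian M X Y \<nu> \<mu> \<rho>" and \<epsilon>: "0 < \<epsilon>"
  defines "d \<equiv> (\<epsilon> + \<nu>) * (\<epsilon> + \<rho>) - \<mu>\<^sup>2"
  shows "0 < d"
    and "expectation (\<lambda>\<omega>. bell (X \<omega> / sqrt \<epsilon>) * bell (Y \<omega> / sqrt \<epsilon>)) = \<epsilon> * d powr (-(1/2))" (is ?goal1)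
    and "expectation (\<lambda>\<omega>. (X \<omega> / sqrt \<epsilon> * bell (X \<omega> / sqrt \<epsilon>)) * (Y \<omega> / sqrt \<epsilon> * bell (Y \<omega> / sqrt \<epsilon>)))
       = \<epsilon>\<^sup>2 * \<mu> * d powr (-(3/2))" (is ?goal2)
    and "expectation (\<lambda>\<omega>. bell (X \<omega> / sqrt \<epsilon>)) = sqrt \<epsilon> * (\<epsilon> + \<nu>) powr (-(1/2))" (is ?goal3)
    and "integrable M Y \<Longrightarrow> expectation (\<lambda>\<omega>. (X \<omega> / sqrt \<epsilon> * bell (X \<omega> / sqrt \<epsilon>)) * Y \<omega>) = \<epsilon> * \<mu> * (\<epsilon> + \<nu>) powr (-(3/2))"
proof -
  note CS = jointly_gaussian_Cauchy_Schwarz[OF G]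
  define a where "a = 1 / sqrt \<epsilon>"
  have a: "a\<^sup>2 = 1 / \<epsilon>" using \<epsilon> by (simp add: a_def power_divide)
  have e\<nu>: "(1 + \<nu> / \<epsilon>) powr q = (\<epsilon> + \<nu>) powr q * \<epsilon> powr (-q)" for q
  proof -
    have "1 + \<nu> / \<epsilon> = (\<epsilon> + \<nu>) * \<epsilon> powr (-1)" using \<epsilon> by (simp add: powr_minus_divide field_simps)
    then show ?thesis using \<epsilon> CS by (simp only: powr_mult powr_powr) simp
  qed
  have "0 \<le> \<epsilon> * (\<nu> + \<rho>)" using CS \<epsilon> by simp
  then show d: "0 < d" using CS(1) mult_pos_pos[OF \<epsilon> \<epsilon>] by (simp add: d_def algebra_simps)
  define D where "D = (1 + \<nu> / \<epsilon>) * (1 + \<rho> / \<epsilon>) - (\<mu> / \<epsilon>)\<^sup>2"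
  have "D = d * \<epsilon> powr (-2)"
    using \<epsilon> by (simp add: D_def d_def powr_minus_divide powr_numeral field_simps power2_eq_square)
  then have D: "D powr q = d powr q * \<epsilon> powr (- (2 * q))" for q
    using d by (simp add: powr_mult powr_powr)
  have J: "jointly_gaussian M (\<lambda>\<omega>. X \<omega> / sqrt \<epsilon>) (\<lambda>\<omega>. Y \<omega> / sqrt \<epsilon>) (\<nu> / \<epsilon>) (\<mu> / \<epsilon>) (\<rho> / \<epsilon>)"
    using jointly_gaussian_scale[OF G, of a a] by (simp add: a power2_eq_square[symmetric]) (simp add: a_def)
  show ?goal1
    using jointly_gaussian_expectations(1)[OF J jointly_gaussian_Cauchy_Schwarz(2,3,1)[OF J]] \<epsilon>
    by (simp add: D_def[symmetric] D)
  have "\<epsilon> powr 3 = \<epsilon> ^ 3" using \<epsilon> by (simp add: powr_numeral)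
  then show ?goal2
    unfolding jointly_gaussian_expectations(2)[OF J jointly_gaussian_Cauchy_Schwarz(2,3,1)[OF J]] D_def[symmetric] D
    using \<epsilon> by (simp add: power3_eq_cube power2_eq_square)
  \<comment> \<open>Scaling the second variable by 0 gives the one-variable expectation as a
    degenerate pair.\<close>
  have J0: "jointly_gaussian M (\<lambda>\<omega>. X \<omega> / sqrt \<epsilon>) (\<lambda>\<omega>. 0) (\<nu> / \<epsilon>) 0 0"
    using jointly_gaussian_scale[OF G, of a 0] by (simp add: a) (simp add: a_def)
  show ?goal3
    using jointly_gaussian_expectations(1)[OF J0 jointly_gaussian_Cauchy_Schwarz(2,3,1)[OF J0]] \<epsilon>
    by (simp add: e\<nu> powr_half_sqrt)
  assume Y: "integrable M Y"
  have J1: "jointly_gaussian M (\<lambda>\<omega>. X \<omega> / sqrt \<epsilon>) Y (\<nu> / \<epsilon>) (\<mu> / sqrt \<epsilon>) \<rho>"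
    using jointly_gaussian_scale[OF G, of a 1] by (simp add: a) (simp add: a_def)
  have "\<epsilon> powr (3/2) / sqrt \<epsilon> = \<epsilon> powr (3/2 - 1/2)" unfolding powr_diff using \<epsilon> by (simp add: powr_half_sqrt)
  then have s: "\<epsilon> powr (3/2) / sqrt \<epsilon> = \<epsilon>" using \<epsilon> by simp
  have "expectation (\<lambda>\<omega>. (X \<omega> / sqrt \<epsilon> * bell (X \<omega> / sqrt \<epsilon>)) * Y \<omega>) = \<mu> / sqrt \<epsilon> * (1 + \<nu> / \<epsilon>) powr (-(3/2))"
    by (rule jointly_gaussian_linear_expectation[OF J1 jointly_gaussian_Cauchy_Schwarz(2,3,1)[OF J1] Y])
  also have "\<dots> = (\<epsilon> powr (3/2) / sqrt \<epsilon>) * \<mu> * (\<epsilon> + \<nu>) powr (-(3/2))"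
    unfolding e\<nu> by simp
  finally show "expectation (\<lambda>\<omega>. (X \<omega> / sqrt \<epsilon> * bell (X \<omega> / sqrt \<epsilon>)) * Y \<omega>) = \<epsilon> * \<mu> * (\<epsilon> + \<nu>) powr (-(3/2))"
    unfolding s .
qed

text \<open>The projection has a negative coefficient, so subtracting it appears as a sum. The
  process is a parameter because both \<open>B\<close> and its continuous modification are
  inserted.\<close>

definition chaos_error_of :: "(real \<Rightarrow> 'a \<Rightarrow> real ^ 3) \<Rightarrow> real \<Rightarrow> real \<Rightarrow> real \<Rightarrow> real \<Rightarrow> 'a \<Rightarrow> real" where
  "chaos_error_of X p \<epsilon> r s \<omega> = partial_deriv 1 (heat_kernel \<epsilon>) (X s \<omega> - X r \<omega>) +
     (2 * pi) powr (-(3/2)) * (\<epsilon> + \<bar>s - r\<bar> powr p) powr (-(5/2)) * (X s \<omega> $ 1 - X r \<omega> $ 1)"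

lemma prod_UNIV_3: "(\<Prod>j\<in>UNIV. g j) = g 1 * (g 2 * g 3)" for g :: "3 \<Rightarrow> real"
  unfolding UNIV_3 by simp

section \<open>Covariances of the gradient and of its projection error\<close>

context fbm3
begin

abbreviation gradient :: "real \<Rightarrow> real \<Rightarrow> real \<Rightarrow> 'a \<Rightarrow> real" where
  "gradient \<epsilon> r s \<omega> \<equiv> partial_deriv 1 (heat_kernel \<epsilon>) (B s \<omega> - B r \<omega>)"

text \<open>The first coordinate contributes \<open>d powr (-(3/2))\<close> and each of the others
  \<open>d powr (-(1/2))\<close>, together \<open>-5/2\<close>. The accumulated
  \<open>\<epsilon> ^ 4\<close> cancels the prefactors of the two gradients.\<close>

lemma gradient_product_expectation:
  assumes t: "0 \<le> r" "0 \<le> s" "0 \<le> r'" "0 \<le> s'" and \<epsilon>: "0 < \<epsilon>"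
  shows "integrable M (\<lambda>\<omega>. gradient \<epsilon> r s \<omega> * gradient \<epsilon> r' s' \<omega>)" (is ?goal1)
    and "expectation (\<lambda>\<omega>. gradient \<epsilon> r s \<omega> * gradient \<epsilon> r' s' \<omega>) =
      (2 * pi) powr (-3) * (fbm_incr_cov p r s r' s' *
       ((\<epsilon> + \<bar>s - r\<bar> powr p) * (\<epsilon> + \<bar>s' - r'\<bar> powr p) - (fbm_incr_cov p r s r' s')\<^sup>2) powr (-(5/2)))" (is ?goal2)
proof -
  define e where "e = (\<lambda>x::real. bell (x / sqrt \<epsilon>))"
  define o1 where "o1 = (\<lambda>x::real. x / sqrt \<epsilon> * bell (x / sqrt \<epsilon>))"
  define K where "K = (2 * pi) powr (-(3/2)) * \<epsilon> powr (-2)"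
  define f :: "3 \<Rightarrow> real \<Rightarrow> real \<Rightarrow> real" where "f = (\<lambda>j x y. if j = 1 then o1 x * o1 y else e x * e y)"
  let ?X = "\<lambda>j \<omega>. B s \<omega> $ j - B r \<omega> $ j" and ?Y = "\<lambda>j \<omega>. B s' \<omega> $ j - B r' \<omega> $ j"
  have XY [measurable]: "?X j \<in> borel_measurable M" "?Y j \<in> borel_measurable M" for j
    using t by (auto intro!: borel_measurable_diff measurable_B_nth)
  have [measurable]: "e \<in> borel_measurable borel" "o1 \<in> borel_measurable borel" by (auto simp: e_def o1_def)
  have fm: "(\<lambda>(x, y). f j x y) \<in> borel_measurable (borel \<Otimes>\<^sub>M borel)" for j
    by (cases "j = 1") (simp_all add: f_def)
  have fi: "integrable M (\<lambda>\<omega>. f j (?X j \<omega>) (?Y j \<omega>))" for j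
  proof (rule integrable_const_bound[where B=1])
    have "\<bar>e x\<bar> \<le> 1" "\<bar>o1 x\<bar> \<le> 1" for x
      using abs_mult_exp_neg_square_le[of "x / sqrt \<epsilon>"] by (auto simp: e_def o1_def)
    then show "AE \<omega> in M. norm (f j (?X j \<omega>) (?Y j \<omega>)) \<le> 1"
      by (intro AE_I2) (auto simp: f_def abs_mult intro!: mult_le_one)
    show "(\<lambda>\<omega>. f j (?X j \<omega>) (?Y j \<omega>)) \<in> borel_measurable M"
      using measurable_compose[OF _ fm[of j], of "\<lambda>\<omega>. (?X j \<omega>, ?Y j \<omega>)"] by simp
  qed
  have grad: "gradient \<epsilon> u v \<omega> = - K * (o1 (B v \<omega> $ 1 - B u \<omega> $ 1) * (e (B v \<omega> $ 2 - B u \<omega> $ 2) * e (B v \<omega> $ 3 - B u \<omega> $ 3)))" for u v \<omega>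
    unfolding partial_deriv_heat_kernel[OF \<epsilon>] K_def o1_def e_def vector_minus_component ..
  have eq: "gradient \<epsilon> r s \<omega> * gradient \<epsilon> r' s' \<omega> = K\<^sup>2 * (\<Prod>j\<in>UNIV. f j (?X j \<omega>) (?Y j \<omega>))" for \<omega>
    unfolding grad prod_UNIV_3 by (simp add: f_def power2_eq_square)
  show ?goal1
    unfolding eq by (intro integrable_mult_right expectation_coordinate_product t fm fi)
  define d where "d = (\<epsilon> + \<bar>s - r\<bar> powr p) * (\<epsilon> + \<bar>s' - r'\<bar> powr p) - (fbm_incr_cov p r s r' s')\<^sup>2"
  note J = jointly_gaussian_kernel_expectations[OF jointly_gaussian_increments[OF t] \<epsilon>, folded d_def]
  have E1: "expectation (\<lambda>\<omega>. f j (?X j \<omega>) (?Y j \<omega>)) = \<epsilon> * d powr (-(1/2))" if "j \<noteq> 1" for j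
    using J(2)[of j] that by (simp add: f_def e_def)
  have E2: "expectation (\<lambda>\<omega>. f 1 (?X 1 \<omega>) (?Y 1 \<omega>)) = \<epsilon>\<^sup>2 * fbm_incr_cov p r s r' s' * d powr (-(3/2))"
    using J(3)[of 1] by (simp add: f_def o1_def)
  have "expectation (\<lambda>\<omega>. gradient \<epsilon> r s \<omega> * gradient \<epsilon> r' s' \<omega>) = K\<^sup>2 * (\<Prod>j\<in>UNIV. expectation (\<lambda>\<omega>. f j (?X j \<omega>) (?Y j \<omega>)))"
    unfolding eq by (simp add: expectation_coordinate_product(2)[OF t fm fi])
  also have "\<dots> = K\<^sup>2 * ((\<epsilon>\<^sup>2 * fbm_incr_cov p r s r' s' * d powr (-(3/2))) * ((\<epsilon> * d powr (-(1/2))) * (\<epsilon> * d powr (-(1/2)))))"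
    by (simp add: prod_UNIV_3 E1 E2)
  also have "\<dots> = (K\<^sup>2 * \<epsilon> ^ 4) * (fbm_incr_cov p r s r' s' * (d powr (-(3/2)) * d powr (-(1/2)) * d powr (-(1/2))))"
    by (simp add: power2_eq_square power4_eq_xxxx)
  also have "d powr (-(3/2)) * d powr (-(1/2)) * d powr (-(1/2)) = d powr (-(5/2))"
    by (simp add: powr_add[symmetric])
  also have "K\<^sup>2 * \<epsilon> ^ 4 = (2 * pi) powr (-3)"
  proof -
    have "\<epsilon> powr (-2) * \<epsilon> powr (-2) * \<epsilon> ^ 4 = 1"
      using \<epsilon> by (simp add: powr_add[symmetric] powr_minus_divide powr_numeral)
    moreover have "(2 * pi) powr (-(3/2)) * (2 * pi) powr (-(3/2)) = (2 * pi) powr (-3)"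
      by (simp add: powr_add[symmetric])
    ultimately show ?thesis by (simp add: K_def power2_eq_square mult_ac)
  qed
  finally show ?goal2
    by (simp add: d_def)
qed

text \<open>The expectation is a constant times \<open>\<mu>\<close>, with a constant that depends
  on \<open>(r, s)\<close> only. This identifies the coefficient of the increment in the orthogonal
  projection.\<close>

lemma gradient_linear_expectation:
  assumes t: "0 \<le> r" "0 \<le> s" "0 \<le> r'" "0 \<le> s'" and \<epsilon>: "0 < \<epsilon>"
  shows "integrable M (\<lambda>\<omega>. gradient \<epsilon> r s \<omega> * (B s' \<omega> $ 1 - B r' \<omega> $ 1))" (is ?goal1)
    and "expectation (\<lambda>\<omega>. gradient \<epsilon> r s \<omega> * (B s' \<omega> $ 1 - B r' \<omega> $ 1)) =
      - ((2 * pi) powr (-(3/2)) * fbm_incr_cov p r s r' s' * (\<epsilon> + \<bar>s - r\<bar> powr p) powr (-(5/2)))" (is ?goal2)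
proof -
  define e where "e = (\<lambda>x::real. bell (x / sqrt \<epsilon>))"
  define o1 where "o1 = (\<lambda>x::real. x / sqrt \<epsilon> * bell (x / sqrt \<epsilon>))"
  define K where "K = (2 * pi) powr (-(3/2)) * \<epsilon> powr (-2)"
  define f :: "3 \<Rightarrow> real \<Rightarrow> real \<Rightarrow> real" where "f = (\<lambda>j x y. if j = 1 then o1 x * y else e x)"
  let ?X = "\<lambda>j \<omega>. B s \<omega> $ j - B r \<omega> $ j" and ?Y = "\<lambda>j \<omega>. B s' \<omega> $ j - B r' \<omega> $ j"
  have XY [measurable]: "?X j \<in> borel_measurable M" "?Y j \<in> borel_measurable M" for j
    using t by (auto intro!: borel_measurable_diff measurable_B_nth)
  have Y: "integrable M (?Y j)" for j using t by (auto intro!: integrable_B)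
  have [measurable]: "e \<in> borel_measurable borel" "o1 \<in> borel_measurable borel" by (auto simp: e_def o1_def)
  have fm: "(\<lambda>(x, y). f j x y) \<in> borel_measurable (borel \<Otimes>\<^sub>M borel)" for j
    by (cases "j = 1") (simp_all add: f_def)
  have fi: "integrable M (\<lambda>\<omega>. f j (?X j \<omega>) (?Y j \<omega>))" for j
  proof (rule Bochner_Integration.integrable_bound)
    show "integrable M (\<lambda>\<omega>. \<bar>?Y j \<omega>\<bar> + 1)" using Y by auto
    have eo: "\<bar>e x\<bar> \<le> 1" "\<bar>o1 x\<bar> \<le> 1" for x
      using abs_mult_exp_neg_square_le[of "x / sqrt \<epsilon>"] by (auto simp: e_def o1_def)
    have "\<bar>o1 x * y\<bar> \<le> \<bar>y\<bar> + 1" "\<bar>e x\<bar> \<le> \<bar>y\<bar> + 1" for x y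
      using mult_right_mono[OF eo(2)[of x], of "\<bar>y\<bar>"] eo(1)[of x] by (auto simp: abs_mult)
    then show "AE \<omega> in M. norm (f j (?X j \<omega>) (?Y j \<omega>)) \<le> norm (\<bar>?Y j \<omega>\<bar> + 1)"
      by (intro AE_I2) (auto simp: f_def)
    show "(\<lambda>\<omega>. f j (?X j \<omega>) (?Y j \<omega>)) \<in> borel_measurable M"
      using measurable_compose[OF _ fm[of j], of "\<lambda>\<omega>. (?X j \<omega>, ?Y j \<omega>)"] by simp
  qed
  have grad: "gradient \<epsilon> u v \<omega> = - K * (o1 (B v \<omega> $ 1 - B u \<omega> $ 1) * (e (B v \<omega> $ 2 - B u \<omega> $ 2) * e (B v \<omega> $ 3 - B u \<omega> $ 3)))" for u v \<omega>
    unfolding partial_deriv_heat_kernel[OF \<epsilon>] K_def o1_def e_def vector_minus_component ..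
  have eq: "gradient \<epsilon> r s \<omega> * (B s' \<omega> $ 1 - B r' \<omega> $ 1) = - K * (\<Prod>j\<in>UNIV. f j (?X j \<omega>) (?Y j \<omega>))" for \<omega>
    unfolding grad prod_UNIV_3 by (simp add: f_def)
  show ?goal1
    unfolding eq by (intro integrable_mult_right expectation_coordinate_product t fm fi)
  define d where "d = \<epsilon> + \<bar>s - r\<bar> powr p"
  note J = jointly_gaussian_kernel_expectations[OF jointly_gaussian_increments[OF t] \<epsilon>, folded d_def]
  have E1: "expectation (\<lambda>\<omega>. f j (?X j \<omega>) (?Y j \<omega>)) = sqrt \<epsilon> * d powr (-(1/2))" if "j \<noteq> 1" for j
    using J(4)[of j] that by (simp add: f_def e_def)
  have E2: "expectation (\<lambda>\<omega>. f 1 (?X 1 \<omega>) (?Y 1 \<omega>)) = \<epsilon> * fbm_incr_cov p r s r' s' * d powr (-(3/2))"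
    using J(5)[of 1] Y[of 1] by (simp add: f_def o1_def)
  have "expectation (\<lambda>\<omega>. gradient \<epsilon> r s \<omega> * (B s' \<omega> $ 1 - B r' \<omega> $ 1)) = - K * (\<Prod>j\<in>UNIV. expectation (\<lambda>\<omega>. f j (?X j \<omega>) (?Y j \<omega>)))"
    unfolding eq by (simp add: expectation_coordinate_product(2)[OF t fm fi])
  also have "\<dots> = - K * ((\<epsilon> * fbm_incr_cov p r s r' s' * d powr (-(3/2))) * ((sqrt \<epsilon> * d powr (-(1/2))) * (sqrt \<epsilon> * d powr (-(1/2)))))"
    by (simp add: prod_UNIV_3 E1 E2)
  also have "\<dots> = - ((K * (\<epsilon> * (sqrt \<epsilon> * sqrt \<epsilon>))) * (fbm_incr_cov p r s r' s' * (d powr (-(3/2)) * d powr (-(1/2)) * d powr (-(1/2)))))"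
    by (simp only: mult_ac mult_minus_left mult_minus_right)
  also have "d powr (-(3/2)) * d powr (-(1/2)) * d powr (-(1/2)) = d powr (-(5/2))"
    by (simp add: powr_add[symmetric])
  also have "K * (\<epsilon> * (sqrt \<epsilon> * sqrt \<epsilon>)) = (2 * pi) powr (-(3/2))"
    using \<epsilon> by (simp add: K_def powr_minus_divide powr_numeral power2_eq_square)
  finally show ?goal2
    by (simp add: d_def)
qed

abbreviation chaos_error :: "real \<Rightarrow> real \<Rightarrow> real \<Rightarrow> 'a \<Rightarrow> real" where
  "chaos_error \<epsilon> r s \<omega> \<equiv> chaos_error_of B p \<epsilon> r s \<omega>"

text \<open>Each cross term equals minus the covariance of the two projections, so of the last three
  terms exactly one subtraction survives: the one in \<open>chaos_remainder\<close>.\<close>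

lemma chaos_error_covariance:
  assumes t: "0 \<le> r" "0 \<le> s" "0 \<le> r'" "0 \<le> s'" and \<epsilon>: "0 < \<epsilon>"
  shows "integrable M (\<lambda>\<omega>. chaos_error \<epsilon> r s \<omega> * chaos_error \<epsilon> r' s' \<omega>)" (is ?goal1)
    and "expectation (\<lambda>\<omega>. chaos_error \<epsilon> r s \<omega> * chaos_error \<epsilon> r' s' \<omega>) =
      (2 * pi) powr (-3) * chaos_remainder \<epsilon> (\<bar>s - r\<bar> powr p) (\<bar>s' - r'\<bar> powr p) (fbm_incr_cov p r s r' s')" (is ?goal2)
proof -
  define k where "k = (2 * pi) powr (-(3/2))"
  define a where "a = (\<epsilon> + \<bar>s - r\<bar> powr p) powr (-(5/2))"
  define b where "b = (\<epsilon> + \<bar>s' - r'\<bar> powr p) powr (-(5/2))"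
  let ?X = "\<lambda>\<omega>. B s \<omega> $ 1 - B r \<omega> $ 1" and ?Y = "\<lambda>\<omega>. B s' \<omega> $ 1 - B r' \<omega> $ 1"
  have eq: "chaos_error \<epsilon> r s \<omega> * chaos_error \<epsilon> r' s' \<omega> =
      gradient \<epsilon> r s \<omega> * gradient \<epsilon> r' s' \<omega> + (k * b) * (gradient \<epsilon> r s \<omega> * ?Y \<omega>)
      + (k * a) * (gradient \<epsilon> r' s' \<omega> * ?X \<omega>) + (k * k * a * b) * (?X \<omega> * ?Y \<omega>)" for \<omega>
    by (simp add: chaos_error_of_def k_def a_def b_def algebra_simps)
  note i = gradient_product_expectation(1)[OF t \<epsilon>] gradient_linear_expectation(1)[OF t \<epsilon>]
     gradient_linear_expectation(1)[OF t(3,4,1,2) \<epsilon>] increment_covariance(1)[OF t, of 1]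
  show ?goal1
    unfolding eq by (intro Bochner_Integration.integrable_add integrable_mult_right i)
  have kk: "k * k = (2 * pi) powr (-3)" by (simp add: k_def powr_add[symmetric])
  have ab: "a * b = ((\<epsilon> + \<bar>s - r\<bar> powr p) * (\<epsilon> + \<bar>s' - r'\<bar> powr p)) powr (-(5/2))"
    by (simp add: a_def b_def powr_mult)
  have "expectation (\<lambda>\<omega>. chaos_error \<epsilon> r s \<omega> * chaos_error \<epsilon> r' s' \<omega>) =
      expectation (\<lambda>\<omega>. gradient \<epsilon> r s \<omega> * gradient \<epsilon> r' s' \<omega>) + (k * b) * expectation (\<lambda>\<omega>. gradient \<epsilon> r s \<omega> * ?Y \<omega>)
      + (k * a) * expectation (\<lambda>\<omega>. gradient \<epsilon> r' s' \<omega> * ?X \<omega>) + (k * k * a * b) * expectation (\<lambda>\<omega>. ?X \<omega> * ?Y \<omega>)"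
    unfolding eq by (simp add: i)
  also have "\<dots> = (2 * pi) powr (-3) * chaos_remainder \<epsilon> (\<bar>s - r\<bar> powr p) (\<bar>s' - r'\<bar> powr p) (fbm_incr_cov p r s r' s')"
    unfolding gradient_product_expectation(2)[OF t \<epsilon>] gradient_linear_expectation(2)[OF t \<epsilon>]
      gradient_linear_expectation(2)[OF t(3,4,1,2) \<epsilon>] increment_covariance(2)[OF t]
      chaos_remainder_def ab[symmetric] kk[symmetric] fbm_incr_cov_commute[of p r' s']
      k_def[symmetric] a_def[symmetric] b_def[symmetric]
    by (simp add: algebra_simps)
  finally show ?goal2 .
qed

end

section \<open>The second moment of the error\<close>

text \<open>The square of an integral is a double integral, and Fubini moves the expectation inside.
  The uniform bound \<open>K\<close>, the finite measure and
  \<open>2 * \<bar>x * y\<bar> \<le> x\<^sup>2 + y\<^sup>2\<close> give absolute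
  integrability.\<close>

lemma (in prob_space) second_moment_integral:
  fixes G :: "'b \<Rightarrow> 'a \<Rightarrow> real"
  assumes "finite_measure Z"
    and G [measurable]: "(\<lambda>(z, \<omega>). G z \<omega>) \<in> borel_measurable (Z \<Otimes>\<^sub>M M)"
    and sq: "\<And>z. z \<in> space Z \<Longrightarrow> integrable M (\<lambda>\<omega>. (G z \<omega>)\<^sup>2)"
    and K: "\<And>z. z \<in> space Z \<Longrightarrow> expectation (\<lambda>\<omega>. (G z \<omega>)\<^sup>2) \<le> K"
  shows "integrable M (\<lambda>\<omega>. (LINT z|Z. G z \<omega>)\<^sup>2)" (is ?goal1)
    and "integrable (Z \<Otimes>\<^sub>M Z) (\<lambda>w. expectation (\<lambda>\<omega>. G (fst w) \<omega> * G (snd w) \<omega>))" (is ?goal2)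
    and "expectation (\<lambda>\<omega>. (LINT z|Z. G z \<omega>)\<^sup>2) = (LINT w|(Z \<Otimes>\<^sub>M Z). expectation (\<lambda>\<omega>. G (fst w) \<omega> * G (snd w) \<omega>))" (is ?goal3)
proof -
  interpret Z: finite_measure Z by fact
  interpret ZZ: pair_sigma_finite Z Z ..
  interpret ZZf: finite_measure "Z \<Otimes>\<^sub>M Z" by (rule finite_measure_pair_measure) fact+
  interpret P: pair_sigma_finite "Z \<Otimes>\<^sub>M Z" M ..
  define f where "f = (\<lambda>w \<omega>. G (fst w) \<omega> * G (snd w) \<omega>)"
  have fm [measurable]: "(\<lambda>(w, \<omega>). f w \<omega>) \<in> borel_measurable ((Z \<Otimes>\<^sub>M Z) \<Otimes>\<^sub>M M)"
    unfolding f_def by measurable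
  have bound: "\<bar>f w \<omega>\<bar> \<le> ((G (fst w) \<omega>)\<^sup>2 + (G (snd w) \<omega>)\<^sup>2) / 2" for w \<omega>
    using sum_squares_bound[of "\<bar>G (fst w) \<omega>\<bar>" "\<bar>G (snd w) \<omega>\<bar>"] by (simp add: f_def abs_mult)
  have ibd: "integrable M (\<lambda>\<omega>. ((G (fst w) \<omega>)\<^sup>2 + (G (snd w) \<omega>)\<^sup>2) / 2)" if "w \<in> space (Z \<Otimes>\<^sub>M Z)" for w
    using that sq by (auto simp: space_pair_measure)
  have fi: "integrable M (f w)" if w: "w \<in> space (Z \<Otimes>\<^sub>M Z)" for w
  proof (rule Bochner_Integration.integrable_bound[OF ibd[OF w]])
    show "f w \<in> borel_measurable M" unfolding f_def using w by (auto simp: space_pair_measure)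
    show "AE \<omega> in M. norm (f w \<omega>) \<le> norm (((G (fst w) \<omega>)\<^sup>2 + (G (snd w) \<omega>)\<^sup>2) / 2)"
      using bound by (intro AE_I2) (auto intro: order_trans)
  qed
  have f1: "integrable ((Z \<Otimes>\<^sub>M Z) \<Otimes>\<^sub>M M) (\<lambda>(w, \<omega>). f w \<omega>)"
  proof (rule P.Fubini_integrable)
    show "integrable (Z \<Otimes>\<^sub>M Z) (\<lambda>w. LINT \<omega>|M. norm (case (w, \<omega>) of (w, \<omega>) \<Rightarrow> f w \<omega>))"
    proof (rule ZZf.integrable_const_bound[where B=K])
      show "AE w in Z \<Otimes>\<^sub>M Z. norm (LINT \<omega>|M. norm (case (w, \<omega>) of (w, \<omega>) \<Rightarrow> f w \<omega>)) \<le> K"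
      proof (intro AE_I2)
        fix w assume w: "w \<in> space (Z \<Otimes>\<^sub>M Z)"
        then have "(LINT \<omega>|M. \<bar>f w \<omega>\<bar>) \<le> (LINT \<omega>|M. ((G (fst w) \<omega>)\<^sup>2 + (G (snd w) \<omega>)\<^sup>2) / 2)"
          using bound fi ibd by (intro integral_mono) auto
        also have "\<dots> = (expectation (\<lambda>\<omega>. (G (fst w) \<omega>)\<^sup>2) + expectation (\<lambda>\<omega>. (G (snd w) \<omega>)\<^sup>2)) / 2"
          using w sq by (auto simp: space_pair_measure)
        also have "\<dots> \<le> (K + K) / 2" using w K by (intro divide_right_mono add_mono) (auto simp: space_pair_measure)
        finally show "norm (LINT \<omega>|M. norm (case (w, \<omega>) of (w, \<omega>) \<Rightarrow> f w \<omega>)) \<le> K" by simp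
      qed
    qed measurable
    show "AE w in Z \<Otimes>\<^sub>M Z. integrable M (\<lambda>\<omega>. case (w, \<omega>) of (w, \<omega>) \<Rightarrow> f w \<omega>)"
      using fi by (intro AE_I2) simp
  qed measurable
  \<comment> \<open>The factorisation is available for those \<open>\<omega>\<close> for which the
    product is integrable, which is almost all of them.\<close>
  have eq: "AE \<omega> in M. (LINT w|(Z \<Otimes>\<^sub>M Z). f w \<omega>) = (LINT z|Z. G z \<omega>)\<^sup>2"
    using P.AE_integrable_snd[OF f1]
  proof eventually_elim
    case (elim \<omega>)
    then show ?case
      using ZZ.integral_fst'[OF elim] by (simp add: f_def power2_eq_square)
  qed
  have m1: "(\<lambda>\<omega>. LINT w|(Z \<Otimes>\<^sub>M Z). f w \<omega>) \<in> borel_measurable M"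
    using P.integrable_snd[OF f1] by auto
  have m2: "(\<lambda>\<omega>. (LINT z|Z. G z \<omega>)\<^sup>2) \<in> borel_measurable M" by measurable
  show ?goal1
    using P.integrable_snd[OF f1] integrable_cong_AE[OF m1 m2 eq] by simp
  show ?goal2
    using P.integrable_fst[OF f1] by (simp add: f_def)
  have "expectation (\<lambda>\<omega>. (LINT z|Z. G z \<omega>)\<^sup>2) = expectation (\<lambda>\<omega>. LINT w|(Z \<Otimes>\<^sub>M Z). f w \<omega>)"
    by (rule integral_cong_AE[OF m2 m1]) (use eq in auto)
  also have "\<dots> = (LINT w|(Z \<Otimes>\<^sub>M Z). expectation (f w))"
    by (rule P.Fubini_integral[OF f1])
  finally show ?goal3
    by (simp add: f_def)
qed

lemma measurable_chain_sum [measurable (raw)]: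
  assumes [measurable]: "f \<in> borel_measurable M" "g \<in> borel_measurable M" "h \<in> borel_measurable M" "k \<in> borel_measurable M"
  shows "(\<lambda>x. chain_sum \<kappa> (f x) (g x) (h x) (k x)) \<in> borel_measurable M"
  unfolding chain_sum_def by measurable

lemma integrable_chain_sum:
  fixes t \<kappa> :: real
  assumes t: "0 < t" and \<kappa>: "0 \<le> \<kappa>" "\<kappa> < 1"
  defines "Q \<equiv> Icc_measure t"
  shows "integrable ((Q \<Otimes>\<^sub>M Q) \<Otimes>\<^sub>M (Q \<Otimes>\<^sub>M Q)) (\<lambda>w. chain_sum \<kappa> (snd (fst w)) (fst (fst w)) (snd (snd w)) (fst (snd w)))"
proof -
  interpret Q: finite_measure Q unfolding Q_def by (rule finite_Icc_measure)
  interpret QQ: pair_sigma_finite Q Q ..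
  interpret QQf: finite_measure "Q \<Otimes>\<^sub>M Q" by (rule finite_measure_pair_measure) unfold_locales
  have Qm[measurable_cong]: "sets Q = sets borel" by (simp add: Q_def)
  have sf: "sigma_finite_measure (Q \<Otimes>\<^sub>M Q)" by unfold_locales
  show ?thesis
  proof (rule integrableI_bounded)
    have "(\<integral>\<^sup>+w. ennreal (norm (chain_sum \<kappa> (snd (fst w)) (fst (fst w)) (snd (snd w)) (fst (snd w)))) \<partial>((Q \<Otimes>\<^sub>M Q) \<Otimes>\<^sub>M (Q \<Otimes>\<^sub>M Q)))
       = (\<integral>\<^sup>+s. \<integral>\<^sup>+r. \<integral>\<^sup>+s'. \<integral>\<^sup>+r'. ennreal (chain_sum \<kappa> r s r' s') \<partial>Q \<partial>Q \<partial>Q \<partial>Q)"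
      by (simp add: sigma_finite_measure.nn_integral_fst[OF sf, symmetric]
          sigma_finite_measure.nn_integral_fst[OF Q.sigma_finite_measure_axioms, symmetric] chain_sum_def)
    also have "\<dots> < \<infinity>" unfolding Q_def by (rule nn_integral_chain_sum_finite[OF assms(1-3)])
    finally show "(\<integral>\<^sup>+w. ennreal (norm (chain_sum \<kappa> (snd (fst w)) (fst (fst w)) (snd (snd w)) (fst (snd w)))) \<partial>((Q \<Otimes>\<^sub>M Q) \<Otimes>\<^sub>M (Q \<Otimes>\<^sub>M Q))) < \<infinity>" .
  qed measurable
qed

text \<open>Discards the coincidences of end points at which the pointwise bound says
  nothing.\<close>

lemma AE_Icc_measure_distinct4:
  fixes t :: real
  defines "Q \<equiv> Icc_measure t"
  shows "AE w in (Q \<Otimes>\<^sub>M Q) \<Otimes>\<^sub>M (Q \<Otimes>\<^sub>M Q). distinct [fst (fst w), snd (fst w), fst (snd w), snd (snd w)]"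
proof -
  interpret Q: finite_measure Q unfolding Q_def by (rule finite_Icc_measure)
  interpret QQ: pair_sigma_finite Q Q ..
  interpret QQf: finite_measure "Q \<Otimes>\<^sub>M Q" by (rule finite_measure_pair_measure) unfold_locales
  interpret P: pair_sigma_finite "Q \<Otimes>\<^sub>M Q" "Q \<Otimes>\<^sub>M Q" ..
  have Qm[measurable_cong]: "sets Q = sets borel" by (simp add: Q_def)
  have inner: "AE y in Q \<Otimes>\<^sub>M Q. fst y \<noteq> snd y \<and> fst y \<noteq> a \<and> fst y \<noteq> b \<and> snd y \<noteq> a \<and> snd y \<noteq> b" for a b
  proof (rule QQ.AE_pair_measure)
    show "AE x in Q. AE y in Q. fst (x, y) \<noteq> snd (x, y) \<and> fst (x, y) \<noteq> a \<and> fst (x, y) \<noteq> b \<and> snd (x, y) \<noteq> a \<and> snd (x, y) \<noteq> b"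
      using AE_Icc_measure_neq[of a t] AE_Icc_measure_neq[of b t] unfolding Q_def[symmetric]
    proof eventually_elim
      case (elim x)
      have "AE y in Q. y \<noteq> a \<and> y \<noteq> b \<and> y \<noteq> x"
        using AE_Icc_measure_neq[of a t, folded Q_def] AE_Icc_measure_neq[of b t, folded Q_def] AE_Icc_measure_neq[of x t, folded Q_def]
        by eventually_elim simp
      then show ?case by (rule eventually_mono) (use elim in auto)
    qed
  qed measurable
  have "AE x in Q \<Otimes>\<^sub>M Q. fst x \<noteq> snd x" using inner[of 0 0] by eventually_elim simp
  show ?thesis
  proof (rule P.AE_pair_measure)
    show "AE x in Q \<Otimes>\<^sub>M Q. AE y in Q \<Otimes>\<^sub>M Q. distinct [fst (fst (x, y)), snd (fst (x, y)), fst (snd (x, y)), snd (snd (x, y))]"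
      using \<open>AE x in Q \<Otimes>\<^sub>M Q. fst x \<noteq> snd x\<close>
    proof eventually_elim
      case (elim x)
      then show ?case by (intro eventually_mono[OF inner[of "fst x" "snd x"]]) auto
    qed
  qed (simp, measurable)
qed

section \<open>A continuous modification and the integrated projection error\<close>

context fbm3
begin

text \<open>Only almost every path of \<open>B\<close> is continuous, and \<open>B\<close> need not be jointly measurable. The
  modification \<open>X\<close> is continuous everywhere (constant on negative times), hence jointly measurable.\<close>

definition null_event :: "'a set" where
  "null_event = (SOME N. N \<in> null_sets M \<and> {\<omega> \<in> space M. \<not> continuous_on {0..} (\<lambda>t. B t \<omega>)} \<subseteq> N)"

definition X :: "real \<Rightarrow> 'a \<Rightarrow> real ^ 3" where
  "X \<tau> \<omega> = (if \<omega> \<in> space M - null_event then B (max 0 \<tau>) \<omega> else 0)"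

lemma null_event: "null_event \<in> null_sets M" "{\<omega> \<in> space M. \<not> continuous_on {0..} (\<lambda>t. B t \<omega>)} \<subseteq> null_event"
proof -
  have "AE \<omega> in M. continuous_on {0..} (\<lambda>t. B t \<omega>)"
    using fbm by (simp add: fractional_brownian_motion_def)
  then obtain N where "{\<omega> \<in> space M. \<not> continuous_on {0..} (\<lambda>t. B t \<omega>)} \<subseteq> N" "emeasure M N = 0" "N \<in> sets M"
    by (rule AE_E)
  then have "\<exists>N. N \<in> null_sets M \<and> {\<omega> \<in> space M. \<not> continuous_on {0..} (\<lambda>t. B t \<omega>)} \<subseteq> N" by auto
  then show "null_event \<in> null_sets M" "{\<omega> \<in> space M. \<not> continuous_on {0..} (\<lambda>t. B t \<omega>)} \<subseteq> null_event"
    unfolding null_event_def by (metis (mono_tags, lifting) someI_ex)+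
qed

lemma AE_X_eq: "AE \<omega> in M. \<forall>\<tau>\<ge>0. X \<tau> \<omega> = B \<tau> \<omega>"
  using AE_not_in[OF null_event(1)] AE_space by eventually_elim (auto simp: X_def)

lemma continuous_X: "continuous_on UNIV (\<lambda>\<tau>. X \<tau> \<omega>)"
proof (cases "\<omega> \<in> space M - null_event")
  case True
  then have "continuous_on {0..} (\<lambda>t. B t \<omega>)" using null_event(2) by auto
  then have "continuous_on UNIV (\<lambda>\<tau>. B (max 0 \<tau>) \<omega>)"
    by (rule continuous_on_compose2) (auto intro!: continuous_intros)
  then show ?thesis using True by (simp add: X_def)
next
  case False
  then have "X \<tau> \<omega> = 0" for \<tau> by (auto simp: X_def)
  then show ?thesis by simp
qed

lemma measurable_X_fixed: "X \<tau> \<in> borel_measurable M"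
proof -
  have [measurable]: "null_event \<in> sets M" using null_event by auto
  have [measurable]: "B (max 0 \<tau>) \<in> borel_measurable M" by (rule measurable_B) simp
  have "(\<lambda>\<omega>. if \<omega> \<in> space M - null_event then B (max 0 \<tau>) \<omega> else 0) \<in> borel_measurable M" by measurable
  then show ?thesis by (simp add: X_def[abs_def])
qed

text \<open>Rounding time down to multiples of \<open>1 / (n + 1)\<close> leaves countably many
  times, hence a jointly measurable map; continuity of every path passes this to the limit.\<close>

lemma measurable_X: "(\<lambda>x. X (fst x) (snd x)) \<in> borel_measurable (borel \<Otimes>\<^sub>M M)"
proof (rule borel_measurable_LIMSEQ_metric)
  show "(\<lambda>x. X (real_of_int \<lfloor>real (Suc n) * fst x\<rfloor> / real (Suc n)) (snd x)) \<in> borel_measurable (borel \<Otimes>\<^sub>M M)" for n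
  proof (rule measurable_compose_countable[where f="\<lambda>i x. X (real_of_int i / real (Suc n)) (snd x)" and g="\<lambda>x. \<lfloor>real (Suc n) * fst x\<rfloor>"])
    show "(\<lambda>x. X (real_of_int i / real (Suc n)) (snd x)) \<in> borel_measurable (borel \<Otimes>\<^sub>M M)" for i
      using measurable_compose[OF measurable_snd measurable_X_fixed] .
    show "(\<lambda>x. \<lfloor>real (Suc n) * fst x\<rfloor>) \<in> measurable (borel \<Otimes>\<^sub>M M) (count_space UNIV)"
      by measurable
  qed
  fix x :: "real \<times> 'a"
  have "(\<lambda>n. real_of_int \<lfloor>real (Suc n) * fst x\<rfloor> / real (Suc n)) \<longlonglongrightarrow> fst x"
  proof (rule tendsto_sandwich)
    show "\<forall>\<^sub>F n in sequentially. fst x - inverse (real (Suc n)) \<le> real_of_int \<lfloor>real (Suc n) * fst x\<rfloor> / real (Suc n)"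
    proof (intro always_eventually allI)
      fix n
      have "(real (Suc n) * fst x - 1) / real (Suc n) \<le> real_of_int \<lfloor>real (Suc n) * fst x\<rfloor> / real (Suc n)"
        by (intro divide_right_mono) linarith+
      then show "fst x - inverse (real (Suc n)) \<le> real_of_int \<lfloor>real (Suc n) * fst x\<rfloor> / real (Suc n)"
        by (simp add: diff_divide_distrib inverse_eq_divide del: of_nat_Suc)
    qed
    show "\<forall>\<^sub>F n in sequentially. real_of_int \<lfloor>real (Suc n) * fst x\<rfloor> / real (Suc n) \<le> fst x"
    proof (intro always_eventually allI)
      fix n
      have "real_of_int \<lfloor>real (Suc n) * fst x\<rfloor> / real (Suc n) \<le> (real (Suc n) * fst x) / real (Suc n)"
        by (intro divide_right_mono) linarith+
      then show "real_of_int \<lfloor>real (Suc n) * fst x\<rfloor> / real (Suc n) \<le> fst x" by (simp del: of_nat_Suc)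
    qed
    show "(\<lambda>n. fst x - inverse (real (Suc n))) \<longlonglongrightarrow> fst x"
      using tendsto_diff[OF tendsto_const LIMSEQ_inverse_real_of_nat, of "fst x"] by simp
  qed simp
  then show "(\<lambda>n. X (real_of_int \<lfloor>real (Suc n) * fst x\<rfloor> / real (Suc n)) (snd x)) \<longlonglongrightarrow> X (fst x) (snd x)"
    by (rule continuous_on_tendsto_compose[OF continuous_X[of "snd x"]]) auto
qed

text \<open>The cut-off at the triangle turns the integral with variable upper limit into one over a
  fixed finite product measure, as Fubini requires.\<close>

definition restricted_error :: "real \<Rightarrow> real \<Rightarrow> real \<times> real \<Rightarrow> 'a \<Rightarrow> real" where
  "restricted_error t \<epsilon> z \<omega> = (if in_triangle t z
     then chaos_error_of X p \<epsilon> (snd z) (fst z) \<omega> else 0)"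

lemma measurable_partial_deriv_heat_kernel:
  assumes "0 < \<epsilon>"
  shows "partial_deriv 1 (heat_kernel \<epsilon> :: real ^ 3 \<Rightarrow> real) \<in> borel_measurable borel"
  unfolding partial_deriv_heat_kernel[OF assms, abs_def] cart_eq_inner_axis by measurable

lemma measurable_restricted_error:
  assumes "0 < \<epsilon>"
  shows "(\<lambda>(z, \<omega>). restricted_error t \<epsilon> z \<omega>) \<in> borel_measurable ((Icc_square t) \<Otimes>\<^sub>M M)"
proof -
  note [measurable] = measurable_X measurable_partial_deriv_heat_kernel[OF assms]
  have [measurable]: "(\<lambda>x. X (fst (fst x)) (snd x)) \<in> borel_measurable ((Icc_square t) \<Otimes>\<^sub>M M)"
    "(\<lambda>x. X (snd (fst x)) (snd x)) \<in> borel_measurable ((Icc_square t) \<Otimes>\<^sub>M M)"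
    using measurable_compose[OF _ measurable_X, of "\<lambda>x. (fst (fst x), snd x)" "(Icc_square t) \<Otimes>\<^sub>M M"]
      measurable_compose[OF _ measurable_X, of "\<lambda>x. (snd (fst x), snd x)" "(Icc_square t) \<Otimes>\<^sub>M M"]
    by simp_all
  show ?thesis
    unfolding restricted_error_def chaos_error_of_def cart_eq_inner_axis split_beta by measurable
qed

lemma restricted_error_covariance:
  assumes \<epsilon>: "0 < \<epsilon>"
  shows "integrable M (\<lambda>\<omega>. restricted_error t \<epsilon> z \<omega> * restricted_error t \<epsilon> z' \<omega>)"
    and "expectation (\<lambda>\<omega>. restricted_error t \<epsilon> z \<omega> * restricted_error t \<epsilon> z' \<omega>) =
      (if in_triangle t z \<and> in_triangle t z'
       then (2 * pi) powr (-3) * chaos_remainder \<epsilon> ((fst z - snd z) powr p) ((fst z' - snd z') powr p)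
          (fbm_incr_cov p (snd z) (fst z) (snd z') (fst z')) else 0)"
proof -
  let ?in = "in_triangle t z \<and> in_triangle t z'"
  let ?f = "\<lambda>\<omega>. restricted_error t \<epsilon> z \<omega> * restricted_error t \<epsilon> z' \<omega>"
  have *: "integrable M ?f \<and> expectation ?f = (2 * pi) powr (-3) * chaos_remainder \<epsilon> ((fst z - snd z) powr p) ((fst z' - snd z') powr p)
          (fbm_incr_cov p (snd z) (fst z) (snd z') (fst z'))" if ?in
  proof -
    have t: "0 \<le> snd z" "0 \<le> fst z" "0 \<le> snd z'" "0 \<le> fst z'" using that by auto
    let ?g = "\<lambda>\<omega>. chaos_error \<epsilon> (snd z) (fst z) \<omega> * chaos_error \<epsilon> (snd z') (fst z') \<omega>"
    have eq: "AE \<omega> in M. ?f \<omega> = ?g \<omega>"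
      using AE_X_eq by eventually_elim (use that t in \<open>simp add: restricted_error_def chaos_error_of_def\<close>)
    have mg: "?g \<in> borel_measurable M" using chaos_error_covariance(1)[OF t \<epsilon>] by auto
    note [measurable] = measurable_X_fixed measurable_partial_deriv_heat_kernel[OF \<epsilon>]
    have mf: "?f \<in> borel_measurable M"
      unfolding restricted_error_def chaos_error_of_def cart_eq_inner_axis by measurable
    have abs: "\<bar>fst z - snd z\<bar> = fst z - snd z" "\<bar>fst z' - snd z'\<bar> = fst z' - snd z'" using that by auto
    show ?thesis
      using integrable_cong_AE[OF mf mg eq] integral_cong_AE[OF mf mg eq] chaos_error_covariance[OF t \<epsilon>]
      by (simp add: abs)
  qed
  have "?f = (\<lambda>_. 0)" if "\<not> ?in" using that by (auto simp: restricted_error_def fun_eq_iff)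
  then have **: "integrable M ?f \<and> expectation ?f = 0" if "\<not> ?in" using that by simp
  show "integrable M ?f" using * ** by (cases ?in) blast+
  show "expectation ?f = (if ?in
       then (2 * pi) powr (-3) * chaos_remainder \<epsilon> ((fst z - snd z) powr p) ((fst z' - snd z') powr p)
          (fbm_incr_cov p (snd z) (fst z) (snd z') (fst z')) else 0)"
    using * ** by (cases ?in) auto
qed

lemma p_bounds: "1 < p" "p < 4/3"
  using H_gt H_less by (auto simp: p_def)

text \<open>A crude bound that blows up as \<open>\<epsilon>\<close> tends to 0; for each fixed
  \<open>\<epsilon>\<close> it is the constant \<open>K\<close> that justifies Fubini. On the
  diagonal the determinant is at least \<open>\<epsilon>\<^sup>2\<close>.\<close>

lemma restricted_error_variance_le:
  assumes \<epsilon>: "0 < \<epsilon>" and t: "0 < t"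
  shows "expectation (\<lambda>\<omega>. (restricted_error t \<epsilon> z \<omega>)\<^sup>2) \<le> (2 * pi) powr (-3) * (t powr p * (\<epsilon>\<^sup>2) powr (-(5/2)))"
proof (cases "in_triangle t z")
  case True
  define v where "v = (fst z - snd z) powr p"
  have v: "0 \<le> v" "v \<le> t powr p" using True p_bounds by (auto simp: v_def intro!: powr_mono2)
  have cov: "fbm_incr_cov p (snd z) (fst z) (snd z) (fst z) = v"
    using True by (simp add: fbm_incr_cov_def v_def abs_minus_commute)
  have "\<epsilon>\<^sup>2 \<le> (\<epsilon> + v) * (\<epsilon> + v) - v\<^sup>2" using \<epsilon> v by (simp add: power2_eq_square algebra_simps)
  then have "v * ((\<epsilon> + v) * (\<epsilon> + v) - v\<^sup>2) powr (-(5/2)) \<le> t powr p * (\<epsilon>\<^sup>2) powr (-(5/2))"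
    using \<epsilon> v by (intro mult_mono powr_mono2') auto
  then have "chaos_remainder \<epsilon> v v v \<le> t powr p * (\<epsilon>\<^sup>2) powr (-(5/2))"
    using chaos_remainder_le[OF v(1), of \<epsilon> v v] by linarith
  then show ?thesis
    using restricted_error_covariance(2)[OF \<epsilon>, of t z z] True
    by (simp add: power2_eq_square[symmetric] cov v_def[symmetric])
next
  case False
  then have "restricted_error t \<epsilon> z \<omega> = 0" for \<omega> by (auto simp: restricted_error_def)
  then show ?thesis by simp
qed

text \<open>The normalisation \<open>5 - 4/p\<close> is the square of the one in the theorem.
  \<open>C\<close> and \<open>\<gamma>\<close> do not depend on \<open>\<epsilon>\<close>, so the
  normalised error vanishes in mean square.\<close>

lemma second_moment_error:
  assumes t: "0 < t"
  obtains C \<gamma> where "0 < \<gamma>"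
    "\<And>\<epsilon>. 0 < \<epsilon> \<Longrightarrow> integrable M (\<lambda>\<omega>. (LINT z|(Icc_square t). restricted_error t \<epsilon> z \<omega>)\<^sup>2)"
    "\<And>\<epsilon>. 0 < \<epsilon> \<Longrightarrow> \<epsilon> powr (5 - 4/p) * expectation (\<lambda>\<omega>. (LINT z|(Icc_square t). restricted_error t \<epsilon> z \<omega>)\<^sup>2) \<le> C * \<epsilon> powr \<gamma>"
proof -
  \<comment> \<open>This makes \<open>p - 1 - 3 * \<eta> = (p - 1) / 2\<close> positive while
    \<open>1 - \<eta> < 1\<close> keeps the chain kernels integrable.\<close>
  define \<eta> where "\<eta> = (p - 1) / 6"
  have \<eta>: "0 \<le> \<eta>" "\<eta> < p - 1" "0 \<le> 1 - \<eta>" "1 - \<eta> < 1" "0 < p - 1 - 3 * \<eta>" using p_bounds by (auto simp: \<eta>_def)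
  obtain C where C: "0 \<le> C" and bound: "\<And>\<epsilon> r s r' s'. 0 < \<epsilon> \<Longrightarrow> r < s \<Longrightarrow> r' < s' \<Longrightarrow> r \<noteq> r' \<Longrightarrow> s \<noteq> s' \<Longrightarrow> r \<noteq> s' \<Longrightarrow> r' \<noteq> s \<Longrightarrow>
      \<epsilon> powr (5 - 4/p) * chaos_remainder \<epsilon> ((s - r) powr p) ((s' - r') powr p) (fbm_incr_cov p r s r' s')
      \<le> C * (\<epsilon> powr ((p - 1 - 3 * \<eta>) / p) * chain_sum (1 - \<eta>) r s r' s')"
    using chaos_remainder_le_chain_sum[OF p_bounds \<eta>(1,2)] by blast
  define Q where "Q = Icc_measure t"
  define \<gamma> where "\<gamma> = (p - 1 - 3 * \<eta>) / p"
  define S where "S = (\<lambda>w::(real \<times> real) \<times> real \<times> real. chain_sum (1 - \<eta>) (snd (fst w)) (fst (fst w)) (snd (snd w)) (fst (snd w)))"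
  have S: "integrable ((Q \<Otimes>\<^sub>M Q) \<Otimes>\<^sub>M (Q \<Otimes>\<^sub>M Q)) S"
    unfolding S_def Q_def by (rule integrable_chain_sum) (use t \<eta> in auto)
  have fin: "finite_measure (Q \<Otimes>\<^sub>M Q)"
    unfolding Q_def by (intro finite_measure_pair_measure finite_Icc_measure)
  have S0: "0 \<le> S w" for w by (simp add: S_def chain_sum_def)
  define C' where "C' = (2 * pi) powr (-3) * C"
  have C': "0 \<le> C'" using C by (simp add: C'_def)
  show thesis
  proof (rule that[of \<gamma> "C' * integral\<^sup>L ((Q \<Otimes>\<^sub>M Q) \<Otimes>\<^sub>M (Q \<Otimes>\<^sub>M Q)) S"])
    show "0 < \<gamma>" using \<eta> p_bounds by (simp add: \<gamma>_def)
    fix \<epsilon> :: real assume \<epsilon>: "0 < \<epsilon>"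
    note sm = second_moment_integral[OF fin, of "restricted_error t \<epsilon>", OF _ _ restricted_error_variance_le[OF \<epsilon> t]]
    have m: "(\<lambda>(z, \<omega>). restricted_error t \<epsilon> z \<omega>) \<in> borel_measurable ((Q \<Otimes>\<^sub>M Q) \<Otimes>\<^sub>M M)"
      unfolding Q_def by (rule measurable_restricted_error[OF \<epsilon>])
    have i: "integrable M (\<lambda>\<omega>. (restricted_error t \<epsilon> z \<omega>)\<^sup>2)" for z
      unfolding power2_eq_square by (rule restricted_error_covariance(1)[OF \<epsilon>])
    note sm = sm[OF m i]
    show "integrable M (\<lambda>\<omega>. (LINT z|(Icc_square t). restricted_error t \<epsilon> z \<omega>)\<^sup>2)"
      using sm(1) by (simp add: Q_def)
    have "\<epsilon> powr (5 - 4/p) * expectation (\<lambda>\<omega>. (LINT z|(Q \<Otimes>\<^sub>M Q). restricted_error t \<epsilon> z \<omega>)\<^sup>2)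
      = (LINT w|((Q \<Otimes>\<^sub>M Q) \<Otimes>\<^sub>M (Q \<Otimes>\<^sub>M Q)). \<epsilon> powr (5 - 4/p) * expectation (\<lambda>\<omega>. restricted_error t \<epsilon> (fst w) \<omega> * restricted_error t \<epsilon> (snd w) \<omega>))"
      unfolding sm(3) by simp
    also have "\<dots> \<le> (LINT w|((Q \<Otimes>\<^sub>M Q) \<Otimes>\<^sub>M (Q \<Otimes>\<^sub>M Q)). (C' * \<epsilon> powr \<gamma>) * S w)"
    proof (rule integral_mono_AE)
      show "AE w in (Q \<Otimes>\<^sub>M Q) \<Otimes>\<^sub>M (Q \<Otimes>\<^sub>M Q). \<epsilon> powr (5 - 4/p) * expectation (\<lambda>\<omega>. restricted_error t \<epsilon> (fst w) \<omega> * restricted_error t \<epsilon> (snd w) \<omega>)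
          \<le> (C' * \<epsilon> powr \<gamma>) * S w"
        using AE_Icc_measure_distinct4[of t, folded Q_def]
      proof eventually_elim
        case (elim w)
        show ?case
        proof (cases "in_triangle t (fst w) \<and> in_triangle t (snd w)")
          case True
          have "\<epsilon> powr (5 - 4/p) * chaos_remainder \<epsilon> ((fst (fst w) - snd (fst w)) powr p) ((fst (snd w) - snd (snd w)) powr p)
              (fbm_incr_cov p (snd (fst w)) (fst (fst w)) (snd (snd w)) (fst (snd w))) \<le> C * (\<epsilon> powr \<gamma> * S w)"
            unfolding \<gamma>_def S_def using elim True by (intro bound[OF \<epsilon>]) auto
          then have "(2 * pi) powr (-3) * (\<epsilon> powr (5 - 4/p) * chaos_remainder \<epsilon> ((fst (fst w) - snd (fst w)) powr p) ((fst (snd w) - snd (snd w)) powr p)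
              (fbm_incr_cov p (snd (fst w)) (fst (fst w)) (snd (snd w)) (fst (snd w)))) \<le> (2 * pi) powr (-3) * (C * (\<epsilon> powr \<gamma> * S w))"
            by (intro mult_left_mono) auto
          then show ?thesis
            unfolding restricted_error_covariance(2)[OF \<epsilon>] C'_def using True by (simp add: mult_ac)
        next
          case False
          then show ?thesis
            unfolding restricted_error_covariance(2)[OF \<epsilon>] using C' S0 by auto
        qed
      qed
    qed (use sm(2) S in auto)
    also have "\<dots> = C' * integral\<^sup>L ((Q \<Otimes>\<^sub>M Q) \<Otimes>\<^sub>M (Q \<Otimes>\<^sub>M Q)) S * \<epsilon> powr \<gamma>" by simp
    finally show "\<epsilon> powr (5 - 4/p) * expectation (\<lambda>\<omega>. (LINT z|(Icc_square t). restricted_error t \<epsilon> z \<omega>)\<^sup>2) \<le> C' * integral\<^sup>L ((Q \<Otimes>\<^sub>M Q) \<Otimes>\<^sub>M (Q \<Otimes>\<^sub>M Q)) S * \<epsilon> powr \<gamma>"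
      by (simp add: Q_def)
  qed
qed

end

section \<open>The pathwise limit of the first chaos\<close>

text \<open>Connects the product measure used for the second moment with the iterated integral in
  the definition of the functional.\<close>

lemma triangle_integral:
  fixes g :: "real \<Rightarrow> real \<Rightarrow> real"
  assumes [measurable]: "(\<lambda>z. g (fst z) (snd z)) \<in> borel_measurable (borel \<Otimes>\<^sub>M borel)"
    and K: "\<And>r s. 0 \<le> r \<Longrightarrow> r \<le> s \<Longrightarrow> s \<le> t \<Longrightarrow> \<bar>g s r\<bar> \<le> K"
  defines "Q \<equiv> Icc_measure t"
  defines "h \<equiv> \<lambda>z. if in_triangle t z then g (fst z) (snd z) else 0"
  shows "integrable (Q \<Otimes>\<^sub>M Q) h"
    and "(LINT z|(Q \<Otimes>\<^sub>M Q). h z) = (LINT s:{0..t}|lborel. LINT r:{0..s}|lborel. g s r)" (is ?goal1)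
proof -
  interpret Q: finite_measure Q unfolding Q_def by (rule finite_Icc_measure)
  interpret QQ: pair_sigma_finite Q Q ..
  interpret QQf: finite_measure "Q \<Otimes>\<^sub>M Q" by (rule finite_measure_pair_measure) unfold_locales
  have Qm[measurable_cong]: "sets Q = sets borel" by (simp add: Q_def)
  have hm [measurable]: "h \<in> borel_measurable (borel \<Otimes>\<^sub>M borel)" unfolding h_def by measurable
  show i: "integrable (Q \<Otimes>\<^sub>M Q) h"
  proof (rule QQf.integrable_const_bound[where B="max K 0"])
    show "AE z in Q \<Otimes>\<^sub>M Q. norm (h z) \<le> max K 0"
      using K by (intro AE_I2) (auto simp: h_def le_max_iff_disj)
  qed measurable
  have Qint: "(LINT x|Q. f x) = (LINT x|lborel. indicator {0..t} x * f x)" if "f \<in> borel_measurable borel" for f :: "real \<Rightarrow> real"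
    using that unfolding Q_def Icc_measure_def by (subst integral_density) auto
  have m2: "(\<lambda>s. LINT r|Q. h (s, r)) \<in> borel_measurable borel" by measurable
  have "(LINT z|(Q \<Otimes>\<^sub>M Q). h z) = (LINT s|Q. LINT r|Q. h (s, r))"
    using QQ.integral_fst'[OF i] by simp
  also have "\<dots> = (LINT s|lborel. indicator {0..t} s * (LINT r|lborel. indicator {0..t} r * h (s, r)))"
    by (subst Qint[OF m2], subst Qint) simp_all
  also have "\<dots> = (LINT s|lborel. indicator {0..t} s * (LINT r|lborel. indicator {0..s} r * g s r))"
  proof (rule Bochner_Integration.integral_cong[OF refl])
    fix s
    have "(indicator {0..t} r * h (s, r)) = indicator {0..s} r * g s r" if "s \<in> {0..t}" for r
      using that by (auto simp: h_def indicator_def)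
    then show "indicator {0..t} s * (LINT r|lborel. indicator {0..t} r * h (s, r)) = indicator {0..t} s * (LINT r|lborel. indicator {0..s} r * g s r)"
      by (cases "s \<in> {0..t}") auto
  qed
  finally show ?goal1
    by (simp add: set_lebesgue_integral_def)
qed

text \<open>With an antiderivative \<open>F\<close>, the integral of the increments telescopes to
  \<open>(F t - F (t - u)) - (F u - F 0)\<close>. Divided by \<open>u\<close> this is a difference
  of two difference quotients, so only the boundary values of \<open>f\<close> survive.\<close>

lemma increment_average:
  fixes f :: "real \<Rightarrow> real"
  assumes f: "continuous_on UNIV f" and t: "0 < t"
  defines "q \<equiv> \<lambda>u. LINT s:{u..t}|lborel. f s - f (s - u)"
  obtains M where "0 \<le> M" "\<And>s. s \<in> {0..t} \<Longrightarrow> \<bar>f s\<bar> \<le> M" "\<And>u. 0 < u \<Longrightarrow> u \<le> t \<Longrightarrow> \<bar>q u / u\<bar> \<le> 2 * M"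
    "((\<lambda>u. q u / u) \<longlongrightarrow> f t - f 0) (at_right 0)"
proof -
  have "compact (f ` {0..t})" by (intro compact_continuous_image continuous_on_subset[OF f]) auto
  then have "bounded (f ` {0..t})" by (rule compact_imp_bounded)
  then obtain M where "\<forall>x\<in>f ` {0..t}. norm x \<le> M" unfolding bounded_iff by blast
  then have M: "\<bar>f s\<bar> \<le> M" if "s \<in> {0..t}" for s using that by auto
  have M0: "0 \<le> M" using M[of 0] t by auto
  \<comment> \<open>The interval is enlarged on both sides so that the derivatives at
    \<open>0\<close> and \<open>t\<close> are two-sided.\<close>
  obtain F where F0: "\<And>x. x \<in> {-1..t+1} \<Longrightarrow> (F has_vector_derivative f x) (at x within {-1..t+1})"
    using antiderivative_continuous[of "-1" "t+1" f] continuous_on_subset[OF f] by blast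
  have F: "(F has_real_derivative f x) (at x)" if "x \<in> {0..t}" for x
    using F0[of x] that by (simp add: has_real_derivative_iff_has_vector_derivative at_within_Icc_at)
  have q: "q u = (F t - F (t - u)) - (F u - F 0)" if u: "0 < u" "u \<le> t" for u
  proof -
    have "(LINT s|lborel. indicator {u..t} s *\<^sub>R (f s - f (s - u))) = (F t - F (t - u)) - (F u - F (u - u))"
    proof (rule integral_FTC_atLeastAtMost)
      fix x assume x: "u \<le> x" "x \<le> t"
      have "((\<lambda>s. F s - F (s - u)) has_real_derivative f x - f (x - u) * 1) (at x)"
        using x u by (intro derivative_intros F DERIV_chain2[where f=F and g="\<lambda>s. s - u"]) (auto intro!: derivative_eq_intros)
      then show "((\<lambda>s. F s - F (s - u)) has_vector_derivative f x - f (x - u)) (at x within {u..t})"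
        by (auto simp: has_real_derivative_iff_has_vector_derivative intro: has_vector_derivative_at_within)
    next
      show "continuous_on {u..t} (\<lambda>s. f s - f (s - u))"
        by (intro continuous_intros continuous_on_compose2[OF f] continuous_on_subset[OF f]) auto
    qed (use u in auto)
    then show ?thesis by (simp add: q_def set_lebesgue_integral_def)
  qed
  have mvt: "\<bar>F b - F a\<bar> \<le> (b - a) * M" if ab: "0 \<le> a" "a < b" "b \<le> t" for a b
  proof -
    obtain z where z: "a < z" "z < b" "F b - F a = (b - a) * f z"
      using MVT2[of a b F f] F ab by auto
    then show ?thesis using M[of z] ab by (auto simp: abs_mult intro!: mult_left_mono)
  qed
  show thesis
  proof (rule that[OF M0 M])
    show "\<bar>q u / u\<bar> \<le> 2 * M" if u: "0 < u" "u \<le> t" for u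
    proof -
      have "\<bar>F t - F (t - u)\<bar> \<le> u * M" "\<bar>F u - F 0\<bar> \<le> u * M"
        using mvt[of "t - u" t] mvt[of 0 u] u by auto
      then have "\<bar>q u\<bar> \<le> u * M + u * M" unfolding q[OF u] by linarith
      then show ?thesis using u by (simp add: field_simps)
    qed
    have A: "((\<lambda>u. (F (0 + u) - F 0) / u) \<longlongrightarrow> f 0) (at_right 0)"
      using F[of 0] t unfolding DERIV_def by (auto intro: tendsto_mono[OF at_le] )
    have "((\<lambda>h. (F (t + h) - F t) / h) \<longlongrightarrow> f t) (at 0)" using F[of t] t unfolding DERIV_def by auto
    moreover have "filterlim (\<lambda>u::real. - u) (at 0) (at_right 0)"
      by (auto simp: filterlim_at eventually_at_filter intro!: tendsto_eq_intros)
    ultimately have B: "((\<lambda>u. (F (t + - u) - F t) / (- u)) \<longlongrightarrow> f t) (at_right 0)"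
      by (rule filterlim_compose)
    have "((\<lambda>u. (F (t + - u) - F t) / (- u) - (F (0 + u) - F 0) / u) \<longlongrightarrow> f t - f 0) (at_right 0)"
      by (intro tendsto_diff A B)
    moreover have "\<forall>\<^sub>F u in at_right 0. (F (t + - u) - F t) / (- u) - (F (0 + u) - F 0) / u = q u / u"
      using eventually_at_right_real[OF t]
    proof eventually_elim
      case (elim u)
      then show ?case by (simp add: q diff_divide_distrib)
    qed
    ultimately show "((\<lambda>u. q u / u) \<longlongrightarrow> f t - f 0) (at_right 0)"
      by (rule Lim_transform_eventually)
  qed
qed

text \<open>The substitution \<open>u = s - r\<close> followed by Fubini isolates the lag
  \<open>u\<close>, on which alone the kernel depends.\<close>

lemma triangle_integral_increments:
  fixes f k :: "real \<Rightarrow> real"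
  assumes f: "continuous_on UNIV f" and t: "0 < t" and k [measurable]: "k \<in> borel_measurable borel"
    and kb: "\<And>u. \<bar>k u\<bar> \<le> K"
  shows "(LINT s:{0..t}|lborel. LINT r:{0..s}|lborel. k (s - r) * (f s - f r)) =
    (LINT u|lborel. indicator {0..t} u * (k u * (LINT s:{u..t}|lborel. f s - f (s - u))))"
proof -
  have [measurable]: "f \<in> borel_measurable borel" by (rule borel_measurable_continuous_onI[OF f])
  obtain M where M: "0 \<le> M" "\<And>s. s \<in> {0..t} \<Longrightarrow> \<bar>f s\<bar> \<le> M" by (rule increment_average[OF f t]) blast
  have K0: "0 \<le> K" using kb[of 0] by auto
  define h where "h = (\<lambda>s u. if 0 \<le> u \<and> u \<le> s \<and> s \<le> t then k u * (f s - f (s - u)) else 0)"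
  have i: "integrable (lborel \<Otimes>\<^sub>M lborel) (\<lambda>(s, u). h s u)"
  proof (rule Bochner_Integration.integrable_bound)
    have 0: "integrable lborel (\<lambda>x. K * (2 * M) * indicator {0..t} x)" "integrable lborel (indicat_real {0..t})"
      by (auto intro!: integrable_mult_right integrable_real_indicator simp: emeasure_lborel_Icc_eq)
    show "integrable (lborel \<Otimes>\<^sub>M lborel) (\<lambda>z. (K * (2 * M) * indicator {0..t} (fst z)) * indicat_real {0..t} (snd z))"
      by (rule lborel_pair.integral_product_mult(1)[OF 0])
    show "AE z in lborel \<Otimes>\<^sub>M lborel. norm (case z of (s, u) \<Rightarrow> h s u) \<le> norm ((K * (2 * M) * indicator {0..t} (fst z)) * indicat_real {0..t} (snd z))"
    proof (intro AE_I2)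
      fix z :: "real \<times> real"
      have "\<bar>k u * (f s - f (s - u))\<bar> \<le> K * (2 * M)" if "0 \<le> u" "u \<le> s" "s \<le> t" for s u
        using kb[of u] M(2)[of s] M(2)[of "s - u"] that K0 by (auto simp: abs_mult intro!: mult_mono)
      then show "norm (case z of (s, u) \<Rightarrow> h s u) \<le> norm ((K * (2 * M) * indicator {0..t} (fst z)) * indicat_real {0..t} (snd z))"
        using K0 M by (auto simp: h_def indicator_def split: prod.splits)
    qed
  qed (simp add: h_def)
  have "(LINT s:{0..t}|lborel. LINT r:{0..s}|lborel. k (s - r) * (f s - f r)) = (LINT s|lborel. LINT u|lborel. h s u)"
    unfolding set_lebesgue_integral_def
  proof (rule Bochner_Integration.integral_cong[OF refl])
    fix s
    have "(LINT r|lborel. indicator {0..s} r *\<^sub>R (k (s - r) * (f s - f r))) = (LINT u|lborel. indicator {0..s} (s - u) *\<^sub>R (k (s - (s - u)) * (f s - f (s - u))))"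
      by (subst lborel_integral_real_affine[of "-1" _ s]) auto
    moreover have "indicator {0..t} s * (indicator {0..s} (s - u) *\<^sub>R (k (s - (s - u)) * (f s - f (s - u)))) = h s u" for u
      by (auto simp: h_def indicator_def)
    ultimately show "indicator {0..t} s *\<^sub>R (LINT r|lborel. indicator {0..s} r *\<^sub>R (k (s - r) * (f s - f r))) = (LINT u|lborel. h s u)"
      by (simp only: real_scaleR_def integral_mult_right_zero[symmetric])
  qed
  also have "\<dots> = (LINT u|lborel. LINT s|lborel. h s u)"
    using lborel_pair.Fubini_integral[OF i] by simp
  also have "\<dots> = (LINT u|lborel. indicator {0..t} u * (k u * (LINT s:{u..t}|lborel. f s - f (s - u))))"
  proof (rule Bochner_Integration.integral_cong[OF refl])
    fix u
    have "h s u = indicator {0..t} u * (k u * (indicator {u..t} s *\<^sub>R (f s - f (s - u))))" for s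
      by (auto simp: h_def indicator_def)
    then show "(LINT s|lborel. h s u) = indicator {0..t} u * (k u * (LINT s:{u..t}|lborel. f s - f (s - u)))"
      by (simp add: set_lebesgue_integral_def)
  qed
  finally show ?thesis .
qed

text \<open>\<open>w\<close> is the rescaled product of the lag with the projected kernel. It
  behaves like \<open>x powr (1 - 5 * p / 2)\<close> at infinity, hence is integrable for
  \<open>p > 1\<close>.\<close>

lemma Beta_improper_integral:
  fixes p :: real
  assumes p: "1 < p"
  defines "w \<equiv> \<lambda>x::real. x * (1 + x powr p) powr (-(5/2))"
  shows "integrable lborel (\<lambda>x. indicator {0<..} x * w x)"
    and "(LINT x|lborel. indicator {0<..} x * w x) = Beta (2/p) (5/2 - 2/p) / p" (is ?goal1)
proof -
  \<comment> \<open>the substitution \<open>y = x powr p / (1 + x powr p)\<close>\<close>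
  define g where "g = (\<lambda>y::real. (y / (1 - y)) powr (1/p))"
  define g' where "g' = (\<lambda>y::real. (1/p) * y powr (1/p - 1) * (1 - y) powr (-1/p - 1))"
  define \<beta> where "\<beta> = (\<lambda>y::real. y powr (2/p - 1) * (1 - y) powr (5/2 - 2/p - 1))"
  have pos: "0 < 2/p" "0 < 5/2 - 2/p" using p by (auto simp: field_simps)
  have fg: "w (g y) * g' y = \<beta> y / p" if y: "0 < y" "y < 1" for y
  proof -
    have "g y powr p = y / (1 - y)" using y p by (simp add: g_def powr_powr)
    then have "1 + g y powr p = (1 - y) powr (-1)" using y by (simp add: powr_minus_divide field_simps)
    then have "(1 + g y powr p) powr (-(5/2)) = (1 - y) powr (5/2)" by (simp only: powr_powr) simp
    moreover have "g y = y powr (1/p) * (1 - y) powr (-(1/p))" using y by (simp add: g_def powr_divide powr_minus_divide)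
    ultimately have "w (g y) * g' y = (1/p) * ((y powr (1/p) * y powr (1/p - 1)) * ((1 - y) powr (-(1/p)) * (1 - y) powr (5/2) * (1 - y) powr (-1/p - 1)))"
      by (simp add: w_def g'_def)
    also have "\<dots> = (1/p) * (y powr (1/p + (1/p - 1)) * (1 - y) powr (-(1/p) + 5/2 + (-1/p - 1)))"
      by (simp only: powr_add)
    also have "1/p + (1/p - 1) = 2/p - 1" by simp
    also have "-(1/p) + 5/2 + (-1/p - 1) = 5/2 - 2/p - 1" by simp
    finally show ?thesis by (simp add: \<beta>_def)
  qed
  have int\<beta>: "set_integrable lborel {0..1} \<beta>" unfolding \<beta>_def by (rule integrable_Beta[OF pos])
  have einter: "einterval 0 1 = {0<..<1}" "einterval 0 \<infinity> = {0<..}"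
    by (auto simp: einterval_def zero_ereal_def one_ereal_def)
  have intfg: "set_integrable lborel (einterval 0 1) (\<lambda>x. w (g x) * g' x)"
  proof -
    have "set_integrable lborel {0<..<1} (\<lambda>x. \<beta> x / p)"
    proof -
      have "set_integrable lborel {0<..<1} \<beta>"
        by (rule set_integrable_subset[OF int\<beta>]) auto
      then have "integrable lborel (\<lambda>x. (indicator {0<..<1} x *\<^sub>R \<beta> x) * (1/p))"
        unfolding set_integrable_def by (rule integrable_mult_left)
      then show ?thesis by (simp add: set_integrable_def)
    qed
    moreover have "set_integrable lborel {0<..<1} (\<lambda>x. w (g x) * g' x) \<longleftrightarrow> set_integrable lborel {0<..<1} (\<lambda>x. \<beta> x / p)"
      by (rule set_integrable_cong) (auto simp: fg)
    ultimately show ?thesis unfolding einter by simp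
  qed
  have lim1: "(g \<longlongrightarrow> 0) (at_right 0)"
  proof -
    have "((\<lambda>y::real. (y / (1 - y)) powr (1/p)) \<longlongrightarrow> (0 / (1 - 0)) powr (1/p)) (at_right 0)"
    proof (rule tendsto_powr2)
      show "\<forall>\<^sub>F x in at_right 0. 0 \<le> x / (1 - x :: real)"
        using eventually_at_right_real[OF zero_less_one] by eventually_elim auto
    qed (use p in \<open>auto intro!: tendsto_eq_intros\<close>)
    then show ?thesis using p by (simp add: g_def)
  qed
  have lim2: "filterlim g at_top (at_left 1)"
  proof -
    have "filterlim (\<lambda>y::real. inverse (1 - y)) at_top (at_left 1)"
      by (rule filterlim_inverse_at_top) (auto intro!: tendsto_eq_intros simp: eventually_at_filter)
    then have 1: "filterlim (\<lambda>y::real. y * inverse (1 - y)) at_top (at_left 1)"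
      by (rule filterlim_tendsto_pos_mult_at_top[rotated 2]) (auto intro: tendsto_ident_at)
    have "filterlim (\<lambda>x::real. exp (1/p * ln x)) at_top at_top"
      using p by (intro filterlim_compose[OF exp_at_top] filterlim_tendsto_pos_mult_at_top[OF tendsto_const _ ln_at_top]) auto
    then have "filterlim (\<lambda>y::real. exp (1/p * ln (y * inverse (1 - y)))) at_top (at_left 1)"
      by (rule filterlim_compose[OF _ 1])
    moreover have "\<forall>\<^sub>F y in at_left 1. exp (1/p * ln (y * inverse (1 - y))) = g y"
      using eventually_at_left_real[OF zero_less_one] by (auto simp: g_def powr_def divide_inverse elim!: eventually_mono)
    ultimately show ?thesis by (simp add: filterlim_cong[OF refl refl])
  qed
  have gpos: "0 < g x" if "0 < ereal x" "ereal x < 1" for x using that by (simp add: g_def)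
  have d: "(g has_real_derivative g' x) (at x)" if x: "0 < ereal x" "ereal x < 1" for x
  proof -
    have x': "0 < x" "x < 1" using x by auto
    have "(g has_real_derivative (1/p) * (x / (1 - x)) powr (1/p - 1) * (1 / (1 - x)^2)) (at x)"
      unfolding g_def using x' by (auto intro!: derivative_eq_intros simp: field_simps power2_eq_square)
    moreover have "(1/p) * (x / (1 - x)) powr (1/p - 1) * (1 / (1 - x)^2) = g' x"
    proof -
      have "(x / (1 - x)) powr (1/p - 1) = x powr (1/p - 1) * (1 - x) powr (-(1/p - 1))"
        unfolding powr_minus_divide using x' by (simp add: powr_divide)
      moreover have "1 / (1 - x)^2 = (1 - x) powr (-2)"
        using x' by (simp add: powr_minus_divide powr_numeral)
      ultimately have "(x / (1 - x)) powr (1/p - 1) * (1 / (1 - x)^2) = x powr (1/p - 1) * ((1 - x) powr (-(1/p - 1)) * (1 - x) powr (-2))"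
        by (simp only: mult.assoc)
      also have "(1 - x) powr (-(1/p - 1)) * (1 - x) powr (-2) = (1 - x) powr (-1/p - 1)"
      proof -
        have "-(1/p - 1) + -2 = -1/p - 1" by simp
        then show ?thesis by (simp only: powr_add[symmetric])
      qed
      finally have E: "(x / (1 - x)) powr (1/p - 1) * (1 / (1 - x)^2) = x powr (1/p - 1) * (1 - x) powr (-1/p - 1)" .
      show ?thesis by (simp only: mult.assoc E g'_def)
    qed
    ultimately show ?thesis by simp
  qed
  have cw: "isCont w (g x)" if "0 < ereal x" "ereal x < 1" for x
    unfolding w_def using gpos[OF that]
    by (intro continuous_intros) (auto simp: add_pos_nonneg less_imp_neq[symmetric])
  have cg': "isCont g' x" if "0 < ereal x" "ereal x < 1" for x
    unfolding g'_def using that by (intro continuous_intros) auto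
  have w0: "0 \<le> w (g x)" if "0 < ereal x" "ereal x < 1" for x
    unfolding w_def using gpos[OF that] by simp
  have g'0: "0 \<le> g' x" if "0 \<le> ereal x" "ereal x \<le> 1" for x
    unfolding g'_def using p by simp
  have A: "((ereal \<circ> g \<circ> real_of_ereal) \<longlongrightarrow> 0) (at_right 0)"
    unfolding zero_ereal_def ereal_tendsto_simps by (rule lim1)
  have B: "((ereal \<circ> g \<circ> real_of_ereal) \<longlongrightarrow> \<infinity>) (at_left 1)"
    unfolding one_ereal_def ereal_tendsto_simps by (rule lim2)
  have z1: "(0::ereal) < 1" by simp
  \<comment> \<open>Nonnegativity lets the substitution yield integrability over the half line along
    with the value.\<close>
  note sub = interval_integral_substitution_nonneg[where a=0 and b=1 and g=g and g'=g' and f=w, OF z1 d cw cg' w0 g'0 A B intfg]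
  show "integrable lborel (\<lambda>x. indicator {0<..} x * w x)"
    using sub(1) by (simp add: einter set_integrable_def)
  have "(LINT x|lborel. indicator {0<..} x * w x) = (LBINT x=0..\<infinity>. w x)"
    by (simp add: interval_lebesgue_integral_def einter set_lebesgue_integral_def)
  also have "\<dots> = (LBINT x=0..1. w (g x) * g' x)" by (rule sub(2))
  also have "\<dots> = (LINT x:{0<..<1}|lborel. w (g x) * g' x)"
    by (simp add: interval_lebesgue_integral_def einter)
  also have "\<dots> = (LINT x:{0<..<1}|lborel. \<beta> x / p)"
    by (rule set_lebesgue_integral_cong) (auto simp: fg)
  also have "\<dots> = (LINT x:{0..1}|lborel. \<beta> x / p)"
    unfolding set_lebesgue_integral_def
    by (intro Bochner_Integration.integral_cong refl) (auto simp: \<beta>_def indicator_def)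
  also have "\<dots> = (LINT x:{0..1}|lborel. \<beta> x) / p" by simp
  also have "(LINT x:{0..1}|lborel. \<beta> x) = integral {0..1} \<beta>" by (rule set_borel_integral_eq_integral[OF int\<beta>])
  also have "integral {0..1} \<beta> = Beta (2/p) (5/2 - 2/p)"
    unfolding \<beta>_def by (rule integral_unique[OF has_integral_Beta_real[OF pos]])
  finally show ?goal1 .
qed

text \<open>After rescaling, the integrand is \<open>w x\<close> times an averaged increment over
  the lag \<open>\<delta> n * x\<close>. The average is bounded by \<open>2 * M\<close> and tends to
  \<open>f t - f 0\<close>, so dominated convergence applies to each path separately.\<close>

lemma first_chaos_limit:
  fixes f :: "real \<Rightarrow> real" and e :: "nat \<Rightarrow> real"
  assumes f: "continuous_on UNIV f" and t: "0 < t" and p: "1 < p"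
    and e: "\<And>n. 0 < e n" "e \<longlonglongrightarrow> 0"
  shows "(\<lambda>n. e n powr (5/2 - 2/p) * (LINT s:{0..t}|lborel. LINT r:{0..s}|lborel. (e n + \<bar>s - r\<bar> powr p) powr (-(5/2)) * (f s - f r)))
     \<longlonglongrightarrow> Beta (2/p) (5/2 - 2/p) / p * (f t - f 0)"
proof -
  define q where "q = (\<lambda>u. LINT s:{u..t}|lborel. f s - f (s - u))"
  define w where "w = (\<lambda>x::real. x * (1 + x powr p) powr (-(5/2)))"
  obtain M where M: "0 \<le> M" "\<And>u. 0 < u \<Longrightarrow> u \<le> t \<Longrightarrow> \<bar>q u / u\<bar> \<le> 2 * M"
    "((\<lambda>u. q u / u) \<longlongrightarrow> f t - f 0) (at_right 0)"
    unfolding q_def by (rule increment_average[OF f t]) blast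
  have [measurable]: "f \<in> borel_measurable borel" by (rule borel_measurable_continuous_onI[OF f])
  have [measurable]: "q \<in> borel_measurable borel"
  proof -
    have "(\<lambda>u. LINT s|lborel. (if u \<le> s \<and> s \<le> t then f s - f (s - u) else 0)) \<in> borel_measurable borel" by measurable
    moreover have "(\<lambda>u. LINT s|lborel. (if u \<le> s \<and> s \<le> t then f s - f (s - u) else 0)) = q"
      unfolding q_def set_lebesgue_integral_def by (intro ext Bochner_Integration.integral_cong refl) (auto simp: indicator_def)
    ultimately show ?thesis by simp
  qed
  define \<delta> where "\<delta> = (\<lambda>n. e n powr (1/p))"
  have \<delta>: "0 < \<delta> n" "\<delta> n powr p = e n" for n using e(1)[of n] p by (auto simp: \<delta>_def powr_powr)
  have "\<delta> \<longlonglongrightarrow> 0 powr (1/p)"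
    unfolding \<delta>_def using e p by (intro tendsto_powr2) (auto intro: less_imp_le always_eventually)
  then have \<delta>0: "\<delta> \<longlonglongrightarrow> 0" by simp
  define h where "h = (\<lambda>n x. if 0 < x \<and> \<delta> n * x \<le> t then w x * (q (\<delta> n * x) / (\<delta> n * x)) else 0)"
  have hm: "h n \<in> borel_measurable lborel" for n unfolding h_def w_def by measurable
  have "e n powr (5/2 - 2/p) * (LINT s:{0..t}|lborel. LINT r:{0..s}|lborel. (e n + \<bar>s - r\<bar> powr p) powr (-(5/2)) * (f s - f r))
      = (LINT x|lborel. h n x)" for n
  proof -
    have kb: "\<bar>(e n + \<bar>u\<bar> powr p) powr (-(5/2))\<bar> \<le> e n powr (-(5/2))" for u
      using e(1)[of n] by (auto intro!: powr_mono2')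
    have "(LINT s:{0..t}|lborel. LINT r:{0..s}|lborel. (e n + \<bar>s - r\<bar> powr p) powr (-(5/2)) * (f s - f r))
       = (LINT u|lborel. indicator {0..t} u * ((e n + \<bar>u\<bar> powr p) powr (-(5/2)) * q u))"
      unfolding q_def by (rule triangle_integral_increments[OF f t _ kb]) measurable
    also have "\<dots> = \<delta> n * (LINT x|lborel. indicator {0..t} (\<delta> n * x) * ((e n + \<bar>\<delta> n * x\<bar> powr p) powr (-(5/2)) * q (\<delta> n * x)))"
      using \<delta>(1)[of n] by (subst lborel_integral_real_affine[of "\<delta> n" _ 0]) auto
    finally have *: "e n powr (5/2 - 2/p) * (LINT s:{0..t}|lborel. LINT r:{0..s}|lborel. (e n + \<bar>s - r\<bar> powr p) powr (-(5/2)) * (f s - f r))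
       = (LINT x|lborel. (e n powr (5/2 - 2/p) * \<delta> n) * (indicator {0..t} (\<delta> n * x) * ((e n + \<bar>\<delta> n * x\<bar> powr p) powr (-(5/2)) * q (\<delta> n * x))))"
      by simp
    show ?thesis unfolding *
    proof (rule integral_cong_AE)
      show "AE x in lborel. (e n powr (5/2 - 2/p) * \<delta> n) * (indicator {0..t} (\<delta> n * x) * ((e n + \<bar>\<delta> n * x\<bar> powr p) powr (-(5/2)) * q (\<delta> n * x))) = h n x"
        using AE_lborel_singleton[of 0]
      proof eventually_elim
        case (elim x)
        show ?case
        proof (cases "0 < x \<and> \<delta> n * x \<le> t")
          case True
          have "e n + \<bar>\<delta> n * x\<bar> powr p = e n * (1 + x powr p)"
            using True \<delta>[of n] by (simp add: abs_mult powr_mult algebra_simps)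
          then have "(e n + \<bar>\<delta> n * x\<bar> powr p) powr (-(5/2)) = e n powr (-(5/2)) * (1 + x powr p) powr (-(5/2))"
            by (simp only: powr_mult)
          moreover have "e n powr (5/2 - 2/p) * \<delta> n * e n powr (-(5/2)) = 1 / \<delta> n"
          proof -
            have "e n powr (5/2 - 2/p) * \<delta> n * e n powr (-(5/2)) = e n powr (5/2 - 2/p + 1/p + -(5/2))"
              unfolding \<delta>_def by (simp only: powr_add)
            also have "5/2 - 2/p + 1/p + -(5/2) = -(1/p)" by simp
            finally show ?thesis using e(1)[of n] by (simp add: \<delta>_def powr_minus_divide)
          qed
          moreover have "indicator {0..t} (\<delta> n * x) = (1::real)" using True \<delta>(1)[of n] by simp
          ultimately have "(e n powr (5/2 - 2/p) * \<delta> n) * (indicator {0..t} (\<delta> n * x) * ((e n + \<bar>\<delta> n * x\<bar> powr p) powr (-(5/2)) * q (\<delta> n * x)))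
             = (1 / \<delta> n) * ((1 + x powr p) powr (-(5/2)) * q (\<delta> n * x))"
            by (simp only: mult_1_left mult.assoc[symmetric])
          also have "\<dots> = h n x" using True \<delta>(1)[of n] by (simp add: h_def w_def)
          finally show ?thesis .
        next
          case False
          then have "\<delta> n * x \<notin> {0..t}" using elim \<delta>(1)[of n] by (auto simp: zero_le_mult_iff)
          then have i0: "indicator {0..t} (\<delta> n * x) = (0::real)" by (rule indicator_simps(2))
          have h0: "h n x = 0" unfolding h_def by (rule if_not_P[OF False])
          show ?thesis unfolding i0 h0 by simp
        qed
      qed
      show "(\<lambda>x. (e n powr (5/2 - 2/p) * \<delta> n) * (indicator {0..t} (\<delta> n * x) * ((e n + \<bar>\<delta> n * x\<bar> powr p) powr (-(5/2)) * q (\<delta> n * x)))) \<in> borel_measurable lborel"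
        by measurable
    qed (rule hm)
  qed
  moreover have "(\<lambda>n. LINT x|lborel. h n x) \<longlonglongrightarrow> (LINT x|lborel. (indicator {0<..} x * w x) * (f t - f 0))"
  proof (rule integral_dominated_convergence[where w="\<lambda>x. (indicator {0<..} x * w x) * (2 * M)"])
    show "integrable lborel (\<lambda>x. (indicator {0<..} x * w x) * (2 * M))"
      unfolding w_def by (intro integrable_mult_left Beta_improper_integral(1)[OF p])
    show "AE x in lborel. (\<lambda>n. h n x) \<longlonglongrightarrow> (indicator {0<..} x * w x) * (f t - f 0)"
    proof (intro AE_I2)
      fix x :: real
      show "(\<lambda>n. h n x) \<longlonglongrightarrow> (indicator {0<..} x * w x) * (f t - f 0)"
      proof (cases "0 < x")
        case True
        have "(\<lambda>n. \<delta> n * x) \<longlonglongrightarrow> 0" using tendsto_mult_left_zero[OF \<delta>0] .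
        then have "filterlim (\<lambda>n. \<delta> n * x) (at_right 0) sequentially"
          using True \<delta>(1) less_imp_neq[OF \<delta>(1)] by (auto simp: filterlim_at intro!: always_eventually)
        then have "(\<lambda>n. q (\<delta> n * x) / (\<delta> n * x)) \<longlonglongrightarrow> f t - f 0"
          by (rule filterlim_compose[OF M(3)])
        then have "(\<lambda>n. w x * (q (\<delta> n * x) / (\<delta> n * x))) \<longlonglongrightarrow> w x * (f t - f 0)"
          by (intro tendsto_mult_left)
        moreover have "\<forall>\<^sub>F n in sequentially. w x * (q (\<delta> n * x) / (\<delta> n * x)) = h n x"
          using order_tendstoD(2)[OF \<open>(\<lambda>n. \<delta> n * x) \<longlonglongrightarrow> 0\<close> t] True by (auto simp: h_def elim: eventually_mono)
        ultimately show ?thesis using True by (simp add: Lim_transform_eventually)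
      qed (simp add: h_def)
    qed
    show "AE x in lborel. norm (h n x) \<le> (indicator {0<..} x * w x) * (2 * M)" for n
    proof (intro AE_I2)
      fix x :: real
      show "norm (h n x) \<le> (indicator {0<..} x * w x) * (2 * M)"
      proof (cases "0 < x \<and> \<delta> n * x \<le> t")
        case True
        have "norm (h n x) = w x * \<bar>q (\<delta> n * x) / (\<delta> n * x)\<bar>"
          using True by (simp add: h_def abs_mult w_def)
        also have "\<dots> \<le> w x * (2 * M)"
          using True \<delta>(1)[of n] by (intro mult_left_mono M(2)) (auto simp: w_def)
        finally show ?thesis using True by simp
      next
        case False
        then show ?thesis using M(1) by (auto simp: h_def w_def indicator_def)
      qed
    qed
    show "(\<lambda>x. (indicator {0<..} x * w x) * (f t - f 0)) \<in> borel_measurable lborel" unfolding w_def by measurable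
  qed (rule hm)
  ultimately show ?thesis
    using Beta_improper_integral(2)[OF p] by (simp add: w_def)
qed

section \<open>Convergence in distribution\<close>

text \<open>Preimages under \<open>f\<close> and \<open>g\<close> differ only inside a null set, all
  of whose subsets are measurable in the completion.\<close>

lemma borel_measurable_completion_cong_AE:
  fixes f g :: "'a \<Rightarrow> real"
  assumes f: "f \<in> borel_measurable M" and eq: "AE x in M. f x = g x"
  shows "g \<in> borel_measurable (completion M)"
proof (rule measurableI)
  obtain N where N: "{x \<in> space M. f x \<noteq> g x} \<subseteq> N" "emeasure M N = 0" "N \<in> sets M"
    using eq by (rule AE_E)
  then have null: "D \<in> sets (completion M)" if "D \<subseteq> N" for D
    using that null_sets_completion_iff2[of D M] by (auto simp: null_sets_def)
  fix A :: "real set" assume A: "A \<in> sets borel"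
  have "g -` A \<inter> space M = ((f -` A \<inter> space M) - {x \<in> space M. f x \<noteq> g x}) \<union> (g -` A \<inter> {x \<in> space M. f x \<noteq> g x})"
    by auto
  moreover have "f -` A \<inter> space M \<in> sets (completion M)" using measurable_sets[OF f A] by simp
  ultimately show "g -` A \<inter> space (completion M) \<in> sets (completion M)"
    using null[OF N(1)] null[of "g -` A \<inter> {x \<in> space M. f x \<noteq> g x}"] N(1) by auto
qed simp

lemma cts_step_Lipschitz:
  assumes "x < y"
  shows "\<bar>cts_step x y a - cts_step x y b\<bar> \<le> \<bar>a - b\<bar> / (y - x)"
proof -
  \<comment> \<open>Clamping to the unit interval does not increase distances, so the slope of the
    affine part is the Lipschitz constant.\<close>
  have *: "cts_step x y a = min 1 (max 0 ((y - a) / (y - x)))" for a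
    using assms by (auto simp: cts_step_def min_def max_def divide_simps)
  have "\<bar>cts_step x y a - cts_step x y b\<bar> \<le> \<bar>(y - a) / (y - x) - (y - b) / (y - x)\<bar>"
    unfolding * by linarith
  also have "\<dots> = \<bar>a - b\<bar> / (y - x)"
    using assms by (simp add: diff_divide_distrib[symmetric] abs_minus_commute)
  finally show ?thesis .
qed

text \<open>A Slutsky argument: Lipschitz step functions determine weak convergence, and their
  expectations change by at most a multiple of the distance in mean square.\<close>

lemma (in prob_space) weak_conv_if_L2_close:
  fixes Y Z :: "nat \<Rightarrow> 'a \<Rightarrow> real"
  assumes Y [measurable]: "\<And>n. Y n \<in> borel_measurable M" and Z [measurable]: "\<And>n. Z n \<in> borel_measurable M"
    and W [measurable]: "W \<in> borel_measurable M"
    and i: "\<And>n. integrable M (\<lambda>\<omega>. (Y n \<omega> - Z n \<omega>)\<^sup>2)"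
    and L2: "(\<lambda>n. expectation (\<lambda>\<omega>. (Y n \<omega> - Z n \<omega>)\<^sup>2)) \<longlonglongrightarrow> 0"
    and lim: "AE \<omega> in M. (\<lambda>n. Z n \<omega>) \<longlonglongrightarrow> W \<omega>"
  shows "weak_conv_m (\<lambda>n. distr M borel (Y n)) (distr M borel W)"
proof (rule integral_cts_step_conv_imp_weak_conv)
  fix x y :: real assume xy: "x < y"
  have cont: "isCont (cts_step x y) z" for z
    using uniformly_continuous_imp_continuous[OF cts_step_uniformly_continuous[OF xy]] by (simp add: continuous_on_eq_continuous_at)
  have cm [measurable]: "cts_step x y \<in> borel_measurable borel"
    using cont by (intro borel_measurable_continuous_onI continuous_at_imp_continuous_on) auto
  have cb: "\<bar>cts_step x y z\<bar> \<le> 1" for z using xy by (auto simp: cts_step_def)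
  have ic: "integrable M (\<lambda>\<omega>. cts_step x y (V \<omega>))" if [measurable]: "V \<in> borel_measurable M" for V
    by (rule integrable_const_bound[where B=1]) (use cb in auto)
  have "(\<lambda>n. expectation (\<lambda>\<omega>. cts_step x y (Z n \<omega>))) \<longlonglongrightarrow> expectation (\<lambda>\<omega>. cts_step x y (W \<omega>))"
  proof (rule integral_dominated_convergence[where w="\<lambda>_. 1"])
    show "AE \<omega> in M. (\<lambda>n. cts_step x y (Z n \<omega>)) \<longlonglongrightarrow> cts_step x y (W \<omega>)"
      using lim by eventually_elim (rule isCont_tendsto_compose[OF cont])
  qed (use cb in auto)
  moreover have "(\<lambda>n. expectation (\<lambda>\<omega>. cts_step x y (Y n \<omega>)) - expectation (\<lambda>\<omega>. cts_step x y (Z n \<omega>))) \<longlonglongrightarrow> 0"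
  proof (rule Lim_null_comparison)
    show "\<forall>\<^sub>F n in sequentially. norm (expectation (\<lambda>\<omega>. cts_step x y (Y n \<omega>)) - expectation (\<lambda>\<omega>. cts_step x y (Z n \<omega>)))
        \<le> sqrt (expectation (\<lambda>\<omega>. (Y n \<omega> - Z n \<omega>)\<^sup>2)) / (y - x)"
    proof (intro always_eventually allI)
      fix n
      let ?D = "\<lambda>\<omega>. \<bar>Y n \<omega> - Z n \<omega>\<bar>"
      have iD: "integrable M ?D"
        using square_integrable_imp_integrable[of "\<lambda>\<omega>. Y n \<omega> - Z n \<omega>"] i by auto
      \<comment> \<open>Nonnegativity of this variance is the bound of the first moment by the root
        of the second.\<close>
      have "0 \<le> variance ?D" by (rule variance_positive)
      also have "\<dots> = expectation (\<lambda>\<omega>. (Y n \<omega> - Z n \<omega>)\<^sup>2) - (expectation ?D)\<^sup>2"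
        using variance_eq[OF iD] i by simp
      finally have ED: "expectation ?D \<le> sqrt (expectation (\<lambda>\<omega>. (Y n \<omega> - Z n \<omega>)\<^sup>2))"
        by (intro real_le_rsqrt) simp
      have "norm (expectation (\<lambda>\<omega>. cts_step x y (Y n \<omega>)) - expectation (\<lambda>\<omega>. cts_step x y (Z n \<omega>)))
          = norm (expectation (\<lambda>\<omega>. cts_step x y (Y n \<omega>) - cts_step x y (Z n \<omega>)))"
        by (simp add: ic)
      also have "\<dots> \<le> expectation (\<lambda>\<omega>. norm (cts_step x y (Y n \<omega>) - cts_step x y (Z n \<omega>)))"
        by (rule integral_norm_bound)
      also have "\<dots> \<le> expectation (\<lambda>\<omega>. ?D \<omega> / (y - x))"
        using iD by (intro integral_mono integrable_norm Bochner_Integration.integrable_diff ic)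
          (auto intro: cts_step_Lipschitz[OF xy])
      also have "\<dots> \<le> sqrt (expectation (\<lambda>\<omega>. (Y n \<omega> - Z n \<omega>)\<^sup>2)) / (y - x)"
        using ED xy by (simp add: divide_right_mono)
      finally show "norm (expectation (\<lambda>\<omega>. cts_step x y (Y n \<omega>)) - expectation (\<lambda>\<omega>. cts_step x y (Z n \<omega>)))
        \<le> sqrt (expectation (\<lambda>\<omega>. (Y n \<omega> - Z n \<omega>)\<^sup>2)) / (y - x)" .
    qed
    show "(\<lambda>n. sqrt (expectation (\<lambda>\<omega>. (Y n \<omega> - Z n \<omega>)\<^sup>2)) / (y - x)) \<longlonglongrightarrow> 0"
      using tendsto_divide[OF tendsto_real_sqrt[OF L2] tendsto_const, of "y - x"] xy by simp
  qed
  ultimately have "(\<lambda>n. expectation (\<lambda>\<omega>. cts_step x y (Y n \<omega>))) \<longlonglongrightarrow> expectation (\<lambda>\<omega>. cts_step x y (W \<omega>))"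
    using tendsto_add by fastforce
  then show "(\<lambda>n. integral\<^sup>L (distr M borel (Y n)) (cts_step x y)) \<longlonglongrightarrow> integral\<^sup>L (distr M borel W) (cts_step x y)"
    by (simp add: integral_distr)
qed auto

section \<open>Splitting the functional into first chaos and error, and the weak limit\<close>

context fbm3
begin

definition first_chaos :: "real \<Rightarrow> real \<Rightarrow> 'a \<Rightarrow> real" where
  "first_chaos t \<epsilon> \<omega> = - ((2 * pi) powr (-(3/2)) *
     (LINT s:{0..t}|lborel. LINT r:{0..s}|lborel. (\<epsilon> + \<bar>s - r\<bar> powr p) powr (-(5/2)) * (X s \<omega> $ 1 - X r \<omega> $ 1)))"

definition error_integral :: "real \<Rightarrow> real \<Rightarrow> 'a \<Rightarrow> real" where
  "error_integral t \<epsilon> \<omega> = (LINT z|(Icc_square t). restricted_error t \<epsilon> z \<omega>)"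

lemma abs_partial_deriv_heat_kernel_le:
  assumes "0 < \<epsilon>"
  shows "\<bar>partial_deriv 1 (heat_kernel \<epsilon> :: real ^ 3 \<Rightarrow> real) x\<bar> \<le> (2 * pi) powr (-(3/2)) * \<epsilon> powr (-2)"
proof -
  define V where "V = x $ 1 / sqrt \<epsilon> * bell (x $ 1 / sqrt \<epsilon>) * (bell (x $ 2 / sqrt \<epsilon>) * bell (x $ 3 / sqrt \<epsilon>))"
  define c where "c = (2 * pi) powr (-(3/2)) * \<epsilon> powr (-2)"
  have "\<bar>V\<bar> \<le> 1 * (1 * 1)"
    unfolding V_def abs_mult[of "_ * exp _" "_ * _"] abs_mult[of "exp _" "exp _"]
    by (intro mult_mono abs_mult_exp_neg_square_le) auto
  then have "c * \<bar>V\<bar> \<le> c" by (intro mult_left_le) (auto simp: c_def)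
  then show ?thesis
    unfolding partial_deriv_heat_kernel[OF assms] V_def[symmetric] c_def[symmetric] by (simp add: abs_mult c_def)
qed

lemma gradient_X_triangle:
  assumes \<epsilon>: "0 < \<epsilon>"
  defines "g \<equiv> \<lambda>\<omega> s r. partial_deriv 1 (heat_kernel \<epsilon>) (X s \<omega> - X r \<omega>)"
  shows "integrable (Icc_square t) (\<lambda>z. if in_triangle t z then g \<omega> (fst z) (snd z) else 0)" (is ?goal1)
    and "(LINT z|(Icc_square t). (if in_triangle t z then g \<omega> (fst z) (snd z) else 0)) = alpha_hat 1 X t \<epsilon> \<omega>" (is ?goal2)
proof -
  have [measurable]: "(\<lambda>\<tau>. X \<tau> \<omega>) \<in> borel_measurable borel"
    by (rule borel_measurable_continuous_onI[OF continuous_X])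
  note [measurable] = measurable_partial_deriv_heat_kernel[OF \<epsilon>]
  have m: "(\<lambda>z. g \<omega> (fst z) (snd z)) \<in> borel_measurable (borel \<Otimes>\<^sub>M borel)" unfolding g_def by measurable
  note * = triangle_integral[OF m, of t "(2 * pi) powr (-(3/2)) * \<epsilon> powr (-2)"]
  show ?goal1
    by (rule *) (simp add: g_def abs_partial_deriv_heat_kernel_le[OF \<epsilon>])
  show ?goal2
  proof -
    have "(LINT z|(Icc_square t). (if in_triangle t z then g \<omega> (fst z) (snd z) else 0)) =
        (LINT s:{0..t}|lborel. LINT r:{0..s}|lborel. g \<omega> s r)"
      by (rule *) (simp add: g_def abs_partial_deriv_heat_kernel_le[OF \<epsilon>])
    then show ?thesis by (simp add: alpha_hat_def g_def)
  qed
qed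

text \<open>Holds for every path of the modification: both parts are bounded on the triangle, so
  their integrals can be separated.\<close>

lemma alpha_hat_decomposition:
  assumes \<epsilon>: "0 < \<epsilon>" and t: "0 < t"
  shows "alpha_hat 1 X t \<epsilon> \<omega> = first_chaos t \<epsilon> \<omega> + error_integral t \<epsilon> \<omega>"
proof -
  define g where "g = (\<lambda>s r. partial_deriv 1 (heat_kernel \<epsilon>) (X s \<omega> - X r \<omega>))"
  define f where "f = (\<lambda>s. X s \<omega> $ 1)"
  define l where "l = (\<lambda>s r. (\<epsilon> + \<bar>s - r\<bar> powr p) powr (-(5/2)) * (f s - f r))"
  define c where "c = (2 * pi) powr (-(3/2))"
  let ?Q = "Icc_square t"
  let ?r = "\<lambda>h z. if in_triangle t z then h (fst z) (snd z) else (0::real)"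
  have f: "continuous_on UNIV f" unfolding f_def by (intro continuous_intros continuous_X)
  have [measurable]: "f \<in> borel_measurable borel" by (rule borel_measurable_continuous_onI[OF f])
  obtain M where M: "\<And>s. s \<in> {0..t} \<Longrightarrow> \<bar>f s\<bar> \<le> M" by (rule increment_average[OF f t]) blast
  have lm: "(\<lambda>z. l (fst z) (snd z)) \<in> borel_measurable (borel \<Otimes>\<^sub>M borel)" unfolding l_def by measurable
  have lb: "\<bar>l s r\<bar> \<le> \<epsilon> powr (-(5/2)) * (2 * M)" if "0 \<le> r" "r \<le> s" "s \<le> t" for r s
  proof -
    have "(\<epsilon> + \<bar>s - r\<bar> powr p) powr (-(5/2)) \<le> \<epsilon> powr (-(5/2))" using \<epsilon> by (intro powr_mono2') auto
    moreover have "\<bar>f s - f r\<bar> \<le> 2 * M" using M[of s] M[of r] that by auto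
    ultimately show ?thesis unfolding l_def abs_mult by (intro mult_mono) auto
  qed
  have L: "integrable ?Q (?r l)" "(LINT z|?Q. ?r l z) = (LINT s:{0..t}|lborel. LINT r:{0..s}|lborel. l s r)"
    using triangle_integral[where t=t, OF lm] lb by blast+
  have G: "integrable ?Q (?r g)" "(LINT z|?Q. ?r g z) = alpha_hat 1 X t \<epsilon> \<omega>"
    unfolding g_def by (rule gradient_X_triangle[OF \<epsilon>])+
  have "error_integral t \<epsilon> \<omega> = (LINT z|?Q. (?r g z + c * ?r l z))"
    unfolding error_integral_def
    by (intro Bochner_Integration.integral_cong refl)
       (simp add: restricted_error_def chaos_error_of_def g_def l_def f_def c_def)
  also have "\<dots> = (LINT z|?Q. ?r g z) + (LINT z|?Q. c * ?r l z)"
    by (rule Bochner_Integration.integral_add[OF G(1)]) (rule integrable_mult_right, rule L(1))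
  also have "(LINT z|?Q. c * ?r l z) = c * (LINT z|?Q. ?r l z)" by (rule integral_mult_right_zero)
  also have "(LINT z|?Q. ?r g z) = alpha_hat 1 X t \<epsilon> \<omega>" by (rule G(2))
  also have "(LINT z|?Q. ?r l z) = (LINT s:{0..t}|lborel. LINT r:{0..s}|lborel. l s r)" by (rule L(2))
  finally show ?thesis by (simp add: first_chaos_def l_def f_def c_def)
qed

lemma measurable_error_integral:
  assumes "0 < \<epsilon>"
  shows "error_integral t \<epsilon> \<in> borel_measurable M"
proof -
  interpret Q: finite_measure "Icc_measure t" by (rule finite_Icc_measure)
  interpret QQ: finite_measure "Icc_square t" by (rule finite_measure_pair_measure) unfold_locales
  have sf: "sigma_finite_measure (Icc_square t)" by unfold_locales
  note [measurable] = measurable_restricted_error[OF assms, of t]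
  show ?thesis unfolding error_integral_def[abs_def]
    by (rule sigma_finite_measure.borel_measurable_lebesgue_integral[OF sf]) measurable
qed

lemma measurable_alpha_hat_X:
  assumes "0 < \<epsilon>"
  shows "alpha_hat 1 X t \<epsilon> \<in> borel_measurable M"
proof -
  interpret Q: finite_measure "Icc_measure t" by (rule finite_Icc_measure)
  interpret QQ: finite_measure "Icc_square t" by (rule finite_measure_pair_measure) unfold_locales
  have sf: "sigma_finite_measure (Icc_square t)" by unfold_locales
  note [measurable] = measurable_partial_deriv_heat_kernel[OF assms]
  have [measurable]: "(\<lambda>x. X (fst (snd x)) (fst x)) \<in> borel_measurable (M \<Otimes>\<^sub>M (Icc_square t))"
    "(\<lambda>x. X (snd (snd x)) (fst x)) \<in> borel_measurable (M \<Otimes>\<^sub>M (Icc_square t))"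
    using measurable_compose[OF _ measurable_X, of "\<lambda>x. (fst (snd x), fst x)" "M \<Otimes>\<^sub>M (Icc_square t)"]
      measurable_compose[OF _ measurable_X, of "\<lambda>x. (snd (snd x), fst x)" "M \<Otimes>\<^sub>M (Icc_square t)"]
    by simp_all
  have "(\<lambda>\<omega>. LINT z|(Icc_square t). (if in_triangle t z
        then partial_deriv 1 (heat_kernel \<epsilon>) (X (fst z) \<omega> - X (snd z) \<omega>) else 0)) \<in> borel_measurable M"
    by (rule sigma_finite_measure.borel_measurable_lebesgue_integral[OF sf]) (simp add: split_beta)
  then show ?thesis unfolding gradient_X_triangle(2)[OF assms] .
qed

text \<open>The functional reads the path only at times in \<open>{0..t}\<close>, where
  \<open>X\<close> and \<open>B\<close> agree outside one null event; hence the uniformity in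
  \<open>\<epsilon>\<close>.\<close>

lemma AE_alpha_hat_eq:
  assumes "0 < t"
  shows "AE \<omega> in M. \<forall>\<epsilon>. alpha_hat 1 X t \<epsilon> \<omega> = alpha_hat 1 B t \<epsilon> \<omega>"
  using AE_X_eq
proof eventually_elim
  case (elim \<omega>)
  show ?case
  proof
    fix \<epsilon>
    have "(LINT r:{0..s}|lborel. partial_deriv 1 (heat_kernel \<epsilon>) (X s \<omega> - X r \<omega>)) =
        (LINT r:{0..s}|lborel. partial_deriv 1 (heat_kernel \<epsilon>) (B s \<omega> - B r \<omega>))" if "0 \<le> s" for s
      using elim that by (intro set_lebesgue_integral_cong) auto
    then show "alpha_hat 1 X t \<epsilon> \<omega> = alpha_hat 1 B t \<epsilon> \<omega>"
      unfolding alpha_hat_def by (intro set_lebesgue_integral_cong) auto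
  qed
qed

lemma distr_increment:
  assumes t: "0 < t"
  shows "distr M borel (\<lambda>\<omega>. a * (X t \<omega> $ 1 - X 0 \<omega> $ 1)) = gaussian_law 0 (a\<^sup>2 * t powr p)"
proof -
  define c :: "real \<Rightarrow> real ^ 3" where "c = (\<lambda>\<tau>. (if \<tau> = 0 then - a else a) *\<^sub>R axis 1 1)"
  have comb: "(\<Sum>\<tau>\<in>{0, t}. c \<tau> \<bullet> B \<tau> \<omega>) = a * (B t \<omega> $ 1 - B 0 \<omega> $ 1)" for \<omega>
    using t by (simp add: c_def inner_axis inner_commute[of "axis 1 1"] algebra_simps)
  obtain v where v: "distr M borel (\<lambda>\<omega>. a * (B t \<omega> $ 1 - B 0 \<omega> $ 1)) = gaussian_law 0 v"
    "v = expectation (\<lambda>\<omega>. (a * (B t \<omega> $ 1 - B 0 \<omega> $ 1))\<^sup>2)"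
    using gaussian_combination[of "{0, t}" c] t unfolding comb by auto
  have "v = a\<^sup>2 * expectation (\<lambda>\<omega>. (B t \<omega> $ 1 - B 0 \<omega> $ 1) * (B t \<omega> $ 1 - B 0 \<omega> $ 1))"
    unfolding v(2) power_mult_distrib by (simp only: integral_mult_right_zero power2_eq_square)
  also have "\<dots> = a\<^sup>2 * t powr p"
    using t by (simp add: increment_covariance(2) fbm_incr_cov_def)
  finally have "v = a\<^sup>2 * t powr p" .
  moreover have "distr M borel (\<lambda>\<omega>. a * (X t \<omega> $ 1 - X 0 \<omega> $ 1)) = distr M borel (\<lambda>\<omega>. a * (B t \<omega> $ 1 - B 0 \<omega> $ 1))"
  proof (rule distr_cong_AE)
    show "AE \<omega> in M. a * (X t \<omega> $ 1 - X 0 \<omega> $ 1) = a * (B t \<omega> $ 1 - B 0 \<omega> $ 1)"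
      using AE_X_eq by eventually_elim (use t in simp)
    note [measurable] = measurable_X_fixed
    show "(\<lambda>\<omega>. a * (X t \<omega> $ 1 - X 0 \<omega> $ 1)) \<in> borel_measurable M"
      unfolding cart_eq_inner_axis by measurable
    show "(\<lambda>\<omega>. a * (B t \<omega> $ 1 - B 0 \<omega> $ 1)) \<in> borel_measurable M"
      using t by (intro borel_measurable_times borel_measurable_diff measurable_B_nth) auto
  qed simp_all
  ultimately show ?thesis using v(1) by simp
qed

text \<open>Two steps of the Gamma recursion give
  \<open>Beta 2 (2 * H - 1) = 1 / (2 * H * (2 * H - 1))\<close>. This cancels the factor
  \<open>2 * H - 1\<close>, and what remains is the squared constant of the pathwise limit times the
  variance of \<open>B t $ 1 - B 0 $ 1\<close>.\<close>

lemma sigma2_squared_eq: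
  "sigma2_squared H t = ((2 * pi) powr (-(3/2)) * (Beta (2/p) (5/2 - 2/p) / p))\<^sup>2 * t powr p"
proof -
  have H: "0 < 2 * H - 1" "0 < H" using H_gt by auto
  have G0: "0 < Gamma (2 * H - 1)" using H by (intro Gamma_real_pos)
  have n: "2 * H \<notin> \<int>\<^sub>\<le>\<^sub>0" "2 * H - 1 \<notin> \<int>\<^sub>\<le>\<^sub>0"
    using H by (auto dest: nonpos_Ints_nonpos)
  have "Beta 2 (2 * H - 1) = Gamma (2 * H - 1) / Gamma (2 + (2 * H - 1))"
    by (simp add: Beta_def Gamma_numeral)
  also have "Gamma (2 + (2 * H - 1)) = 2 * H * Gamma (2 * H)"
    using Gamma_plus1[of "2 * H"] n by (simp add: add.commute)
  also have "Gamma (2 * H) = (2 * H - 1) * Gamma (2 * H - 1)"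
    using Gamma_plus1[of "2 * H - 1"] n by simp
  finally have b: "Beta 2 (2 * H - 1) = 1 / (2 * H * (2 * H - 1))"
    using H G0 by simp
  have e: "2/p = 1/H" "5/2 - 2/p = (5 * H - 2) / (2 * H)"
    using H by (simp_all add: p_def field_simps)
  have "((2 * pi) powr (-(3/2)))\<^sup>2 = (2 * pi) powr (-3)"
    by (simp add: power2_eq_square powr_add[symmetric])
  also have "\<dots> = 1 / (8 * pi ^ 3)"
    by (simp add: powr_minus_divide powr_numeral power_mult_distrib)
  finally have s: "((2 * pi) powr (-(3/2)))\<^sup>2 = 1 / (8 * pi ^ 3)" .
  show ?thesis
    unfolding sigma2_squared_def b power_mult_distrib power_divide s e
    using H by (simp add: p_def field_simps power2_eq_square)
qed

lemma alpha_hat_weak_convergence: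
  assumes t: "0 < t" and e: "\<And>n. 0 < e n" "e \<longlonglongrightarrow> 0"
  shows "weak_conv_m (\<lambda>n. distr M borel (\<lambda>\<omega>. e n powr (5/2 - 2/p) * alpha_hat 1 X t (e n) \<omega>)) (gaussian_law 0 (sigma2_squared H t))"
proof -
  obtain C \<gamma> where C: "0 < \<gamma>"
    "\<And>\<epsilon>. 0 < \<epsilon> \<Longrightarrow> integrable M (\<lambda>\<omega>. (error_integral t \<epsilon> \<omega>)\<^sup>2)"
    "\<And>\<epsilon>. 0 < \<epsilon> \<Longrightarrow> \<epsilon> powr (5 - 4/p) * expectation (\<lambda>\<omega>. (error_integral t \<epsilon> \<omega>)\<^sup>2) \<le> C * \<epsilon> powr \<gamma>"
    by (rule second_moment_error[OF t, folded error_integral_def]) (rule that)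
  \<comment> \<open>The sign is that of the derivative of the heat kernel; it disappears in the
    variance.\<close>
  define a where "a = - ((2 * pi) powr (-(3/2)) * (Beta (2/p) (5/2 - 2/p) / p))"
  define S where "S = (\<lambda>n. e n powr (5/2 - 2/p))"
  have S2: "(S n)\<^sup>2 = e n powr (5 - 4/p)" for n
    by (simp add: S_def power2_eq_square powr_add[symmetric])
  note [measurable] = measurable_alpha_hat_X[OF e(1), of t] measurable_error_integral[OF e(1), of t] measurable_X_fixed
  have fc: "first_chaos t (e n) = (\<lambda>\<omega>. alpha_hat 1 X t (e n) \<omega> - error_integral t (e n) \<omega>)" for n
    using alpha_hat_decomposition[OF e(1) t] by (auto simp: fun_eq_iff)
  have [measurable]: "first_chaos t (e n) \<in> borel_measurable M" for n
    unfolding fc by measurable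
  have diff: "(S n * alpha_hat 1 X t (e n) \<omega> - S n * first_chaos t (e n) \<omega>)\<^sup>2 = (S n)\<^sup>2 * (error_integral t (e n) \<omega>)\<^sup>2" for n \<omega>
    unfolding alpha_hat_decomposition[OF e(1) t] distrib_left add_diff_cancel_left' power_mult_distrib ..
  have "weak_conv_m (\<lambda>n. distr M borel (\<lambda>\<omega>. S n * alpha_hat 1 X t (e n) \<omega>)) (distr M borel (\<lambda>\<omega>. a * (X t \<omega> $ 1 - X 0 \<omega> $ 1)))"
  proof (rule weak_conv_if_L2_close[where Z="\<lambda>n \<omega>. S n * first_chaos t (e n) \<omega>"])
    show "integrable M (\<lambda>\<omega>. (S n * alpha_hat 1 X t (e n) \<omega> - S n * first_chaos t (e n) \<omega>)\<^sup>2)" for n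
      unfolding diff using C(2)[OF e(1)] by simp
    show "(\<lambda>n. expectation (\<lambda>\<omega>. (S n * alpha_hat 1 X t (e n) \<omega> - S n * first_chaos t (e n) \<omega>)\<^sup>2)) \<longlonglongrightarrow> 0"
    proof (rule Lim_null_comparison)
      show "\<forall>\<^sub>F n in sequentially. norm (expectation (\<lambda>\<omega>. (S n * alpha_hat 1 X t (e n) \<omega> - S n * first_chaos t (e n) \<omega>)\<^sup>2)) \<le> C * e n powr \<gamma>"
        unfolding diff using C(3)[OF e(1)] by (intro always_eventually allI) (simp add: S2)
      have "(\<lambda>n. e n powr \<gamma>) \<longlonglongrightarrow> 0 powr \<gamma>"
        using e C(1) by (intro tendsto_powr2) (auto intro: less_imp_le always_eventually)
      then show "(\<lambda>n. C * e n powr \<gamma>) \<longlonglongrightarrow> 0" by (intro tendsto_mult_right_zero) simp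
    qed
    show "AE \<omega> in M. (\<lambda>n. S n * first_chaos t (e n) \<omega>) \<longlonglongrightarrow> a * (X t \<omega> $ 1 - X 0 \<omega> $ 1)"
    proof (intro AE_I2)
      fix \<omega>
      have "continuous_on UNIV (\<lambda>s. X s \<omega> $ 1)" by (intro continuous_intros continuous_X)
      from tendsto_mult_left[OF first_chaos_limit[OF this t p_bounds(1) e], of "- ((2 * pi) powr (-(3/2)))"]
      show "(\<lambda>n. S n * first_chaos t (e n) \<omega>) \<longlonglongrightarrow> a * (X t \<omega> $ 1 - X 0 \<omega> $ 1)"
        by (simp add: S_def first_chaos_def a_def mult_ac)
    qed
    show "(\<lambda>\<omega>. a * (X t \<omega> $ 1 - X 0 \<omega> $ 1)) \<in> borel_measurable M"
      unfolding cart_eq_inner_axis by measurable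
  qed measurable
  then show ?thesis
    unfolding distr_increment[OF t] sigma2_squared_eq S_def a_def power2_minus .
qed

end

theorem theorem1p6:
  fixes M :: "'a measure" and B :: "real \<Rightarrow> 'a \<Rightarrow> real ^ 3" and H t :: real
  assumes "prob_space M"
    and "1 / 2 < H" and "H < 2 / 3"
    and "0 < t"
    and "fractional_brownian_motion M H B"
  shows "converges_in_distribution_at_0 M
           (\<lambda>\<epsilon> \<omega>. \<epsilon> powr (5 / 2 - 1 / H) * alpha_hat 1 B t \<epsilon> \<omega>)
           (gaussian_law 0 (sigma2_squared H t))"
proof -
  interpret prob_space M by fact
  interpret fbm3 M B H "2 * H" by unfold_locales (use assms in auto)
  have eq: "AE \<omega> in M. \<epsilon> powr (5/2 - 1/H) * alpha_hat 1 X t \<epsilon> \<omega> = \<epsilon> powr (5/2 - 1/H) * alpha_hat 1 B t \<epsilon> \<omega>" for \<epsilon>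
    using AE_alpha_hat_eq[OF \<open>0 < t\<close>] by eventually_elim simp
  have mX: "(\<lambda>\<omega>. \<epsilon> powr (5/2 - 1/H) * alpha_hat 1 X t \<epsilon> \<omega>) \<in> borel_measurable M" if "0 < \<epsilon>" for \<epsilon>
    using measurable_alpha_hat_X[OF that] by measurable
  have mB: "(\<lambda>\<omega>. \<epsilon> powr (5/2 - 1/H) * alpha_hat 1 B t \<epsilon> \<omega>) \<in> borel_measurable (completion M)" if "0 < \<epsilon>" for \<epsilon>
    by (rule borel_measurable_completion_cong_AE[OF mX[OF that] eq])
  \<comment> \<open>Neither passing to the completion nor replacing \<open>B\<close> by its
    modification changes the law, so the limit proved for \<open>X\<close> on \<open>M\<close>
    transfers.\<close>
  have d: "distr (completion M) borel (\<lambda>\<omega>. \<epsilon> powr (5/2 - 1/H) * alpha_hat 1 B t \<epsilon> \<omega>) =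
      distr M borel (\<lambda>\<omega>. \<epsilon> powr (5/2 - 1/H) * alpha_hat 1 X t \<epsilon> \<omega>)" if "0 < \<epsilon>" for \<epsilon>
  proof -
    have "distr (completion M) borel (\<lambda>\<omega>. \<epsilon> powr (5/2 - 1/H) * alpha_hat 1 B t \<epsilon> \<omega>) =
        distr (completion M) borel (\<lambda>\<omega>. \<epsilon> powr (5/2 - 1/H) * alpha_hat 1 X t \<epsilon> \<omega>)"
    proof (rule distr_cong_AE)
      have "AE \<omega> in completion M. \<epsilon> powr (5/2 - 1/H) * alpha_hat 1 X t \<epsilon> \<omega> = \<epsilon> powr (5/2 - 1/H) * alpha_hat 1 B t \<epsilon> \<omega>"
        by (rule AE_completion[OF eq])
      then show "AE \<omega> in completion M. \<epsilon> powr (5/2 - 1/H) * alpha_hat 1 B t \<epsilon> \<omega> = \<epsilon> powr (5/2 - 1/H) * alpha_hat 1 X t \<epsilon> \<omega>"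
        by (rule eventually_mono) (erule sym)
    qed (rule refl mB[OF that] measurable_completion[OF mX[OF that]])+
    then show ?thesis using distr_completion[OF mX[OF that]] by simp
  qed
  show ?thesis
    unfolding converges_in_distribution_at_0_def
  proof (intro conjI allI impI)
    fix e :: "nat \<Rightarrow> real" assume e: "(\<forall>n. 0 < e n) \<and> e \<longlonglongrightarrow> 0"
    then have "weak_conv_m (\<lambda>n. distr M borel (\<lambda>\<omega>. e n powr (5/2 - 2/(2 * H)) * alpha_hat 1 X t (e n) \<omega>)) (gaussian_law 0 (sigma2_squared H t))"
      by (intro alpha_hat_weak_convergence assms) auto
    then show "weak_conv_m (\<lambda>n. distr (completion M) borel (\<lambda>\<omega>. e n powr (5/2 - 1/H) * alpha_hat 1 B t (e n) \<omega>)) (gaussian_law 0 (sigma2_squared H t))"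
      using e by (simp add: d)
  qed (rule mB)
qed

end
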